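(* $\Gamma_{6,3}=\Sigma_{6,3}$; that is, a matrix in $\mathcal{Q}(2)\otimes\mathcal{S}(3)$ is $Q_+(2)\otimes S_+(3)$-separable if and only if it is a PPT matrix.
   Context: $\mathcal{S}(3)$ is the real vector space of real symmetric $3\times 3$ matrices and $S_+(3)$ its cone of positive semidefinite (PSD) matrices. $\mathcal{Q}(N)$ is the real vector space of quaternionic hermitian $N\times N$ matrices ($A=A^*$, with $*$ the quaternionic conjugate transpose) and $Q_+(N)$ its cone of PSD matrices ($v^*Av\ge 0$ for all $v\in\mathbb{H}^N$). The (real) tensor product $\mathcal{Q}(2)\otimes\mathcal{S}(3)$ is regarded as a subspace of $\mathcal{Q}(6)$ via the Kronecker product; it consists of the quaternionic hermitian $6\times6$ matrices $\begin{pmatrix}B_{11}&B_{12}\\ B_{21}&B_{22}\end{pmatrix}$ whose four $3\times3$ blocks are all symmetric (so $B_{21}=\overline{B_{12}}$ and $B_{11},B_{22}$ are real). Its partial transpose is $\begin{pmatrix}B_{11}&B_{21}\\ B_{12}&B_{22}\end{pmatrix}$. A matrix is PPT if it and its partial transpose are both PSD. $\Gamma_{6,3}$ is the cone of PPT matrices in $\mathcal{Q}(2)\otimes\mathcal{S}(3)$. A matrix is $Q_+(2)\otimes S_+(3)$-separable if it is a finite sum $\sum_l A_l\otimes B_l$ with $A_l\in Q_+(2)$, $B_l\in S_+(3)$; $\Sigma_{6,3}$ is the cone of such matrices. *)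

theory Defs
  imports "HOL-Analysis.Analysis"
begin

datatype quat = Quat (qRe: real) (qI: real) (qJ: real) (qK: real)

lemma quat_eq_iff:
  "x = y \<longleftrightarrow> qRe x = qRe y \<and> qI x = qI y \<and> qJ x = qJ y \<and> qK x = qK y"
  by (cases x; cases y) auto

instantiation quat :: ring_1
begin

definition "0 = Quat 0 0 0 0"
definition "1 = Quat 1 0 0 0"
definition "- x = Quat (- qRe x) (- qI x) (- qJ x) (- qK x)"
definition "x + y = Quat (qRe x + qRe y) (qI x + qI y) (qJ x + qJ y) (qK x + qK y)"
definition "x - y = Quat (qRe x - qRe y) (qI x - qI y) (qJ x - qJ y) (qK x - qK y)"
definition "x * y = Quat
  (qRe x * qRe y - qI x * qI y - qJ x * qJ y - qK x * qK y)
  (qRe x * qI y + qI x * qRe y + qJ x * qK y - qK x * qJ y)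
  (qRe x * qJ y - qI x * qK y + qJ x * qRe y + qK x * qI y)
  (qRe x * qK y + qI x * qJ y - qJ x * qI y + qK x * qRe y)"

instance
  by standard
    (simp_all add: quat_eq_iff zero_quat_def one_quat_def uminus_quat_def plus_quat_def
      minus_quat_def times_quat_def algebra_simps)

end

instantiation quat :: real_algebra_1
begin

definition "r *\<^sub>R x = Quat (r * qRe x) (r * qI x) (r * qJ x) (r * qK x)"

instance
  by standard
    (simp_all add: quat_eq_iff plus_quat_def times_quat_def scaleR_quat_def algebra_simps)

end

definition qcnj :: "quat \<Rightarrow> quat"
  where "qcnj x = Quat (qRe x) (- qI x) (- qJ x) (- qK x)"

lemma quat_units:
  defines "i \<equiv> Quat 0 1 0 0" and "j \<equiv> Quat 0 0 1 0" and "k \<equiv> Quat 0 0 0 1"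
  shows "i * i = -1" "j * j = -1" "k * k = -1" "i * j = k" "j * k = i" "k * i = j"
    "j * i = - k" "k * j = - i" "i * k = - j"
  by (simp_all add: i_def j_def k_def quat_eq_iff times_quat_def uminus_quat_def one_quat_def)

lemma qcnj_mult: "qcnj (x * y) = qcnj y * qcnj x"
  by (simp add: quat_eq_iff qcnj_def times_quat_def algebra_simps)

lemma qcnj_add: "qcnj (x + y) = qcnj x + qcnj y"
  by (simp add: quat_eq_iff qcnj_def plus_quat_def)

lemma qcnj_scaleR: "qcnj (r *\<^sub>R x) = r *\<^sub>R qcnj x"
  by (simp add: quat_eq_iff qcnj_def scaleR_quat_def)

lemma qcnj_qcnj: "qcnj (qcnj x) = x"
  by (simp add: quat_eq_iff qcnj_def)

lemma qcnj_zero: "qcnj 0 = 0"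
  by (simp add: quat_eq_iff qcnj_def zero_quat_def)

definition qadjoint :: "quat^'n^'m \<Rightarrow> quat^'m^'n"
  where "qadjoint A = (\<chi> i j. qcnj (A $ j $ i))"

definition quat_herm :: "(quat^'n^'n) set"
  where "quat_herm = {A. qadjoint A = A}"

text \<open>The quaternion \<open>v\<^sup>* A v\<close>.\<close>

definition quat_form :: "quat^'n^'n \<Rightarrow> quat^'n \<Rightarrow> quat"
  where "quat_form A v = (\<Sum>i\<in>UNIV. qcnj (v $ i) * (A *v v) $ i)"

definition quat_psd :: "(quat^'n^'n) set"
  where "quat_psd = {A \<in> quat_herm. \<forall>v. quat_form A v \<in> \<real>\<^sub>\<ge>\<^sub>0}"

definition real_sym :: "(real^'n^'n) set"
  where "real_sym = {B. transpose B = B}"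

definition real_psd :: "(real^'n^'n) set"
  where "real_psd = {B \<in> real_sym. \<forall>v. 0 \<le> v \<bullet> (B *v v)}"

text \<open>
  Block matrices are indexed by pairs: the entry \<open>M $ (i, a) $ (j, b)\<close> is the entry at
  position \<open>(a, b)\<close> of the block at position \<open>(i, j)\<close>.
\<close>

definition kron :: "quat^'n^'n \<Rightarrow> real^'m^'m \<Rightarrow> quat^('n \<times> 'm)^('n \<times> 'm)"
  where "kron A B = (\<chi> p q. (B $ snd p $ snd q) *\<^sub>R (A $ fst p $ fst q))"

definition herm_tensor_sym :: "(quat^('n::finite \<times> 'm::finite)^('n \<times> 'm)) set"
  where "herm_tensor_sym = span {kron A B | A B. A \<in> quat_herm \<and> B \<in> real_sym}"

lemma herm_tensor_sym_iff:
  fixes M :: "quat^('n::finite \<times> 'm::finite)^('n \<times> 'm)"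
  shows "M \<in> herm_tensor_sym \<longleftrightarrow>
    M \<in> quat_herm \<and> (\<forall>i j a b. M $ (i, a) $ (j, b) = M $ (i, b) $ (j, a))"
proof
  let ?T = "{M :: quat^('n \<times> 'm)^('n \<times> 'm).
    M \<in> quat_herm \<and> (\<forall>i j a b. M $ (i, a) $ (j, b) = M $ (i, b) $ (j, a))}"
  have "subspace ?T"
    by (simp add: subspace_def quat_herm_def qadjoint_def vec_eq_iff qcnj_add qcnj_scaleR
        qcnj_zero)
  moreover have "{kron A B | A B. A \<in> quat_herm \<and> B \<in> real_sym} \<subseteq> ?T"
    by (auto simp: quat_herm_def real_sym_def qadjoint_def kron_def vec_eq_iff transpose_def
        qcnj_scaleR)
  ultimately have "herm_tensor_sym \<subseteq> ?T"
    unfolding herm_tensor_sym_def by (rule span_minimal[rotated])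
  then show "M \<in> herm_tensor_sym \<Longrightarrow>
    M \<in> quat_herm \<and> (\<forall>i j a b. M $ (i, a) $ (j, b) = M $ (i, b) $ (j, a))" by blast
next
  assume *: "M \<in> quat_herm \<and> (\<forall>i j a b. M $ (i, a) $ (j, b) = M $ (i, b) $ (j, a))"
  define C where "C a b = (\<chi> i j. M $ (i, a) $ (j, b))" for a b
  define E :: "'m \<Rightarrow> 'm \<Rightarrow> real^'m^'m" where
    "E a b = (\<chi> c d. (of_bool (c = a \<and> d = b) + of_bool (c = b \<and> d = a)) / 2)" for a b
  have herm: "qcnj (M $ p $ q) = M $ q $ p" for p q
    using * by (cases p; cases q) (simp add: quat_herm_def qadjoint_def vec_eq_iff)
  have C: "C a b \<in> quat_herm" for a b
    using * by (simp add: C_def quat_herm_def qadjoint_def vec_eq_iff herm)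
  have E: "E a b \<in> real_sym" for a b
    by (simp add: E_def real_sym_def transpose_def vec_eq_iff conj_commute add.commute)
  have pick: "(\<Sum>a\<in>UNIV. \<Sum>b\<in>UNIV. if c = a then if d = b then f a b else 0 else 0) = f c d"
    for f :: "'m \<Rightarrow> 'm \<Rightarrow> quat" and c d
  proof -
    have "(\<Sum>b\<in>UNIV. if c = a then if d = b then f a b else 0 else 0)
        = (if c = a then f a d else 0)" for a
      by (cases "c = a") simp_all
    then show ?thesis by simp
  qed
  have "(\<Sum>a\<in>UNIV. \<Sum>b\<in>UNIV. kron (C a b) (E a b)) $ (i, c) $ (j, d) = M $ (i, c) $ (j, d)"
    for i j c d
  proof -
    have "(\<Sum>a\<in>UNIV. \<Sum>b\<in>UNIV. kron (C a b) (E a b)) $ (i, c) $ (j, d)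
      = (\<Sum>a\<in>UNIV. \<Sum>b\<in>UNIV.
          (if c = a then if d = b then (1/2) *\<^sub>R M $ (i, a) $ (j, b) else 0 else 0)
        + (if d = a then if c = b then (1/2) *\<^sub>R M $ (i, a) $ (j, b) else 0 else 0))"
      unfolding sum_component
      by (intro sum.cong refl) (simp add: kron_def C_def E_def scaleR_left_distrib[symmetric])
    also have "\<dots> = (1/2) *\<^sub>R M $ (i, c) $ (j, d) + (1/2) *\<^sub>R M $ (i, d) $ (j, c)"
      by (simp only: sum.distrib pick)
    also have "\<dots> = M $ (i, c) $ (j, d)"
      using * by (simp add: scaleR_left_distrib[symmetric])
    finally show ?thesis .
  qed
  then have "M = (\<Sum>a\<in>UNIV. \<Sum>b\<in>UNIV. kron (C a b) (E a b))"
    by (simp add: vec_eq_iff)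
  also have "\<dots> \<in> herm_tensor_sym"
    unfolding herm_tensor_sym_def using C E by (intro span_sum span_base) blast
  finally show "M \<in> herm_tensor_sym" .
qed

text \<open>
  Transposition acts on the block indices only: it exchanges the off-diagonal blocks and leaves
  the entries inside each block in place.
\<close>

definition partial_transpose ::
    "quat^('n::finite \<times> 'm::finite)^('n \<times> 'm) \<Rightarrow> quat^('n \<times> 'm)^('n \<times> 'm)"
  where "partial_transpose M = (\<chi> p q. M $ (fst q, snd p) $ (fst p, snd q))"

definition PPT :: "quat^('n::finite \<times> 'm::finite)^('n \<times> 'm) \<Rightarrow> bool"
  where "PPT M \<longleftrightarrow> M \<in> quat_psd \<and> partial_transpose M \<in> quat_psd"

definition separable :: "quat^('n::finite \<times> 'm::finite)^('n \<times> 'm) \<Rightarrow> bool"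
  where "separable M \<longleftrightarrow>
    (\<exists>(N::nat) A B. (\<forall>l<N. A l \<in> quat_psd \<and> B l \<in> real_psd) \<and> M = (\<Sum>l<N. kron (A l) (B l)))"

definition Gamma_6_3 :: "(quat^(2 \<times> 3)^(2 \<times> 3)) set"
  where "Gamma_6_3 = {M \<in> herm_tensor_sym. PPT M}"

definition Sigma_6_3 :: "(quat^(2 \<times> 3)^(2 \<times> 3)) set"
  where "Sigma_6_3 = {M. separable M}"

end

theory Submission
  imports Defs
begin

text \<open>
  Separability is dual to block positivity: a functional that is nonnegative on all products
  \<open>A \<otimes> v v\<^sup>T\<close> is a quadratic map \<open>Z\<close> from \<open>\<real>\<^sup>3\<close> into the positive semidefinite
  quaternionic \<open>2 \<times> 2\<close> matrices, while a PPT matrix is a functional that is nonnegative on the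
  quadratic maps \<open>(|c|\<^sup>2, |d|\<^sup>2, c d\<^sup>*)\<close> and \<open>(|c|\<^sup>2, |d|\<^sup>2, d\<^sup>* c)\<close> with \<open>c, d\<close> linear. So
  every \<open>Z\<close> has to be a limit of sums of such squares.

  After a perturbation, subtract from \<open>Z\<close> the largest possible multiple \<open>|v|\<^sup>2 N\<close> of a constant
  matrix, measured by \<open>det N\<close>. As in John's theorem, the remainder touches the boundary of the
  cone in two different directions, which the symmetries of the cone move to the two diagonal
  entries: one diagonal entry vanishes at a vector \<open>v\<^sub>1\<close>, the other one at \<open>v\<^sub>2\<close>. If these vectors
  are independent, then \<open>Z = (|x|\<^sup>2, |y|\<^sup>2, \<beta>(x, y))\<close> with \<open>x, y\<close> linear maps to \<open>\<real>\<^sup>2\<close> and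
  \<open>\<beta> : \<real>\<^sup>2 \<times> \<real>\<^sup>2 \<rightarrow> \<H>\<close> a bilinear contraction. By Krein-Milman \<open>\<beta>\<close> may be taken
  extreme; then Finsler's lemma shows \<open>|\<beta>(x, y)| = |x| |y|\<close>, and such a \<open>\<beta>\<close> is quaternion
  multiplication in one of the two orders, i.e. \<open>Z\<close> is a square.
\<close>

section \<open>Quaternions as a Euclidean space\<close>

text \<open>Moving a constant matrix can raise its determinant only if that determinant is positive;
  the perturbation ensures this by keeping \<open>Z\<close> uniformly inside the cone on the unit
  sphere. If \<open>v\<^sub>1\<close> and \<open>v\<^sub>2\<close> are dependent, both diagonal
  entries vanish at one vector, so the whole matrix vanishes there and \<open>Z\<close> lives on the
  orthogonal plane. A zero is a contact in every direction, so one further contact in that plane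
  restores two independent null vectors. Dimension three produces the bilinear map: one diagonal
  entry depends on coordinates x, z only, the other on y, z only, so the determinant bound excludes
  x^2 and y^2 from the off-diagonal entry; scaling (x, z) and (y, z) separately then splits the
  shared z into two independent variables. Extremality of \<beta> is exploited by a rank-one change
  of \<beta>, which can be found because the quaternions have the same dimension 4 as the real 2 x 2
  matrices on which \<beta> acts.\<close>

lemma quat_sel_simps [simp]:
  "qRe 0 = 0" "qI 0 = 0" "qJ 0 = 0" "qK 0 = 0"
  "qRe 1 = 1" "qI 1 = 0" "qJ 1 = 0" "qK 1 = 0"
  "qRe (- x) = - qRe x" "qI (- x) = - qI x" "qJ (- x) = - qJ x" "qK (- x) = - qK x"
  "qRe (x + y) = qRe x + qRe y" "qI (x + y) = qI x + qI y"
  "qJ (x + y) = qJ x + qJ y" "qK (x + y) = qK x + qK y"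
  "qRe (x - y) = qRe x - qRe y" "qI (x - y) = qI x - qI y"
  "qJ (x - y) = qJ x - qJ y" "qK (x - y) = qK x - qK y"
  "qRe (r *\<^sub>R x) = r * qRe x" "qI (r *\<^sub>R x) = r * qI x"
  "qJ (r *\<^sub>R x) = r * qJ x" "qK (r *\<^sub>R x) = r * qK x"
  "qRe (qcnj x) = qRe x" "qI (qcnj x) = - qI x" "qJ (qcnj x) = - qJ x" "qK (qcnj x) = - qK x"
  by (simp_all add: zero_quat_def one_quat_def uminus_quat_def plus_quat_def minus_quat_def
      scaleR_quat_def qcnj_def)

lemma quat_mult_sel:
  "qRe (x * y) = qRe x * qRe y - qI x * qI y - qJ x * qJ y - qK x * qK y"
  "qI (x * y) = qRe x * qI y + qI x * qRe y + qJ x * qK y - qK x * qJ y"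
  "qJ (x * y) = qRe x * qJ y - qI x * qK y + qJ x * qRe y + qK x * qI y"
  "qK (x * y) = qRe x * qK y + qI x * qJ y - qJ x * qI y + qK x * qRe y"
  by (simp_all add: times_quat_def)

instantiation quat :: real_inner
begin

definition "inner x y = qRe x * qRe y + qI x * qI y + qJ x * qJ y + qK x * qK y"
definition "norm (x :: quat) = sqrt (inner x x)"
definition "dist (x :: quat) y = norm (x - y)"
definition "sgn (x :: quat) = x /\<^sub>R norm x"
definition "uniformity = (INF e\<in>{0 <..}. principal {(x :: quat, y). dist x y < e})"
definition "open (U :: quat set) \<longleftrightarrow>
  (\<forall>x\<in>U. eventually (\<lambda>(x', y). x' = x \<longrightarrow> y \<in> U) uniformity)"

instance
proof
  fix x y z :: quat and r :: real and U :: "quat set"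
  show "dist x y = norm (x - y)" by (rule dist_quat_def)
  show "sgn x = x /\<^sub>R norm x" by (rule sgn_quat_def)
  show "uniformity = (INF e\<in>{0 <..}. principal {(x :: quat, y). dist x y < e})"
    by (rule uniformity_quat_def)
  show "open U \<longleftrightarrow> (\<forall>x\<in>U. eventually (\<lambda>(x', y). x' = x \<longrightarrow> y \<in> U) uniformity)"
    by (rule open_quat_def)
  show "x \<bullet> y = y \<bullet> x" by (simp add: inner_quat_def mult.commute)
  show "(x + y) \<bullet> z = x \<bullet> z + y \<bullet> z" by (simp add: inner_quat_def algebra_simps)
  show "(r *\<^sub>R x) \<bullet> y = r * (x \<bullet> y)" by (simp add: inner_quat_def algebra_simps)
  show "0 \<le> x \<bullet> x" by (simp add: inner_quat_def)
  show "x \<bullet> x = 0 \<longleftrightarrow> x = 0"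
  proof
    assume "x \<bullet> x = 0"
    then have "(qRe x)\<^sup>2 + (qI x)\<^sup>2 + (qJ x)\<^sup>2 + (qK x)\<^sup>2 = 0"
      by (simp add: inner_quat_def power2_eq_square)
    then have "(qRe x)\<^sup>2 = 0 \<and> (qI x)\<^sup>2 = 0 \<and> (qJ x)\<^sup>2 = 0 \<and> (qK x)\<^sup>2 = 0"
      using zero_le_power2[of "qRe x"] zero_le_power2[of "qI x"] zero_le_power2[of "qJ x"]
        zero_le_power2[of "qK x"] by linarith
    then show "x = 0" by (simp add: quat_eq_iff)
  qed (simp add: inner_quat_def)
  show "norm x = sqrt (x \<bullet> x)" by (rule norm_quat_def)
qed

end

text \<open>Adjoints, Krein-Milman and separating hyperplanes are applied to tuples and matrices of
  quaternions, which inherit their Euclidean structure from here.\<close>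

instantiation quat :: euclidean_space
begin

definition "Basis = {Quat 1 0 0 0, Quat 0 1 0 0, Quat 0 0 1 0, Quat 0 0 0 1}"

instance
proof
  show "(Basis :: quat set) \<noteq> {}" "finite (Basis :: quat set)"
    by (simp_all add: Basis_quat_def)
  fix u v x :: quat
  show "u \<in> Basis \<Longrightarrow> v \<in> Basis \<Longrightarrow> u \<bullet> v = (if u = v then 1 else 0)"
    unfolding Basis_quat_def by (elim insertE emptyE; simp add: inner_quat_def)
  show "(\<forall>u\<in>Basis. x \<bullet> u = 0) \<longleftrightarrow> x = 0"
    by (simp only: Basis_quat_def ball_simps inner_quat_def quat_eq_iff quat.sel quat_sel_simps)
      simp
qed

end

lemma DIM_quat [simp]: "DIM(quat) = 4"
  by (simp add: Basis_quat_def)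

lemma power2_norm_quat: "(norm x)\<^sup>2 = (qRe x)\<^sup>2 + (qI x)\<^sup>2 + (qJ x)\<^sup>2 + (qK x)\<^sup>2"
  unfolding power2_norm_eq_inner by (simp add: inner_quat_def power2_eq_square)

lemma norm_qcnj [simp]: "norm (qcnj x) = norm x"
  by (rule power2_eq_imp_eq) (simp_all add: power2_norm_quat)

lemma norm_quat_mult: "norm (x * y) = norm x * norm (y :: quat)"
  by (rule power2_eq_imp_eq)
    (simp_all only: power2_norm_quat power_mult_distrib quat_mult_sel, simp_all, algebra)

lemma norm_quat_one [simp]: "norm (1 :: quat) = 1"
  by (rule power2_eq_imp_eq) (simp_all add: power2_norm_quat)

lemma qRe_mult_commute: "qRe (x * y) = qRe (y * x)"
  by (simp add: quat_mult_sel)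

lemma quat_inner_qRe: "x \<bullet> y = qRe (qcnj x * y)" "x \<bullet> y = qRe (x * qcnj y)"
  by (simp_all add: inner_quat_def quat_mult_sel)

lemma inner_mult_left_cnj: "x \<bullet> (l * y) = (x * qcnj y) \<bullet> (l :: quat)"
  by (simp add: inner_quat_def quat_mult_sel algebra_simps)

lemma inner_mult_right_cnj: "x \<bullet> (y * l) = (qcnj y * x) \<bullet> (l :: quat)"
  by (simp add: inner_quat_def quat_mult_sel algebra_simps)

lemma inner_qcnj_qcnj [simp]: "qcnj x \<bullet> qcnj y = x \<bullet> y"
  by (simp add: inner_quat_def)

lemma inner_qcnj_left: "qcnj x \<bullet> y = x \<bullet> qcnj y"
  by (simp add: inner_quat_def)

lemma mult_qcnj_self: "x * qcnj x = (norm x)\<^sup>2 *\<^sub>R 1" "qcnj x * x = (norm x)\<^sup>2 *\<^sub>R 1"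
  unfolding power2_norm_quat by (simp_all add: quat_eq_iff quat_mult_sel power2_eq_square)

lemma linear_qcnj: "linear qcnj"
  by (simp add: linear_iff qcnj_add qcnj_scaleR)

lemma bounded_linear_quat:
  "bounded_linear qRe" "bounded_linear qI" "bounded_linear qJ" "bounded_linear qK"
  "bounded_linear qcnj"
  by (auto intro!: linear_conv_bounded_linear[THEN iffD1] simp: linear_iff qcnj_add qcnj_scaleR)

lemmas continuous_on_qcnj [continuous_intros] =
  bounded_linear.continuous_on[OF bounded_linear_quat(5)]


section \<open>Limits of sums of squares\<close>

text \<open>The triple \<open>(a, b, q)\<close> stands for the hermitian matrix with diagonal \<open>a, b\<close> and
  upper right entry \<open>q\<close>.\<close>

type_synonym herm2 = "real \<times> real \<times> quat"

definition psd2 :: "herm2 set"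
  where "psd2 = {(a, b, q). 0 \<le> a \<and> 0 \<le> b \<and> (norm q)\<^sup>2 \<le> a * b}"

text \<open>The products \<open>c d\<^sup>*\<close> and \<open>d\<^sup>* c\<close> correspond to positivity of a matrix and of its partial
  transpose, respectively.\<close>

definition sq1 :: "('v \<Rightarrow> quat) \<Rightarrow> ('v \<Rightarrow> quat) \<Rightarrow> 'v \<Rightarrow> herm2"
  where "sq1 c d v = ((norm (c v))\<^sup>2, (norm (d v))\<^sup>2, c v * qcnj (d v))"

definition sq2 :: "('v \<Rightarrow> quat) \<Rightarrow> ('v \<Rightarrow> quat) \<Rightarrow> 'v \<Rightarrow> herm2"
  where "sq2 c d v = ((norm (c v))\<^sup>2, (norm (d v))\<^sup>2, qcnj (d v) * c v)"

text \<open>The functional acts on all functions, so that no type of quadratic maps has to be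
  formed; linearity is packed into one equation.\<close>

definition sq_positive :: "(('v::real_vector \<Rightarrow> herm2) \<Rightarrow> real) \<Rightarrow> bool"
  where "sq_positive \<phi> \<longleftrightarrow>
    (\<forall>A B r. \<phi> (\<lambda>v. A v + r *\<^sub>R B v) = \<phi> A + r * \<phi> B) \<and>
    (\<forall>c d. linear c \<longrightarrow> linear d \<longrightarrow> 0 \<le> \<phi> (sq1 c d) \<and> 0 \<le> \<phi> (sq2 c d))"

text \<open>This is the bidual description of the closed cone generated by the squares.\<close>

definition sos :: "('v::real_vector \<Rightarrow> herm2) \<Rightarrow> bool"
  where "sos Z \<longleftrightarrow> (\<forall>\<phi>. sq_positive \<phi> \<longrightarrow> 0 \<le> \<phi> Z)"

lemma sq_positive_linear:
  assumes "sq_positive \<phi>"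
  shows "\<phi> (\<lambda>v. A v + B v) = \<phi> A + \<phi> B" "\<phi> (\<lambda>v. r *\<^sub>R A v) = r * \<phi> A"
    "\<phi> (\<lambda>v. A v + r *\<^sub>R B v) = \<phi> A + r * \<phi> B"
proof -
  have *: "\<phi> (\<lambda>v. A v + r *\<^sub>R B v) = \<phi> A + r * \<phi> B" for A B r
    using assms by (simp add: sq_positive_def)
  show "\<phi> (\<lambda>v. A v + B v) = \<phi> A + \<phi> B" using *[of A 1 B] by simp
  have "\<phi> (\<lambda>v. 0) = 0" using *[of "\<lambda>v. 0" 1 "\<lambda>v. 0"] by simp
  then show "\<phi> (\<lambda>v. r *\<^sub>R A v) = r * \<phi> A" using *[of "\<lambda>v. 0" r A] by simp
  show "\<phi> (\<lambda>v. A v + r *\<^sub>R B v) = \<phi> A + r * \<phi> B" by (rule *)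
qed

lemma sos_sq: "linear c \<Longrightarrow> linear d \<Longrightarrow> sos (sq1 c d)"
  "linear c \<Longrightarrow> linear d \<Longrightarrow> sos (sq2 c d)"
  by (simp_all add: sos_def sq_positive_def)

lemma sos_add: "sos A \<Longrightarrow> sos B \<Longrightarrow> sos (\<lambda>v. A v + B v)"
  by (simp add: sos_def sq_positive_linear)

lemma sos_scaleR: "sos A \<Longrightarrow> 0 \<le> r \<Longrightarrow> sos (\<lambda>v. r *\<^sub>R A v)"
  by (simp add: sos_def sq_positive_linear)

lemma sos_zero: "sos (\<lambda>v. 0)"
  using sos_scaleR[OF sos_sq(1)[of "\<lambda>v. 0" "\<lambda>v. 0"], of 0] by (simp add: linear_zero)

lemma sos_sum: "finite I \<Longrightarrow> (\<And>i. i \<in> I \<Longrightarrow> sos (A i)) \<Longrightarrow> sos (\<lambda>v. \<Sum>i\<in>I. A i v)"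
  by (induction I rule: finite_induct) (simp_all add: sos_zero sos_add)

text \<open>A functional is affine in e along \<open>Z + e W\<close>, so its nonnegativity passes to
  e = 0 by a limit in the reals.\<close>

lemma sos_limit:
  assumes "\<And>e. 0 < e \<Longrightarrow> sos (\<lambda>v. Z v + e *\<^sub>R W v)"
  shows "sos Z"
  unfolding sos_def
proof (intro allI impI)
  fix \<phi> :: "('a \<Rightarrow> herm2) \<Rightarrow> real" assume \<phi>: "sq_positive \<phi>"
  have *: "0 \<le> \<phi> Z + e * \<phi> W" if "0 < e" for e
    using assms[OF that] \<phi> by (simp add: sos_def sq_positive_linear(3))
  have "((\<lambda>e. \<phi> Z + e * \<phi> W) \<longlongrightarrow> \<phi> Z + 0 * \<phi> W) (at_right 0)"
    by (intro tendsto_intros)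
  moreover have "eventually (\<lambda>e. 0 \<le> \<phi> Z + e * \<phi> W) (at_right 0)"
    using * by (auto simp: eventually_at_right_field intro!: exI[of _ 1])
  ultimately show "0 \<le> \<phi> Z"
    using tendsto_lowerbound[OF _ _ trivial_limit_at_right_real] by fastforce
qed

section \<open>The convex cone of positive semidefinite hermitian 2 x 2 matrices\<close>

lemma psd2_add: "z \<in> psd2 \<Longrightarrow> w \<in> psd2 \<Longrightarrow> z + w \<in> psd2"
proof -
  obtain a b q a' b' q' where zw: "z = (a, b, q)" "w = (a', b', q')"
    by (metis prod_cases3)
  assume "z \<in> psd2" "w \<in> psd2"
  then have *: "0 \<le> a" "0 \<le> b" "(norm q)\<^sup>2 \<le> a * b" "0 \<le> a'" "0 \<le> b'" "(norm q')\<^sup>2 \<le> a' * b'"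
    by (simp_all add: psd2_def zw)
  \<comment> \<open>The cross term \<open>2 * norm q * norm q'\<close> has to fit below a b' + a' b,
    which is AM-GM for these two products.\<close>
  have "(norm q * norm q')\<^sup>2 \<le> (a * b) * (a' * b')"
    unfolding power_mult_distrib using * by (intro mult_mono) auto
  also have "\<dots> \<le> ((a * b' + a' * b) / 2)\<^sup>2"
    using zero_le_power2[of "a * b' - a' * b"] by (simp add: power2_eq_square algebra_simps)
  finally have "norm q * norm q' \<le> (a * b' + a' * b) / 2"
    by (rule power2_le_imp_le) (use * in simp)
  moreover have "(norm (q + q'))\<^sup>2 \<le> (norm q + norm q')\<^sup>2"
    by (intro power_mono norm_triangle_ineq) simp
  ultimately have "(norm (q + q'))\<^sup>2 \<le> (a + a') * (b + b')"
    using * by (simp add: power2_sum algebra_simps)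
  then show ?thesis using * by (simp add: psd2_def zw)
qed

lemma psd2_scaleR: "z \<in> psd2 \<Longrightarrow> 0 \<le> r \<Longrightarrow> r *\<^sub>R z \<in> psd2"
proof -
  assume *: "z \<in> psd2" "0 \<le> r"
  obtain a b q where z: "z = (a, b, q)" by (metis prod_cases3)
  have "r\<^sup>2 * (norm q)\<^sup>2 \<le> r\<^sup>2 * (a * b)"
    using * by (intro mult_left_mono) (auto simp: psd2_def z)
  then show ?thesis using * by (auto simp: psd2_def z power2_eq_square algebra_simps)
qed

text \<open>One step of Cholesky elimination: for a > 0 the first summand reproduces a and q, and
  only the Schur complement \<open>r\<close> remains. For a = 0 the determinant bound forces q =
  0.\<close>

lemma psd2_rank_ones:
  assumes "z \<in> psd2"
  obtains c d x y where
    "z = ((norm c)\<^sup>2, (norm d)\<^sup>2, c * qcnj d) + ((norm x)\<^sup>2, (norm y)\<^sup>2, x * qcnj y)"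
proof -
  obtain a b q where z: "z = (a, b, q)" by (metis prod_cases3)
  have *: "0 \<le> a" "0 \<le> b" "(norm q)\<^sup>2 \<le> a * b" using assms by (simp_all add: z psd2_def)
  show thesis
  proof (cases "a = 0")
    case True
    then have "q = 0" using * by simp
    with True show thesis
      using * by (intro that[of 0 0 0 "sqrt b *\<^sub>R 1"])
        (simp add: z power_mult_distrib)
  next
    case False
    with * have a: "a > 0" by simp
    define r where "r = b - (norm q)\<^sup>2 / a"
    have r: "0 \<le> r" using * a by (simp add: r_def divide_simps mult.commute)
    have d: "(norm ((1 / sqrt a) *\<^sub>R qcnj q))\<^sup>2 = (norm q)\<^sup>2 / a"
      using a by (simp add: power_mult_distrib power_divide)
    show thesis
      using a r by (intro that[of "sqrt a *\<^sub>R 1" "(1 / sqrt a) *\<^sub>R qcnj q"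
          0 "sqrt r *\<^sub>R 1"])
        (simp add: z d[simplified] qcnj_scaleR qcnj_qcnj, simp add: power_mult_distrib power_divide r_def)
  qed
qed

lemma sos_rank_one:
  assumes f: "linear (f :: 'v::real_vector \<Rightarrow> real)" and z: "z \<in> psd2"
  shows "sos (\<lambda>v. (f v)\<^sup>2 *\<^sub>R z)"
proof -
  obtain c d x y where z: "z = ((norm c)\<^sup>2, (norm d)\<^sup>2, c * qcnj d)
      + ((norm x)\<^sup>2, (norm y)\<^sup>2, x * qcnj y)"
    using psd2_rank_ones[OF z] by metis
  have lin: "linear (\<lambda>v. f v *\<^sub>R x)" for x :: quat
    using f by (simp add: linear_iff scaleR_left_distrib)
  have *: "sq1 (\<lambda>v. f v *\<^sub>R c) (\<lambda>v. f v *\<^sub>R d)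
      = (\<lambda>v. (f v)\<^sup>2 *\<^sub>R ((norm c)\<^sup>2, (norm d)\<^sup>2, c * qcnj d))" for c d
    by (rule ext) (simp add: sq1_def power_mult_distrib qcnj_scaleR power2_eq_square)
  show ?thesis
    unfolding z scaleR_right_distrib
    using sos_add[OF sos_sq(1)[OF lin lin] sos_sq(1)[OF lin lin]] by (simp only: *)
qed

text \<open>Congruence by the unipotent matrix with rows (1, l) and (0, 1), written out in the
  entries.\<close>

definition shear :: "quat \<Rightarrow> herm2 \<Rightarrow> herm2"
  where "shear l = (\<lambda>(a, b, q). (a + 2 * (l \<bullet> q) + (norm l)\<^sup>2 * b, b, q + b *\<^sub>R l))"

definition flip :: "herm2 \<Rightarrow> herm2"
  where "flip = (\<lambda>(a, b, q). (b, a, qcnj q))"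

lemma linear_shear: "linear (shear l)"
  by (auto simp: linear_iff shear_def inner_add_right algebra_simps)

lemma linear_flip: "linear flip"
  by (auto simp: linear_iff flip_def qcnj_add qcnj_scaleR)

lemma shear_inverse: "shear (- l) (shear l z) = z" "shear l (shear (- l) z) = z"
  by (auto simp: shear_def inner_add_right power2_norm_eq_inner algebra_simps split: prod.splits)

lemma flip_flip: "flip (flip z) = z"
  by (simp add: flip_def qcnj_qcnj split: prod.splits)

lemma psd2_flip: "z \<in> psd2 \<Longrightarrow> flip z \<in> psd2"
  by (auto simp: flip_def psd2_def mult.commute)

text \<open>The congruence preserves a b - norm q^2. This settles the sign of the new corner entry
  when b > 0; when b = 0, q vanishes and the corner is unchanged.\<close>

lemma psd2_shear: "z \<in> psd2 \<Longrightarrow> shear l z \<in> psd2"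
proof -
  assume *: "z \<in> psd2"
  obtain a b q where z: "z = (a, b, q)" by (metis prod_cases3)
  have "\<bar>l \<bullet> q\<bar> \<le> norm l * norm q" by (rule Cauchy_Schwarz_ineq2)
  have 1: "(norm (q + b *\<^sub>R l))\<^sup>2 = (norm q)\<^sup>2 + 2 * b * (l \<bullet> q) + b\<^sup>2 * (norm l)\<^sup>2"
    unfolding power2_norm_eq_inner
    by (simp add: inner_add_left inner_add_right power2_eq_square inner_commute algebra_simps)
  then have 2: "(norm (q + b *\<^sub>R l))\<^sup>2 \<le> (a + 2 * (l \<bullet> q) + (norm l)\<^sup>2 * b) * b"
    using * by (simp add: z psd2_def power2_eq_square algebra_simps)
  have "0 \<le> a + 2 * (l \<bullet> q) + (norm l)\<^sup>2 * b"
  proof (cases "b = 0")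
    case True then show ?thesis using * by (simp add: z psd2_def)
  next
    case False
    then have "b > 0" using * by (simp add: z psd2_def)
    then show ?thesis using 2 by (meson order_trans zero_le_mult_iff zero_le_power2 not_le)
  qed
  then show ?thesis using 2 * by (simp add: z psd2_def shear_def)
qed

text \<open>Composing \<open>\<phi>\<close> with \<open>S\<close> gives a functional that is again
  nonnegative on squares, and its value at the image of \<open>Z\<close> under \<open>T\<close> is
  \<open>\<phi> Z\<close>.\<close>

lemma sos_transform:
  assumes T: "linear T" and inv: "\<And>z. S (T z) = z"
    and S: "linear S" "\<And>c d :: 'v \<Rightarrow> quat. linear c \<Longrightarrow> linear d \<Longrightarrow> sos (\<lambda>v. S (sq1 c d v))"
    "\<And>c d :: 'v \<Rightarrow> quat. linear c \<Longrightarrow> linear d \<Longrightarrow> sos (\<lambda>v. S (sq2 c d v))"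
    and Z: "sos (\<lambda>v :: 'v::real_vector. T (Z v))"
  shows "sos Z"
  unfolding sos_def
proof (intro allI impI)
  fix \<phi> :: "('v \<Rightarrow> herm2) \<Rightarrow> real" assume \<phi>: "sq_positive \<phi>"
  have "sq_positive (\<lambda>A. \<phi> (\<lambda>v. S (A v)))"
    unfolding sq_positive_def
    using S(2,3) \<phi> by (simp add: sq_positive_linear[OF \<phi>] linear_add[OF S(1)] linear_scale[OF S(1)] sos_def)
  then have "0 \<le> \<phi> (\<lambda>v. S (T (Z v)))"
    using Z[unfolded sos_def, rule_format, of "\<lambda>A. \<phi> (\<lambda>v. S (A v))"] by simp
  then show "0 \<le> \<phi> Z" by (simp add: inv)
qed

text \<open>The inverse shear of a square is a square, with c replaced by c - l d for the first kind
  and by c - d l for the second: l acts on the side that fits the order of the product.\<close>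

lemma sos_shear: "sos (\<lambda>v. shear l (Z v)) \<Longrightarrow> sos Z"
proof (erule sos_transform[OF linear_shear shear_inverse(1) linear_shear, rotated 2])
  fix c d :: "'a \<Rightarrow> quat" assume cd: "linear c" "linear d"
  have lin: "linear (\<lambda>v. c v + - l * d v)" "linear (\<lambda>v. c v + d v * - l)"
    using cd by (simp_all add: linear_iff algebra_simps)
  have n: "(norm (x + y))\<^sup>2 = (norm x)\<^sup>2 + 2 * (x \<bullet> y) + (norm y)\<^sup>2" for x y :: quat
    unfolding power2_norm_eq_inner by (simp add: inner_add_left inner_add_right inner_commute)
  have lcd: "c v \<bullet> (l * d v) = l \<bullet> (c v * qcnj (d v))" "c v \<bullet> (d v * l) = l \<bullet> (qcnj (d v) * c v)" for v
    by (simp_all only: inner_mult_left_cnj[of "c v" l] inner_mult_right_cnj[of "c v" _ l] inner_commute)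
  have "(\<lambda>v. shear (- l) (sq1 c d v)) = sq1 (\<lambda>v. c v + - l * d v) d"
    unfolding sq1_def shear_def split_conv n
    by (rule ext) (simp add: lcd norm_quat_mult power_mult_distrib algebra_simps
        mult.assoc mult_qcnj_self)
  then show "sos (\<lambda>v. shear (- l) (sq1 c d v))" using sos_sq(1)[OF lin(1) cd(2)] by simp
  have "(\<lambda>v. shear (- l) (sq2 c d v)) = sq2 (\<lambda>v. c v + d v * - l) d"
    unfolding sq2_def shear_def split_conv n
    by (rule ext) (simp add: lcd norm_quat_mult power_mult_distrib algebra_simps
        mult.assoc[symmetric] mult_qcnj_self)
  then show "sos (\<lambda>v. shear (- l) (sq2 c d v))" using sos_sq(2)[OF lin(2) cd(2)] by simp
qed

lemma sos_flip: "sos (\<lambda>v. flip (Z v)) \<Longrightarrow> sos Z"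
proof (erule sos_transform[OF linear_flip flip_flip linear_flip, rotated 2])
  fix c d :: "'a \<Rightarrow> quat" assume cd: "linear c" "linear d"
  have "(\<lambda>v. flip (sq1 c d v)) = sq1 d c" "(\<lambda>v. flip (sq2 c d v)) = sq2 d c"
    by (rule ext, simp add: flip_def sq1_def sq2_def qcnj_mult qcnj_qcnj)+
  then show "sos (\<lambda>v. flip (sq1 c d v))" "sos (\<lambda>v. flip (sq2 c d v))"
    using sos_sq cd by metis+
qed


section \<open>Two contacts with the Lorentz cone\<close>

lemma norm_le_inner:
  fixes x :: "'x::euclidean_space"
  assumes "\<And>u. norm u = 1 \<Longrightarrow> x \<bullet> u \<le> r"
  shows "norm x \<le> r"
proof (cases "x = 0")
  case True
  obtain u :: 'x where "norm u = 1" using norm_Basis nonempty_Basis by blast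
  with assms[of u] True show ?thesis by simp
next
  case False
  have "x \<bullet> (x /\<^sub>R norm x) \<le> r" using False by (intro assms) simp
  then show ?thesis using False by (simp add: dot_square_norm power2_eq_square field_simps)
qed

text \<open>
  The analogue of John's theorem for the Lorentz cone: the largest cone element lying below all
  \<open>(T v, X v)\<close>, measured by its determinant, touches in two different directions. Otherwise,
  moving it towards the only contact direction \<open>u\<^sub>0\<close> would increase the determinant.
\<close>

lemma lorentz_two_contacts:
  fixes T :: "'v::euclidean_space \<Rightarrow> real" and X :: "'v \<Rightarrow> 'x::euclidean_space"
  assumes S: "compact S" "S \<noteq> {}" and T: "continuous_on S T" and X: "continuous_on S X"
    and e: "0 < e" "\<And>v. v \<in> S \<Longrightarrow> norm (X v) + e \<le> T v"
  obtains n\<^sub>0 n v\<^sub>1 v\<^sub>2 u\<^sub>1 u\<^sub>2 where "norm n \<le> n\<^sub>0" "\<And>v. v \<in> S \<Longrightarrow> norm (X v - n) \<le> T v - n\<^sub>0"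
    "v\<^sub>1 \<in> S" "v\<^sub>2 \<in> S" "norm u\<^sub>1 = 1" "norm u\<^sub>2 = 1" "u\<^sub>1 \<noteq> u\<^sub>2"
    "T v\<^sub>1 - n\<^sub>0 = (X v\<^sub>1 - n) \<bullet> u\<^sub>1" "T v\<^sub>2 - n\<^sub>0 = (X v\<^sub>2 - n) \<bullet> u\<^sub>2"
proof -
  note contacts = that
  define F where "F = {p :: real \<times> 'x. norm (snd p) \<le> fst p \<and>
    (\<forall>v\<in>S. norm (X v - snd p) \<le> T v - fst p)}"
  obtain v\<^sub>0 where v0: "v\<^sub>0 \<in> S" using S by blast
  have "compact F"
  proof (rule compact_eq_bounded_closed[THEN iffD2], intro conjI)
    have "norm p \<le> 2 * T v\<^sub>0" if "p \<in> F" for p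
    proof -
      have p: "norm (snd p) \<le> fst p" "norm (X v\<^sub>0 - snd p) \<le> T v\<^sub>0 - fst p"
        using that v0 by (auto simp: F_def)
      then have "0 \<le> T v\<^sub>0 - fst p" "0 \<le> fst p"
        using norm_ge_zero order_trans by blast+
      then show ?thesis
        using p norm_Pair_le[of "fst p" "snd p"] by simp
    qed
    then show "bounded F" unfolding bounded_iff by blast
    have "F = {p. norm (snd p) \<le> fst p} \<inter> (\<Inter>v\<in>S. {p. norm (X v - snd p) \<le> T v - fst p})"
      by (auto simp: F_def)
    also have "closed \<dots>"
      by (intro closed_Int closed_INT ballI closed_Collect_le continuous_intros)
    finally show "closed F" .
  qed
  moreover have eF: "(e, 0) \<in> F" using e by (auto simp: F_def algebra_simps)
  moreover have "continuous_on F (\<lambda>p. (fst p)\<^sup>2 - (norm (snd p))\<^sup>2)"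
    by (intro continuous_intros)
  ultimately obtain p where p: "p \<in> F"
    and max: "\<And>p'. p' \<in> F \<Longrightarrow> (fst p')\<^sup>2 - (norm (snd p'))\<^sup>2 \<le> (fst p)\<^sup>2 - (norm (snd p))\<^sup>2"
    using continuous_attains_sup[of F] by blast
  define n\<^sub>0 n where "n\<^sub>0 = fst p" and "n = snd p"
  define d where "d = n\<^sub>0\<^sup>2 - (norm n)\<^sup>2"
  have n: "norm n \<le> n\<^sub>0" "\<And>v. v \<in> S \<Longrightarrow> norm (X v - n) \<le> T v - n\<^sub>0"
    using p by (auto simp: F_def n\<^sub>0_def n_def)
  have "0 < e\<^sup>2" using e by simp
  \<comment> \<open>The feasible point (e, 0) already has determinant e^2.\<close>
  then have d: "0 < d"
    using max[OF eF] unfolding d_def n\<^sub>0_def n_def fst_conv snd_conv norm_zero zero_power2 by linarith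
  define c where "c = n\<^sub>0 - norm n"
  have c: "0 < c"
    using d n by (cases "n\<^sub>0 = norm n") (auto simp: c_def d_def)
  \<comment> \<open>The remainder at v paired with the boundary element (1, -u) of the dual cone; a
    zero is a contact at v in direction u.\<close>
  define g where "g = (\<lambda>v u. T v - n\<^sub>0 - (X v - n) \<bullet> u)"
  have g0: "0 \<le> g v u" if "v \<in> S" "norm u = 1" for v u
    using n(2)[OF that(1)] norm_cauchy_schwarz[of "X v - n" u] that(2) by (simp add: g_def)
  show thesis
  proof (rule ccontr)
    assume "\<not> thesis"
    have one: "u = u'" if "v \<in> S" "v' \<in> S" "norm u = 1" "norm u' = 1" "g v u = 0" "g v' u' = 0"
      for v v' u u'
    proof (rule ccontr)
      assume "u \<noteq> u'"
      have thesis
        by (rule contacts[OF n(1) n(2) that(1-4) \<open>u \<noteq> u'\<close>]) (use that in \<open>simp_all add: g_def\<close>)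
      with \<open>\<not> thesis\<close> show False by contradiction
    qed
    obtain u\<^sub>0 :: 'x where u0: "norm u\<^sub>0 = 1"
      and uniq: "\<And>v u. v \<in> S \<Longrightarrow> norm u = 1 \<Longrightarrow> g v u = 0 \<Longrightarrow> u = u\<^sub>0"
    proof (cases "\<exists>v u. v \<in> S \<and> norm u = 1 \<and> g v u = 0")
      case True
      then show ?thesis using one that by metis
    next
      case False
      obtain u :: 'x where "norm u = 1" using norm_Basis nonempty_Basis by blast
      then show ?thesis using False that by blast
    qed
    \<comment> \<open>Moving by t towards \<open>m (1, u\<^sub>0)\<close> changes the determinant to
      first order by \<open>2 t (m (n\<^sub>0 - n \<bullet> u\<^sub>0) - d)\<close>. As
      \<open>n\<^sub>0 - n \<bullet> u\<^sub>0\<close> is at least c, this m makes the gain at least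
      2 t d.\<close>
    define m where "m = 2 * d / c"
    have m: "0 < m" using d c by (simp add: m_def)
    \<comment> \<open>Outside \<open>B\<close> the move costs less than t c, and shrinking
      \<open>(n\<^sub>0, n)\<close> by the factor 1 - t pays for it. On \<open>B\<close> the
      direction u differs from \<open>u\<^sub>0\<close>, so compactness bounds g away from
      0.\<close>
    define B where "B = (S \<times> sphere 0 1) \<inter> {(v, u). c \<le> m * (1 - u\<^sub>0 \<bullet> u)}"
    have "compact B"
      unfolding B_def case_prod_beta using S
      by (intro compact_Int_closed compact_Times compact_sphere closed_Collect_le continuous_intros)
    have contB: "continuous_on B (\<lambda>p. g (fst p) (snd p))"
      unfolding g_def B_def
      by (intro continuous_intros continuous_on_compose2[OF T] continuous_on_compose2[OF X]) auto
    have gpos: "0 < g v u" if "(v, u) \<in> B" for v u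
    proof -
      have "u \<noteq> u\<^sub>0"
        using that c u0 by (auto simp: B_def dot_square_norm)
      then have "g v u \<noteq> 0" using uniq that by (auto simp: B_def)
      then show ?thesis using g0[of v u] that by (auto simp: B_def)
    qed
    obtain \<delta> where \<delta>: "0 < \<delta>" "\<And>v u. (v, u) \<in> B \<Longrightarrow> \<delta> \<le> g v u"
    proof (cases "B = {}")
      case True then show ?thesis using that[of 1] by auto
    next
      case False
      then obtain q where "q \<in> B" "\<And>q'. q' \<in> B \<Longrightarrow> g (fst q) (snd q) \<le> g (fst q') (snd q')"
        using continuous_attains_inf[OF \<open>compact B\<close> False contB] by blast
      then show ?thesis using gpos that[of "g (fst q) (snd q)"] by (metis fst_conv snd_conv prod.collapse)
    qed
    \<comment> \<open>The cost on \<open>B\<close> is at most 2 m t, hence at most \<delta>; the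
      bound 1/2 keeps 2 - 3 t positive in the final estimate.\<close>
    define t where "t = min (1/2) (\<delta> / (2 * m))"
    have t: "0 < t" "t \<le> 1/2" "2 * m * t \<le> \<delta>"
      using \<delta> m by (auto simp: t_def min_def field_simps)
    define q where "q = ((1 - t) * n\<^sub>0 + t * m, (1 - t) *\<^sub>R n + (t * m) *\<^sub>R u\<^sub>0)"
    have "q \<in> F"
      unfolding F_def mem_Collect_eq
    proof (intro conjI ballI)
      have "norm ((1 - t) *\<^sub>R n + (t * m) *\<^sub>R u\<^sub>0) \<le> (1 - t) * norm n + t * m"
        using norm_triangle_ineq[of "(1 - t) *\<^sub>R n" "(t * m) *\<^sub>R u\<^sub>0"] t m u0 by simp
      also have "\<dots> \<le> (1 - t) * n\<^sub>0 + t * m" using n t by (simp add: mult_left_mono)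
      finally show "norm (snd q) \<le> fst q" by (simp add: q_def)
      fix v assume v: "v \<in> S"
      show "norm (X v - snd q) \<le> T v - fst q"
      proof (rule norm_le_inner)
        fix u :: 'x assume u: "norm u = 1"
        have nu: "c \<le> n\<^sub>0 - n \<bullet> u"
          using norm_cauchy_schwarz[of n u] u by (simp add: c_def)
        have eq: "T v - fst q - (X v - snd q) \<bullet> u
            = g v u + t * (n\<^sub>0 - n \<bullet> u) - t * (m * (1 - u\<^sub>0 \<bullet> u))"
          by (simp add: q_def g_def inner_diff_left inner_add_left algebra_simps)
        have "t * (m * (1 - u\<^sub>0 \<bullet> u)) \<le> g v u + t * (n\<^sub>0 - n \<bullet> u)"
        proof (cases "c \<le> m * (1 - u\<^sub>0 \<bullet> u)")
          case True
          then have "\<delta> \<le> g v u" using u v by (intro \<delta>) (simp add: B_def)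
          have "- 1 \<le> u\<^sub>0 \<bullet> u"
            using Cauchy_Schwarz_ineq2[of "u\<^sub>0" u] u u0 by simp
          then have "t * (m * (1 - u\<^sub>0 \<bullet> u)) \<le> t * (m * 2)"
            using t m by (intro mult_left_mono) auto
          also have "\<dots> \<le> g v u" using t \<open>\<delta> \<le> g v u\<close> by (simp add: mult.commute mult.left_commute)
          moreover have "0 \<le> t * (n\<^sub>0 - n \<bullet> u)" using t nu c by simp
          ultimately show ?thesis by linarith
        next
          case False
          then have "t * (m * (1 - u\<^sub>0 \<bullet> u)) \<le> t * (n\<^sub>0 - n \<bullet> u)"
            using t nu by (intro mult_left_mono) auto
          then show ?thesis using g0[OF v u] by linarith
        qed
        then show "(X v - snd q) \<bullet> u \<le> T v - fst q" using eq by linarith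
      qed
    qed
    then have le: "(fst q)\<^sup>2 - (norm (snd q))\<^sup>2 \<le> d"
      using max by (simp add: d_def n\<^sub>0_def n_def)
    have "u\<^sub>0 \<bullet> u\<^sub>0 = 1" using u0 by (simp add: dot_square_norm)
    then have eq: "(fst q)\<^sup>2 - (norm (snd q))\<^sup>2
        = (1 - t)\<^sup>2 * d + 2 * t * (1 - t) * m * (n\<^sub>0 - n \<bullet> u\<^sub>0)"
      unfolding q_def fst_conv snd_conv d_def power2_norm_eq_inner
      by (simp add: inner_add_left inner_add_right inner_commute power2_eq_square algebra_simps)
    have "2 * d = m * c" using c by (simp add: m_def)
    also have "\<dots> \<le> m * (n\<^sub>0 - n \<bullet> u\<^sub>0)"
      using m norm_cauchy_schwarz[of n "u\<^sub>0"] u0 by (intro mult_left_mono) (auto simp: c_def)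
    finally have "2 * t * (1 - t) * (2 * d) \<le> 2 * t * (1 - t) * (m * (n\<^sub>0 - n \<bullet> u\<^sub>0))"
      using t by (intro mult_left_mono) auto
    with le eq have "(1 - t)\<^sup>2 * d + 2 * t * (1 - t) * (2 * d) \<le> d"
      unfolding mult.assoc by linarith
    then have "d * (t * (2 - 3 * t)) \<le> 0" by (simp add: power2_eq_square algebra_simps)
    moreover have "0 < d * (t * (2 - 3 * t))" using d t by simp
    ultimately show False by linarith
  qed
qed


section \<open>Quadratic maps\<close>

definition quadmap :: "('v::real_vector \<Rightarrow> 'w::real_vector) \<Rightarrow> bool"
  where "quadmap Z \<longleftrightarrow> (\<exists>B. bilinear B \<and> (\<forall>x y. B x y = B y x) \<and> Z = (\<lambda>v. B v v))"

lemma quadmap_linear: "quadmap Z \<Longrightarrow> linear T \<Longrightarrow> quadmap (\<lambda>v. T (Z v))"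
  unfolding quadmap_def bilinear_def
proof (elim exE conjE)
  fix B assume *: "linear T" "\<forall>x. linear (B x)" "\<forall>y. linear (\<lambda>x. B x y)" "\<forall>x y. B x y = B y x"
    and Z: "Z = (\<lambda>v. B v v)"
  then show "\<exists>C. ((\<forall>x. linear (C x)) \<and> (\<forall>y. linear (\<lambda>x. C x y))) \<and>
      (\<forall>x y. C x y = C y x) \<and> (\<lambda>v. T (Z v)) = (\<lambda>v. C v v)"
    by (intro exI[of _ "\<lambda>x y. T (B x y)"]) (auto intro: linear_compose[unfolded o_def])
qed

lemma quadmap_add: "quadmap Y \<Longrightarrow> quadmap Z \<Longrightarrow> quadmap (\<lambda>v. Y v + Z v)"
  unfolding quadmap_def
proof (elim exE conjE)
  fix B C assume *: "bilinear B" "bilinear C" "\<forall>x y. B x y = B y x" "\<forall>x y. C x y = C y x"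
    "Y = (\<lambda>v. B v v)" "Z = (\<lambda>v. C v v)"
  then show "\<exists>D. bilinear D \<and> (\<forall>x y. D x y = D y x) \<and> (\<lambda>v. Y v + Z v) = (\<lambda>v. D v v)"
    by (intro exI[of _ "\<lambda>x y. B x y + C x y"]) (auto simp: bilinear_def intro: linear_compose_add)
qed

lemma linear_scaleR_const: "linear f \<Longrightarrow> linear (\<lambda>v. f v *\<^sub>R z)"
  by (simp add: linear_iff scaleR_left_distrib)

lemma quadmap_scaleR: "quadmap Z \<Longrightarrow> quadmap (\<lambda>v. r *\<^sub>R Z v)"
  by (rule quadmap_linear) (simp_all add: linear_scaleR)

lemma quadmap_norm2:
  fixes P :: "'v::real_vector \<Rightarrow> 'w::real_inner"
  assumes "linear P"
  shows "quadmap (\<lambda>v. (norm (P v))\<^sup>2 *\<^sub>R z)"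
  unfolding quadmap_def power2_norm_eq_inner
  using assms by (intro exI[of _ "\<lambda>x y. (P x \<bullet> P y) *\<^sub>R z"])
    (auto simp: bilinear_def linear_iff inner_add_left inner_add_right scaleR_left_distrib inner_commute)

lemma quadmap_homogeneous: "quadmap Z \<Longrightarrow> Z (c *\<^sub>R v) = c\<^sup>2 *\<^sub>R Z v"
  by (auto simp: quadmap_def bilinear_lmul bilinear_rmul power2_eq_square)

lemma quadmap_continuous:
  fixes Z :: "'v::euclidean_space \<Rightarrow> 'w::real_normed_vector"
  assumes "quadmap Z"
  shows "continuous_on S Z"
proof -
  obtain B where B: "bilinear B" "Z = (\<lambda>v. B v v)" using assms by (auto simp: quadmap_def)
  have eq: "Z = (\<lambda>v. \<Sum>i\<in>Basis. \<Sum>j\<in>Basis. ((v \<bullet> i) * (v \<bullet> j)) *\<^sub>R B i j)"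
    unfolding B(2)
  proof
    fix v
    have "B v v = B (\<Sum>i\<in>Basis. (v \<bullet> i) *\<^sub>R i) (\<Sum>j\<in>Basis. (v \<bullet> j) *\<^sub>R j)"
      by (simp add: euclidean_representation)
    also have "\<dots> = (\<Sum>i\<in>Basis. \<Sum>j\<in>Basis. ((v \<bullet> i) * (v \<bullet> j)) *\<^sub>R B i j)"
      unfolding bilinear_sum[OF B(1)] sum.cartesian_product
      by (intro sum.cong refl) (auto simp: bilinear_lmul[OF B(1)] bilinear_rmul[OF B(1)] mult.commute)
    finally show "B v v = (\<Sum>i\<in>Basis. \<Sum>j\<in>Basis. ((v \<bullet> i) * (v \<bullet> j)) *\<^sub>R B i j)" .
  qed
  show ?thesis by (subst eq) (intro continuous_intros)
qed

definition pos_quadmap :: "('v::real_vector \<Rightarrow> herm2) \<Rightarrow> bool"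
  where "pos_quadmap Z \<longleftrightarrow> quadmap Z \<and> (\<forall>v. Z v \<in> psd2)"

lemma pos_quadmap_shear: "pos_quadmap Z \<Longrightarrow> pos_quadmap (\<lambda>v. shear l (Z v))"
  by (simp add: pos_quadmap_def quadmap_linear linear_shear psd2_shear)

lemma pos_quadmap_flip: "pos_quadmap Z \<Longrightarrow> pos_quadmap (\<lambda>v. flip (Z v))"
  by (simp add: pos_quadmap_def quadmap_linear linear_flip psd2_flip)

lemma sos_norm2:
  fixes P :: "'v::real_vector \<Rightarrow> 'w::euclidean_space"
  assumes "linear P" "z \<in> psd2"
  shows "sos (\<lambda>v. (norm (P v))\<^sup>2 *\<^sub>R z)"
proof -
  have "(norm (P v))\<^sup>2 *\<^sub>R z = (\<Sum>i\<in>Basis. (P v \<bullet> i)\<^sup>2 *\<^sub>R z)" for v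
    unfolding power2_norm_eq_inner euclidean_inner[of "P v" "P v"] scaleR_sum_left
    by (simp add: power2_eq_square)
  moreover have "linear (\<lambda>v. P v \<bullet> i)" for i
    using assms(1) by (simp add: linear_iff inner_add_left)
  ultimately show ?thesis
    by (simp add: sos_sum sos_rank_one assms(2))
qed


section \<open>Contractive bilinear maps into the quaternions\<close>

text \<open>
  The S-lemma with a homogeneous equality constraint. If \<open>d\<close> is positive at \<open>X\<close> and negative at
  \<open>Y\<close>, then \<open>d\<close> vanishes at \<open>X + s Y\<close> for one positive and one negative value of \<open>s\<close>;
  eliminating the mixed term of \<open>q\<close> from the two resulting inequalities compares the two bounds
  on the multiplier.
\<close>

lemma finsler:
  fixes q d :: "'a::real_vector \<Rightarrow> 'a \<Rightarrow> real"
  assumes q: "bilinear q" "\<And>x y. q x y = q y x" and d: "bilinear d" "\<And>x y. d x y = d y x"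
    and nonneg: "\<And>x. d x x = 0 \<Longrightarrow> 0 \<le> q x x"
    and indef: "0 < d X\<^sub>0 X\<^sub>0" "d Y\<^sub>0 Y\<^sub>0 < 0"
  obtains t where "\<And>x. 0 \<le> q x x + t * d x x"
proof -
  have key: "- q X X / d X X \<le> q Y Y / - d Y Y" if "0 < d X X" "d Y Y < 0" for X Y
  proof -
    define \<alpha> \<delta> \<gamma> where "\<alpha> = d X X" "\<delta> = d X Y" "\<gamma> = - d Y Y"
    note defs = this
    have pos: "0 < \<alpha>" "0 < \<gamma>" using that by (simp_all add: defs)
    define R where "R = sqrt (\<delta>\<^sup>2 + \<alpha> * \<gamma>)"
    have R2: "R\<^sup>2 = \<delta>\<^sup>2 + \<alpha> * \<gamma>" using pos by (simp add: R_def)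
    have "\<bar>\<delta>\<bar> < R" unfolding R_def
      by (rule real_less_rsqrt) (use pos in simp)
    then have sgn: "0 < R + \<delta>" "0 < R - \<delta>" "0 < R" by linarith+
    have expand: "q (X + s *\<^sub>R Y) (X + s *\<^sub>R Y) = q X X + 2 * s * q X Y + s\<^sup>2 * q Y Y"
      "d (X + s *\<^sub>R Y) (X + s *\<^sub>R Y) = \<alpha> + 2 * s * \<delta> - s\<^sup>2 * \<gamma>" for s
      using q(2)[of Y X] d(2)[of Y X]
      by (simp_all add: defs bilinear_ladd[OF q(1)] bilinear_radd[OF q(1)] bilinear_lmul[OF q(1)]
          bilinear_rmul[OF q(1)] bilinear_ladd[OF d(1)] bilinear_radd[OF d(1)]
          bilinear_lmul[OF d(1)] bilinear_rmul[OF d(1)] power2_eq_square algebra_simps)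
    have root: "0 \<le> q X X * \<gamma>\<^sup>2 + 2 * (\<delta> + e * R) * \<gamma> * q X Y + (\<delta> + e * R)\<^sup>2 * q Y Y"
      if "e\<^sup>2 = 1" for e
    proof -
      define s where "s = (\<delta> + e * R) / \<gamma>"
      have s: "s * \<gamma> = \<delta> + e * R" using pos by (simp add: s_def)
      have "\<gamma> * (\<alpha> + 2 * s * \<delta> - s\<^sup>2 * \<gamma>) = \<gamma> * \<alpha> + 2 * (s * \<gamma>) * \<delta> - (s * \<gamma>)\<^sup>2"
        by (simp add: power2_eq_square algebra_simps)
      also have "\<dots> = \<gamma> * \<alpha> + \<delta>\<^sup>2 - e\<^sup>2 * R\<^sup>2"
        unfolding s by (simp add: power2_eq_square algebra_simps)
      also have "\<dots> = 0" using that R2 by simp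
      finally have "\<alpha> + 2 * s * \<delta> - s\<^sup>2 * \<gamma> = 0" using pos by simp
      then have "0 \<le> q X X + 2 * s * q X Y + s\<^sup>2 * q Y Y"
        using nonneg[of "X + s *\<^sub>R Y"] expand by simp
      then have "0 \<le> \<gamma>\<^sup>2 * (q X X + 2 * s * q X Y + s\<^sup>2 * q Y Y)" by simp
      also have "\<dots> = q X X * \<gamma>\<^sup>2 + 2 * (s * \<gamma>) * \<gamma> * q X Y + (s * \<gamma>)\<^sup>2 * q Y Y"
        by (simp add: power2_eq_square algebra_simps)
      finally show ?thesis unfolding s .
    qed
    \<comment> \<open>The weights cancel the mixed terms, whose coefficients are proportional to (R
      - \<delta>)(\<delta> + R) and (R + \<delta>)(\<delta> - R).\<close>
    have "0 \<le> (R - \<delta>) * (q X X * \<gamma>\<^sup>2 + 2 * (\<delta> + R) * \<gamma> * q X Y + (\<delta> + R)\<^sup>2 * q Y Y)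
        + (R + \<delta>) * (q X X * \<gamma>\<^sup>2 + 2 * (\<delta> - R) * \<gamma> * q X Y + (\<delta> - R)\<^sup>2 * q Y Y)"
      using root[of 1] root[of "-1"] sgn mult_nonneg_nonneg add_nonneg_nonneg by simp
    also have "\<dots> = 2 * R * (q X X * \<gamma>\<^sup>2 + (R\<^sup>2 - \<delta>\<^sup>2) * q Y Y)"
      by (simp add: power2_eq_square algebra_simps)
    also have "\<dots> = 2 * R * \<gamma> * (q X X * \<gamma> + \<alpha> * q Y Y)"
      unfolding R2 by (simp add: power2_eq_square algebra_simps)
    finally have "0 \<le> 2 * R * \<gamma> * (q X X * \<gamma> + \<alpha> * q Y Y)" .
    moreover have "0 < 2 * R * \<gamma>" using sgn pos by simp
    ultimately have "0 \<le> q X X * \<gamma> + \<alpha> * q Y Y"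
      by (meson mult_pos_neg not_less)
    then have "- q X X / \<alpha> \<le> q Y Y / \<gamma>"
      using pos by (simp add: divide_simps algebra_simps)
    then show ?thesis by (simp add: defs)
  qed
  \<comment> \<open>Vectors with positive d bound the multiplier from below by the elements of
    \<open>L\<close>, vectors with negative d bound it from above; the supremum meets both.\<close>
  define L where "L = {- q X X / d X X | X. 0 < d X X}"
  define t where "t = Sup L"
  have bdd: "bdd_above L" 
    unfolding L_def by (rule bdd_aboveI[of _ "q Y\<^sub>0 Y\<^sub>0 / - d Y\<^sub>0 Y\<^sub>0"]) (use key[OF _ indef(2)] in blast)
  have ne: "L \<noteq> {}" using indef by (auto simp: L_def)
  show thesis
  proof
    fix x
    consider "d x x = 0" | "0 < d x x" | "d x x < 0" by linarith
    then show "0 \<le> q x x + t * d x x"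
    proof cases
      case 1 then show ?thesis using nonneg by simp
    next
      case 2
      then have "- q x x / d x x \<le> t"
        unfolding t_def using bdd by (intro cSup_upper) (auto simp: L_def)
      then show ?thesis using 2 by (simp add: divide_simps algebra_simps)
    next
      case 3
      have "t \<le> q x x / - d x x"
        unfolding t_def using key[OF _ 3] by (intro cSup_least ne) (unfold L_def, blast)
      then show ?thesis using 3 by (simp add: divide_simps algebra_simps)
    qed
  qed
qed

lemma psd_bilinear_Cauchy_Schwarz:
  fixes h :: "'a::real_vector \<Rightarrow> 'a \<Rightarrow> real"
  assumes h: "bilinear h" "\<And>x y. h x y = h y x" and pos: "\<And>x. 0 \<le> h x x" and y: "0 < h y y"
  shows "(h y x)\<^sup>2 \<le> h y y * h x x"
proof -
  have "0 \<le> h (h y y *\<^sub>R x - h y x *\<^sub>R y) (h y y *\<^sub>R x - h y x *\<^sub>R y)" by (rule pos)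
  also have "\<dots> = h y y * (h y y * h x x - (h y x)\<^sup>2)"
    using h(2)[of x y]
    by (simp add: bilinear_lsub[OF h(1)] bilinear_rsub[OF h(1)] bilinear_lmul[OF h(1)]
        bilinear_rmul[OF h(1)] power2_eq_square algebra_simps)
  finally show ?thesis using y by (simp add: zero_le_mult_iff)
qed

lemma bilinear_add_scaled:
  fixes q d :: "'a::real_vector \<Rightarrow> 'a \<Rightarrow> real"
  shows "bilinear q \<Longrightarrow> bilinear d \<Longrightarrow> bilinear (\<lambda>x y. q x y + t * d x y)"
  by (simp add: bilinear_def linear_iff algebra_simps)

section \<open>Bilinear contractions and their extreme points\<close>

type_synonym mat2 = "real \<times> real \<times> real \<times> real"

type_synonym quat4 = "quat \<times> quat \<times> quat \<times> quat"

definition det2 :: "mat2 \<Rightarrow> real"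
  where "det2 = (\<lambda>(x\<^sub>1\<^sub>1, x\<^sub>1\<^sub>2, x\<^sub>2\<^sub>1, x\<^sub>2\<^sub>2). x\<^sub>1\<^sub>1 * x\<^sub>2\<^sub>2 - x\<^sub>1\<^sub>2 * x\<^sub>2\<^sub>1)"

definition qmap :: "quat4 \<Rightarrow> mat2 \<Rightarrow> quat"
  where "qmap = (\<lambda>(b\<^sub>1\<^sub>1, b\<^sub>1\<^sub>2, b\<^sub>2\<^sub>1, b\<^sub>2\<^sub>2) (x\<^sub>1\<^sub>1, x\<^sub>1\<^sub>2, x\<^sub>2\<^sub>1, x\<^sub>2\<^sub>2).
    x\<^sub>1\<^sub>1 *\<^sub>R b\<^sub>1\<^sub>1 + x\<^sub>1\<^sub>2 *\<^sub>R b\<^sub>1\<^sub>2 + x\<^sub>2\<^sub>1 *\<^sub>R b\<^sub>2\<^sub>1 + x\<^sub>2\<^sub>2 *\<^sub>R b\<^sub>2\<^sub>2)"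

text \<open>A bilinear map \<open>\<real>\<^sup>2 \<times> \<real>\<^sup>2 \<rightarrow> \<H>\<close> is a linear map on \<open>2 \<times> 2\<close> matrices, and it is a
  contraction iff the linear map is one on the matrices of rank at most one.\<close>

definition contractions :: "quat4 set"
  where "contractions = {b. \<forall>X. det2 X = 0 \<longrightarrow> norm (qmap b X) \<le> norm X}"

lemma contractionsD: "b \<in> contractions \<Longrightarrow> det2 X = 0 \<Longrightarrow> norm (qmap b X) \<le> norm X"
  unfolding contractions_def mem_Collect_eq by (elim allE impE)

lemma contractionsI: "(\<And>X. det2 X = 0 \<Longrightarrow> norm (qmap b X) \<le> norm X) \<Longrightarrow> b \<in> contractions"
  unfolding contractions_def mem_Collect_eq by (intro allI impI)

lemma bilinear_qmap: "bilinear qmap"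
  by (auto simp: bilinear_def linear_iff qmap_def algebra_simps)

lemmas qmap_linear_simps = bilinear_ladd[OF bilinear_qmap] bilinear_radd[OF bilinear_qmap]
  bilinear_lmul[OF bilinear_qmap] bilinear_rmul[OF bilinear_qmap] bilinear_lsub[OF bilinear_qmap]
  bilinear_rsub[OF bilinear_qmap]

lemma continuous_on_qmap: "continuous_on S (\<lambda>b. qmap b X)"
  unfolding qmap_def case_prod_beta by (intro continuous_intros)

lemma convex_contractions: "convex contractions"
  unfolding convex_def
proof (intro ballI allI impI contractionsI)
  fix b c X and u v :: real
  assume bc: "b \<in> contractions" "c \<in> contractions"
    and uv: "0 \<le> u" "0 \<le> v" "u + v = 1" and X: "det2 X = 0"
  have "norm (u *\<^sub>R qmap b X + v *\<^sub>R qmap c X) \<le> u * norm (qmap b X) + v * norm (qmap c X)"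
    using norm_triangle_ineq[of "u *\<^sub>R qmap b X" "v *\<^sub>R qmap c X"] uv by simp
  also have "\<dots> \<le> u * norm X + v * norm X"
    using bc[THEN contractionsD, OF X] uv by (intro add_mono mult_left_mono)
  also have "\<dots> = norm X" using uv by (simp add: distrib_right[symmetric])
  finally show "norm (qmap (u *\<^sub>R b + v *\<^sub>R c) X) \<le> norm X"
    by (simp only: qmap_linear_simps)
qed

lemma compact_contractions: "compact contractions"
  unfolding compact_eq_bounded_closed
proof
  have "norm b \<le> 4" if "b \<in> contractions" for b
  proof -
    obtain b1 b2 b3 b4 where b: "b = (b1, b2, b3, b4)" by (metis prod_cases4)
    have le: "det2 X = 0 \<Longrightarrow> norm (qmap b X) \<le> norm X" for X
      using that by (rule contractionsD)
    have "norm b1 \<le> 1" "norm b2 \<le> 1" "norm b3 \<le> 1" "norm b4 \<le> 1"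
      using le[of "(1, 0, 0, 0)"] le[of "(0, 1, 0, 0)"] le[of "(0, 0, 1, 0)"] le[of "(0, 0, 0, 1)"]
      by (simp_all add: b qmap_def det2_def norm_Pair)
    moreover have "norm b \<le> norm b1 + (norm b2 + (norm b3 + norm b4))"
      unfolding b by (intro order_trans[OF norm_Pair_le] add_left_mono order_refl)
    ultimately show ?thesis by linarith
  qed
  then show "bounded contractions" unfolding bounded_iff by blast
  have "contractions = (\<Inter>X\<in>{X. det2 X = 0}. {b. norm (qmap b X) \<le> norm X})"
    unfolding contractions_def by fast
  also have "closed \<dots>"
    by (intro closed_INT ballI closed_Collect_le continuous_intros continuous_on_qmap)
  finally show "closed contractions" .
qed

text \<open>The slack norm X^2 - norm (qmap b X)^2 is nonnegative where the determinant vanishes, so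
  the S-lemma turns it into a positive semidefinite form h by adding t det. If h were nonzero, b
  could be moved both ways by a rank-one map whose effect h absorbs, against extremality.\<close>

lemma extreme_contraction:
  assumes ext: "b extreme_point_of contractions"
  obtains t where "\<And>X. (norm (qmap b X))\<^sup>2 = (norm X)\<^sup>2 + t * det2 X"
proof -
  have b: "b \<in> contractions" using ext by (simp add: extreme_point_of_def)
  define q where "q = (\<lambda>X Y. X \<bullet> Y - qmap b X \<bullet> qmap b Y)"
  define d :: "mat2 \<Rightarrow> mat2 \<Rightarrow> real" where "d = (\<lambda>(x1, x2, x3, x4) (y1, y2, y3, y4).
    (x1 * y4 + x4 * y1 - x2 * y3 - x3 * y2) / 2)"
  have q: "bilinear q" "q X Y = q Y X" for X Y
    unfolding q_def bilinear_def
    by (auto simp: linear_iff inner_add_left inner_add_right inner_commute algebra_simps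
        qmap_linear_simps simp del: inner_Pair)
  have d: "bilinear d" "d X Y = d Y X" "d X X = det2 X" for X Y
    by (auto simp: d_def det2_def bilinear_def linear_iff algebra_simps add_divide_distrib
        diff_divide_distrib split: prod.splits)
  have q_eq: "q X X = (norm X)\<^sup>2 - (norm (qmap b X))\<^sup>2" for X
    by (simp add: q_def power2_norm_eq_inner)
  have nonneg: "0 \<le> q X X" if "d X X = 0" for X
    using contractionsD[OF b, of X] that by (simp add: q_eq d power_mono)
  have indef: "0 < d (1, 0, 0, 1) (1, 0, 0, 1)" "d (0, 1, 1, 0) (0, 1, 1, 0) < 0"
    by (simp_all add: d_def)
  obtain t where t: "\<And>X. 0 \<le> q X X + t * d X X"
    using finsler[OF q d(1,2) nonneg indef] by blast
  define h where "h = (\<lambda>X Y. q X Y + t * d X Y)"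
  have h: "bilinear h" "h X Y = h Y X" "0 \<le> h X X" for X Y
    using q(2)[of X Y] d(2)[of X Y] t[of X] bilinear_add_scaled[OF q(1) d(1)]
    by (simp_all only: h_def)
  have "h Y Y = 0" for Y
  proof (rule ccontr)
    assume "h Y Y \<noteq> 0"
    then have Y: "0 < h Y Y" using h(3)[of Y] by simp
    have lin: "linear (h Y)" using h(1) unfolding bilinear_def by fast
    define W where "W = adjoint (h Y) 1"
    have W: "h Y X = W \<bullet> X" for X
      using adjoint_works[OF lin, of X 1] by (simp add: W_def inner_commute)
    have W0: "W \<noteq> 0" using Y W[of Y] by auto
    have linb: "linear (qmap b)" using bilinear_qmap unfolding bilinear_def by fast
    \<comment> \<open>The cross term of the perturbed norm contains
      \<open>qmap b X \<bullet> k\<close>, which has to be proportional to \<open>h Y X\<close>.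
      Both spaces have dimension 4, so either the adjoint is onto and k is a preimage of W, or k can
      be taken in its kernel and the cross term disappears.\<close>
    have "\<exists>k c. k \<noteq> 0 \<and> 0 \<le> c \<and> c \<le> 1 \<and> adjoint (qmap b) k = c *\<^sub>R W"
    proof (cases "inj (adjoint (qmap b))")
      case True
      have "surj (adjoint (qmap b))"
        by (rule linear_injective_imp_surjective[OF adjoint_linear[OF linb] True]) simp
      then obtain k where "adjoint (qmap b) k = W" by (metis surjD)
      then show ?thesis
        using W0 linear_0[OF adjoint_linear[OF linb]] by (intro exI[of _ k] exI[of _ 1]) auto
    next
      case False
      then obtain k where "k \<noteq> 0" "adjoint (qmap b) k = 0"
        using linear_injective_0[OF adjoint_linear[OF linb]] by auto
      then show ?thesis by (intro exI[of _ k] exI[of _ 0]) auto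
    qed
    then obtain k c where k: "k \<noteq> 0" and c: "0 \<le> c" "c \<le> 1"
      and adj: "adjoint (qmap b) k = c *\<^sub>R W" by blast
    have kb: "qmap b X \<bullet> k = c * h Y X" for X
      using adjoint_works[OF linb, of X k] by (simp add: adj W inner_commute)
    \<comment> \<open>Small enough that the increase, at most e (2 + norm k^2) (h Y X)^2, stays
      below (h Y X)^2 / h Y Y and so, by Cauchy-Schwarz, below h X X.\<close>
    define e where "e = min 1 (1 / (h Y Y * (2 + (norm k)\<^sup>2)))"
    have pos: "0 < h Y Y * (2 + (norm k)\<^sup>2)" using Y by (simp add: add_pos_nonneg)
    have e: "0 < e" "e \<le> 1" "e * (2 + (norm k)\<^sup>2) \<le> 1 / h Y Y"
    proof -
      show "0 < e" "e \<le> 1" using pos by (auto simp: e_def)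
      have "e \<le> 1 / (h Y Y * (2 + (norm k)\<^sup>2))" by (simp add: e_def)
      then have "e * (2 + (norm k)\<^sup>2) \<le> 1 / (h Y Y * (2 + (norm k)\<^sup>2)) * (2 + (norm k)\<^sup>2)"
        by (intro mult_right_mono) auto
      also have "\<dots> = 1 / h Y Y"
        using Y pos by (simp add: field_simps)
      finally show "e * (2 + (norm k)\<^sup>2) \<le> 1 / h Y Y" .
    qed
    define w where "w = (\<lambda>X. e * h Y X)"
    define \<Delta> where "\<Delta> = (w (1, 0, 0, 0) *\<^sub>R k, w (0, 1, 0, 0) *\<^sub>R k, w (0, 0, 1, 0) *\<^sub>R k, w (0, 0, 0, 1) *\<^sub>R k)"
    have \<Delta>: "qmap \<Delta> X = w X *\<^sub>R k" for X
    proof -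
      obtain x1 x2 x3 x4 where X: "X = (x1, x2, x3, x4)" by (metis prod_cases4)
      have X': "X = x1 *\<^sub>R (1, 0, 0, 0) + x2 *\<^sub>R (0, 1, 0, 0) + x3 *\<^sub>R (0, 0, 1, 0) + x4 *\<^sub>R (0, 0, 0, 1)"
        by (simp add: X)
      have "w X = x1 * w (1, 0, 0, 0) + x2 * w (0, 1, 0, 0) + x3 * w (0, 0, 1, 0) + x4 * w (0, 0, 0, 1)"
        unfolding w_def by (subst X') (simp only: linear_add[OF lin] linear_scale[OF lin], simp add: algebra_simps)
      then show ?thesis
        by (simp add: \<Delta>_def qmap_def X scaleR_left_distrib)
    qed
    have "b + r *\<^sub>R \<Delta> \<in> contractions" if r: "r\<^sup>2 = 1" for r
    proof (rule contractionsI)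
      fix X :: mat2 assume X: "det2 X = 0"
      have r1: "r = 1 \<or> r = -1" using r by (simp add: power2_eq_1_iff)
      have "(norm (qmap (b + r *\<^sub>R \<Delta>) X))\<^sup>2
          = (norm (qmap b X))\<^sup>2 + 2 * r * w X * (c * h Y X) + r\<^sup>2 * (w X)\<^sup>2 * (norm k)\<^sup>2"
        unfolding qmap_linear_simps \<Delta> power2_norm_eq_inner kb[symmetric]
        by (simp add: inner_add_left inner_add_right inner_commute power2_eq_square algebra_simps)
      also have "\<dots> = (norm (qmap b X))\<^sup>2 + (h Y X)\<^sup>2 * (e * (2 * (r * c) + e * (norm k)\<^sup>2))"
        using r by (simp add: w_def power2_eq_square algebra_simps)
      also have "\<dots> \<le> (norm (qmap b X))\<^sup>2 + (h Y X)\<^sup>2 * (1 / h Y Y)"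
      proof (intro add_left_mono mult_left_mono)
        have "r * c \<le> 1" using r1 c by auto
        moreover have "e * (norm k)\<^sup>2 \<le> (norm k)\<^sup>2" using e by (simp add: mult_left_le_one_le)
        ultimately have "e * (2 * (r * c) + e * (norm k)\<^sup>2) \<le> e * (2 + (norm k)\<^sup>2)"
          using e by (intro mult_left_mono) auto
        then show "e * (2 * (r * c) + e * (norm k)\<^sup>2) \<le> 1 / h Y Y" using e by linarith
      qed simp
      also have "\<dots> \<le> (norm (qmap b X))\<^sup>2 + h X X"
        using psd_bilinear_Cauchy_Schwarz[OF h Y, of X] Y
        by (simp add: divide_simps algebra_simps)
      also have "\<dots> = (norm X)\<^sup>2" using X by (simp add: h_def q_eq d)
      finally show "norm (qmap (b + r *\<^sub>R \<Delta>) X) \<le> norm X" by (rule power2_le_imp_le) simp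
    qed
    from this[of 1] this[of "-1"] have in12: "b + \<Delta> \<in> contractions" "b - \<Delta> \<in> contractions" by simp_all
    have "\<Delta> \<noteq> 0"
      using \<Delta>[of Y] k e Y by (auto simp: w_def bilinear_lzero[OF bilinear_qmap])
    have "b + \<Delta> \<noteq> b - \<Delta>"
    proof
      assume "b + \<Delta> = b - \<Delta>"
      then have "\<Delta> = - \<Delta>" by (simp only: diff_conv_add_uminus add_left_cancel)
      then have "\<Delta> + \<Delta> = 0" by (metis add.right_inverse)
      then have "2 *\<^sub>R \<Delta> = 0" by (simp only: scaleR_2)
      with \<open>\<Delta> \<noteq> 0\<close> show False by (metis scaleR_eq_0_iff zero_neq_numeral)
    qed
    then have "midpoint (b + \<Delta>) (b - \<Delta>) \<in> open_segment (b + \<Delta>) (b - \<Delta>)" by simp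
    moreover have "midpoint (b + \<Delta>) (b - \<Delta>) = b"
      by (simp add: midpoint_def scaleR_2[symmetric])
    ultimately show False using ext in12 by (auto simp: extreme_point_of_def)
  qed
  then have h0: "q X X + t * d X X = 0" for X by (simp only: h_def)
  have "(norm (qmap b X))\<^sup>2 = (norm X)\<^sup>2 + t * det2 X" for X
    using h0[of X] unfolding q_eq d(3) by linarith
  then show thesis by (rule that)
qed


text \<open>
  Both products have real part \<open>s \<bullet> 1\<close>, and the imaginary part of \<open>s\<close> is orthogonal to those of
  \<open>p\<close> and \<open>r\<close>, hence a multiple of their cross product; the norms leave only the sign open.
\<close>

lemma quat_unit_product:
  fixes p r s :: quat
  assumes p: "qRe p = 0" "norm p = 1" and r: "qRe r = 0" "norm r = 1" and s: "norm s = 1"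
    and orth: "p \<bullet> s = 0" "r \<bullet> s = 0" and t: "qRe s = - (p \<bullet> r)"
  shows "s = r * p \<or> s = p * r"
proof -
  obtain p1 p2 p3 where P: "p = Quat 0 p1 p2 p3" using p(1) by (metis quat.collapse)
  obtain r1 r2 r3 where R: "r = Quat 0 r1 r2 r3" using r(1) by (metis quat.collapse)
  obtain s0 s1 s2 s3 where S: "s = Quat s0 s1 s2 s3" by (metis quat.collapse)
  \<comment> \<open>The cross product of the imaginary parts of r and p; \<open>D\<close> is its
    inner product with the imaginary part of s.\<close>
  define n1 n2 n3 where "n1 = r2 * p3 - r3 * p2" "n2 = r3 * p1 - r1 * p3" "n3 = r1 * p2 - r2 * p1"
  note n = this
  define D where "D = s1 * n1 + s2 * n2 + s3 * n3"
  have pp: "p1\<^sup>2 + p2\<^sup>2 + p3\<^sup>2 = 1" and rr: "r1\<^sup>2 + r2\<^sup>2 + r3\<^sup>2 = 1"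
    and ss: "s0\<^sup>2 + s1\<^sup>2 + s2\<^sup>2 + s3\<^sup>2 = 1"
    using p(2) r(2) s power2_norm_quat[of p] power2_norm_quat[of r] power2_norm_quat[of s]
    by (simp_all add: P R S)
  have ps: "p1 * s1 + p2 * s2 + p3 * s3 = 0" and rs: "r1 * s1 + r2 * s2 + r3 * s3 = 0"
    and s0: "s0 = - (p1 * r1 + p2 * r2 + p3 * r3)"
    using orth t by (simp_all add: P R S inner_quat_def)
  have nn: "n1\<^sup>2 + n2\<^sup>2 + n3\<^sup>2 = 1 - s0\<^sup>2"
  proof -
    have "n1\<^sup>2 + n2\<^sup>2 + n3\<^sup>2 = (p1\<^sup>2 + p2\<^sup>2 + p3\<^sup>2) * (r1\<^sup>2 + r2\<^sup>2 + r3\<^sup>2)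
        - (p1 * r1 + p2 * r2 + p3 * r3)\<^sup>2"
      unfolding n by algebra
    moreover have "s0\<^sup>2 = (p1 * r1 + p2 * r2 + p3 * r3)\<^sup>2" by (simp only: s0 power2_minus)
    ultimately show ?thesis using pp rr by simp
  qed
  \<comment> \<open>Lagrange's identity; the cross product of n with the imaginary part of s
    vanishes because that part is orthogonal to p and r.\<close>
  have D2: "D\<^sup>2 = (n1\<^sup>2 + n2\<^sup>2 + n3\<^sup>2) * (s1\<^sup>2 + s2\<^sup>2 + s3\<^sup>2)"
  proof -
    have "(n1\<^sup>2 + n2\<^sup>2 + n3\<^sup>2) * (s1\<^sup>2 + s2\<^sup>2 + s3\<^sup>2) - D\<^sup>2
        = (n2 * s3 - n3 * s2)\<^sup>2 + (n3 * s1 - n1 * s3)\<^sup>2 + (n1 * s2 - n2 * s1)\<^sup>2"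
      unfolding D_def by algebra
    moreover have "n2 * s3 - n3 * s2 = 0" "n3 * s1 - n1 * s3 = 0" "n1 * s2 - n2 * s1 = 0"
      unfolding n using ps rs by algebra+
    ultimately show ?thesis by simp
  qed
  have ss': "s1\<^sup>2 + s2\<^sup>2 + s3\<^sup>2 = 1 - s0\<^sup>2" using ss by simp
  have "(D - (1 - s0\<^sup>2)) * (D + (1 - s0\<^sup>2)) = 0"
    using D2[unfolded nn ss'] by algebra
  then consider "D = 1 - s0\<^sup>2" | "D = - (1 - s0\<^sup>2)" by auto
  then show ?thesis
  proof cases
    case 1
    have "(s1 - n1)\<^sup>2 + (s2 - n2)\<^sup>2 + (s3 - n3)\<^sup>2
        = (s1\<^sup>2 + s2\<^sup>2 + s3\<^sup>2) + (n1\<^sup>2 + n2\<^sup>2 + n3\<^sup>2) - 2 * D"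
      unfolding D_def by algebra
    also have "\<dots> = 0" unfolding ss' nn 1 by simp
    finally have "s1 = n1 \<and> s2 = n2 \<and> s3 = n3"
      by (smt (verit) zero_le_power2 power2_eq_iff_nonneg zero_eq_power2)
    then have "s = r * p"
      by (simp add: P R S quat_eq_iff quat_mult_sel s0 n algebra_simps)
    then show ?thesis ..
  next
    case 2
    have "(s1 + n1)\<^sup>2 + (s2 + n2)\<^sup>2 + (s3 + n3)\<^sup>2
        = (s1\<^sup>2 + s2\<^sup>2 + s3\<^sup>2) + (n1\<^sup>2 + n2\<^sup>2 + n3\<^sup>2) + 2 * D"
      unfolding D_def by algebra
    also have "\<dots> = 0" unfolding ss' nn 2 by simp
    finally have "s1 + n1 = 0 \<and> s2 + n2 = 0 \<and> s3 + n3 = 0"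
      by (smt (verit) zero_le_power2 zero_eq_power2)
    then have "s1 = - n1 \<and> s2 = - n2 \<and> s3 = - n3" by linarith
    then have "s = p * r"
      by (simp add: P R S quat_eq_iff quat_mult_sel s0 n algebra_simps)
    then show ?thesis ..
  qed
qed

lemma inner_unit_mult: "norm u = 1 \<Longrightarrow> (u * x) \<bullet> (u * y) = x \<bullet> (y :: quat)"
proof -
  assume u: "norm u = 1"
  have "(u * x) \<bullet> (u * y) = qRe (qcnj x * (qcnj u * u) * y)"
    by (simp add: quat_inner_qRe(1) qcnj_mult mult.assoc)
  then show ?thesis by (simp add: mult_qcnj_self u quat_inner_qRe(1))
qed

text \<open>The hypothesis gives \<open>|\<beta>(x, y)| = |x| |y|\<close> on \<open>\<real>\<^sup>2 \<times> \<real>\<^sup>2\<close>, so up to the unit \<open>b\<^sub>1\<^sub>1\<close> the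
  map \<open>\<beta>\<close> is quaternion multiplication with the factors in one of the two orders.\<close>

lemma isometric_qmap:
  assumes iso: "\<And>X. (norm (qmap (b\<^sub>1\<^sub>1, b\<^sub>1\<^sub>2, b\<^sub>2\<^sub>1, b\<^sub>2\<^sub>2) X))\<^sup>2 = (norm X)\<^sup>2 + t * det2 X"
  shows "norm b\<^sub>1\<^sub>1 = 1" "norm b\<^sub>1\<^sub>2 = 1" "norm b\<^sub>2\<^sub>1 = 1" "b\<^sub>1\<^sub>1 \<bullet> b\<^sub>2\<^sub>1 = 0" "b\<^sub>1\<^sub>1 \<bullet> b\<^sub>1\<^sub>2 = 0"
    "b\<^sub>2\<^sub>2 = b\<^sub>2\<^sub>1 * qcnj b\<^sub>1\<^sub>1 * b\<^sub>1\<^sub>2 \<or> b\<^sub>2\<^sub>2 = b\<^sub>1\<^sub>2 * qcnj b\<^sub>1\<^sub>1 * b\<^sub>2\<^sub>1"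
proof -
  have N: "(norm (x1, x2, x3, x4))\<^sup>2 = x1\<^sup>2 + (x2\<^sup>2 + (x3\<^sup>2 + x4\<^sup>2))" for x1 x2 x3 x4 :: real
    by (simp add: norm_Pair)
  have s: "(norm (x + y))\<^sup>2 = (norm x)\<^sup>2 + (norm y)\<^sup>2 + 2 * (x \<bullet> y)" for x y :: quat
    unfolding power2_norm_eq_inner by (simp add: inner_add_left inner_add_right inner_commute)
  have I: "(norm (qmap (b\<^sub>1\<^sub>1, b\<^sub>1\<^sub>2, b\<^sub>2\<^sub>1, b\<^sub>2\<^sub>2) (x1, x2, x3, x4)))\<^sup>2
      = x1\<^sup>2 + (x2\<^sup>2 + (x3\<^sup>2 + x4\<^sup>2)) + t * (x1 * x4 - x2 * x3)" for x1 x2 x3 x4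
    using iso[of "(x1, x2, x3, x4)"] unfolding N det2_def by simp
  have n2: "(norm b\<^sub>1\<^sub>1)\<^sup>2 = 1" "(norm b\<^sub>1\<^sub>2)\<^sup>2 = 1" "(norm b\<^sub>2\<^sub>1)\<^sup>2 = 1" "(norm b\<^sub>2\<^sub>2)\<^sup>2 = 1"
    using I[of 1 0 0 0] I[of 0 1 0 0] I[of 0 0 1 0] I[of 0 0 0 1]
    by (simp_all add: qmap_def)
  then have n: "norm b\<^sub>1\<^sub>1 = 1" "norm b\<^sub>1\<^sub>2 = 1" "norm b\<^sub>2\<^sub>1 = 1" "norm b\<^sub>2\<^sub>2 = 1"
    by (simp_all add: power2_eq_1_iff) (smt (verit) norm_ge_zero)+
  have o: "b\<^sub>1\<^sub>1 \<bullet> b\<^sub>1\<^sub>2 = 0" "b\<^sub>1\<^sub>1 \<bullet> b\<^sub>2\<^sub>1 = 0" "b\<^sub>1\<^sub>2 \<bullet> b\<^sub>2\<^sub>2 = 0" "b\<^sub>2\<^sub>1 \<bullet> b\<^sub>2\<^sub>2 = 0"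
    "2 * (b\<^sub>1\<^sub>1 \<bullet> b\<^sub>2\<^sub>2) = t" "2 * (b\<^sub>1\<^sub>2 \<bullet> b\<^sub>2\<^sub>1) = - t"
    using I[of 1 1 0 0] I[of 1 0 1 0] I[of 0 1 0 1] I[of 0 0 1 1]
      I[of 1 0 0 1] I[of 0 1 1 0] n2
    by (simp_all add: qmap_def s)
  let ?u = "qcnj b\<^sub>1\<^sub>1"
  have u: "norm ?u = 1" using n by simp
  have cancel: "b\<^sub>1\<^sub>1 * (?u * x) = x" for x
    using n by (simp add: mult.assoc[symmetric] mult_qcnj_self)
  \<comment> \<open>Left multiplication by \<open>?u\<close> is an isometry taking
    \<open>b\<^sub>1\<^sub>1\<close> to 1, so orthogonality to \<open>b\<^sub>1\<^sub>1\<close>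
    becomes a vanishing real part. Eliminating t from the last two equations of \<open>o\<close>
    gives the required real part of \<open>?u * b\<^sub>2\<^sub>2\<close>.\<close>
  have "?u * b\<^sub>2\<^sub>2 = (?u * b\<^sub>2\<^sub>1) * (?u * b\<^sub>1\<^sub>2) \<or> ?u * b\<^sub>2\<^sub>2 = (?u * b\<^sub>1\<^sub>2) * (?u * b\<^sub>2\<^sub>1)"
    using n o u by (intro quat_unit_product)
      (simp_all add: norm_quat_mult inner_unit_mult quat_inner_qRe(1)[symmetric])
  then have "b\<^sub>1\<^sub>1 * (?u * b\<^sub>2\<^sub>2) = b\<^sub>1\<^sub>1 * (?u * (b\<^sub>2\<^sub>1 * (?u * b\<^sub>1\<^sub>2)))
      \<or> b\<^sub>1\<^sub>1 * (?u * b\<^sub>2\<^sub>2) = b\<^sub>1\<^sub>1 * (?u * (b\<^sub>1\<^sub>2 * (?u * b\<^sub>2\<^sub>1)))"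
    by (simp only: mult.assoc) metis
  then show "b\<^sub>2\<^sub>2 = b\<^sub>2\<^sub>1 * ?u * b\<^sub>1\<^sub>2 \<or> b\<^sub>2\<^sub>2 = b\<^sub>1\<^sub>2 * ?u * b\<^sub>2\<^sub>1"
    by (simp only: cancel mult.assoc)
  show "norm b\<^sub>1\<^sub>1 = 1" "norm b\<^sub>1\<^sub>2 = 1" "norm b\<^sub>2\<^sub>1 = 1" "b\<^sub>1\<^sub>1 \<bullet> b\<^sub>2\<^sub>1 = 0" "b\<^sub>1\<^sub>1 \<bullet> b\<^sub>1\<^sub>2 = 0"
    using n o by auto
qed

text \<open>The diagonal is fixed and the off-diagonal entry is linear in b, so the suitable b form
  a convex set; at an extreme contraction the map is itself a square.\<close>

lemma sos_contraction:
  fixes x\<^sub>1 x\<^sub>2 y\<^sub>1 y\<^sub>2 :: "'v::real_vector \<Rightarrow> real"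
  assumes lin: "linear x\<^sub>1" "linear x\<^sub>2" "linear y\<^sub>1" "linear y\<^sub>2" and b: "b \<in> contractions"
  shows "sos (\<lambda>v. ((x\<^sub>1 v)\<^sup>2 + (x\<^sub>2 v)\<^sup>2, (y\<^sub>1 v)\<^sup>2 + (y\<^sub>2 v)\<^sup>2,
    qmap b (x\<^sub>1 v * y\<^sub>1 v, x\<^sub>1 v * y\<^sub>2 v, x\<^sub>2 v * y\<^sub>1 v, x\<^sub>2 v * y\<^sub>2 v)))"
proof -
  let ?Z = "\<lambda>b v. ((x\<^sub>1 v)\<^sup>2 + (x\<^sub>2 v)\<^sup>2, (y\<^sub>1 v)\<^sup>2 + (y\<^sub>2 v)\<^sup>2,
    qmap b (x\<^sub>1 v * y\<^sub>1 v, x\<^sub>1 v * y\<^sub>2 v, x\<^sub>2 v * y\<^sub>1 v, x\<^sub>2 v * y\<^sub>2 v))"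
  have two: "linear (\<lambda>v. f v *\<^sub>R x + g v *\<^sub>R y)" if "linear f" "linear g"
    for f g :: "'v \<Rightarrow> real" and x y :: quat
    using that by (intro linear_compose_add linear_scaleR_const)
  have norm2: "(norm (r *\<^sub>R x + s *\<^sub>R y))\<^sup>2 = r\<^sup>2 + s\<^sup>2"
    if "norm x = 1" "norm y = 1" "x \<bullet> y = 0" for x y :: quat and r s
    unfolding power2_norm_eq_inner inner_add_left inner_add_right inner_scaleR_left inner_scaleR_right
    using that by (simp add: dot_square_norm inner_commute power2_eq_square)
  have ext: "sos (?Z b)" if extb: "b extreme_point_of contractions" for b
  proof -
    obtain b\<^sub>1\<^sub>1 b\<^sub>1\<^sub>2 b\<^sub>2\<^sub>1 b\<^sub>2\<^sub>2 where beq: "b = (b\<^sub>1\<^sub>1, b\<^sub>1\<^sub>2, b\<^sub>2\<^sub>1, b\<^sub>2\<^sub>2)" by (metis prod_cases4)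
    obtain t where iso: "\<And>X. (norm (qmap b X))\<^sup>2 = (norm X)\<^sup>2 + t * det2 X"
      using extreme_contraction[OF extb] by blast
    note I = isometric_qmap[OF iso[unfolded beq]]
    let ?c = "\<lambda>v. x\<^sub>1 v *\<^sub>R b\<^sub>1\<^sub>1 + x\<^sub>2 v *\<^sub>R b\<^sub>2\<^sub>1"
    note c = norm2[OF I(1,3,4)]
    have one: "b\<^sub>1\<^sub>1 * qcnj b\<^sub>1\<^sub>1 = 1" "qcnj b\<^sub>1\<^sub>1 * b\<^sub>1\<^sub>1 = 1" using I(1) by (simp_all add: mult_qcnj_self)
    have one': "b\<^sub>1\<^sub>1 * (qcnj b\<^sub>1\<^sub>1 * x) = x" for x
      using one by (simp add: mult.assoc[symmetric])
    have qcnj_one: "qcnj 1 = 1" by (simp add: quat_eq_iff)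
    from I(6) show ?thesis
    proof
      assume b22: "b\<^sub>2\<^sub>2 = b\<^sub>2\<^sub>1 * qcnj b\<^sub>1\<^sub>1 * b\<^sub>1\<^sub>2"
      \<comment> \<open>Right multiplication by \<open>qcnj p\<close> takes
        \<open>b\<^sub>1\<^sub>1\<close> to \<open>b\<^sub>1\<^sub>2\<close> and
        \<open>b\<^sub>2\<^sub>1\<close> to \<open>b\<^sub>2\<^sub>2\<close>, so \<open>?c\<close>
        times the conjugate of \<open>y\<^sub>1 + y\<^sub>2 p\<close> has the four entries of b as
        coefficients.\<close>
      define p where "p = qcnj b\<^sub>1\<^sub>2 * b\<^sub>1\<^sub>1"
      have p: "norm p = 1" "1 \<bullet> p = 0" "b\<^sub>1\<^sub>1 * qcnj p = b\<^sub>1\<^sub>2" "b\<^sub>2\<^sub>1 * qcnj p = b\<^sub>2\<^sub>2"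
        using I(1,2,5) one
        by (simp_all add: p_def b22 norm_quat_mult qcnj_mult qcnj_qcnj mult.assoc one', 
            simp add: inner_quat_def quat_mult_sel algebra_simps)
      have "sq1 ?c (\<lambda>v. y\<^sub>1 v *\<^sub>R 1 + y\<^sub>2 v *\<^sub>R p) = ?Z b"
        unfolding sq1_def beq qmap_def split_conv c norm2[OF norm_quat_one p(1,2)]
        by (simp add: qcnj_add qcnj_scaleR qcnj_one distrib_left distrib_right p(3,4) mult.commute scaleR_right_distrib add_ac)
      then show ?thesis using sos_sq(1)[OF two[OF lin(1,2), of b\<^sub>1\<^sub>1 b\<^sub>2\<^sub>1] two[OF lin(3,4), of 1 p]] by simp
    next
      assume b22: "b\<^sub>2\<^sub>2 = b\<^sub>1\<^sub>2 * qcnj b\<^sub>1\<^sub>1 * b\<^sub>2\<^sub>1"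
      \<comment> \<open>The mirror image: left multiplication by \<open>qcnj p\<close> has the same
        effect and leads to a square of the second kind.\<close>
      define p where "p = b\<^sub>1\<^sub>1 * qcnj b\<^sub>1\<^sub>2"
      have p: "norm p = 1" "1 \<bullet> p = 0" "qcnj p * b\<^sub>1\<^sub>1 = b\<^sub>1\<^sub>2" "qcnj p * b\<^sub>2\<^sub>1 = b\<^sub>2\<^sub>2"
        using I(1,2,5) one
        by (simp_all add: p_def b22 norm_quat_mult qcnj_mult qcnj_qcnj mult.assoc one', 
            simp add: inner_quat_def quat_mult_sel algebra_simps)
      have "sq2 ?c (\<lambda>v. y\<^sub>1 v *\<^sub>R 1 + y\<^sub>2 v *\<^sub>R p) = ?Z b"
        unfolding sq2_def beq qmap_def split_conv c norm2[OF norm_quat_one p(1,2)]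
        by (simp add: qcnj_add qcnj_scaleR qcnj_one distrib_left distrib_right p(3,4) mult.commute scaleR_right_distrib add_ac)
      then show ?thesis using sos_sq(2)[OF two[OF lin(1,2), of b\<^sub>1\<^sub>1 b\<^sub>2\<^sub>1] two[OF lin(3,4), of 1 p]] by simp
    qed
  qed
  have "convex {b. sos (?Z b)}"
    unfolding convex_def
  proof (intro ballI allI impI, unfold mem_Collect_eq)
    fix b c and u v :: real
    assume *: "sos (?Z b)" "sos (?Z c)" "0 \<le> u" "0 \<le> v" "u + v = 1"
    have "?Z (u *\<^sub>R b + v *\<^sub>R c) = (\<lambda>w. u *\<^sub>R ?Z b w + v *\<^sub>R ?Z c w)"
      using *(5) by (simp only: qmap_linear_simps fun_eq_iff scaleR_Pair add_Pair prod.inject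
          real_scaleR_def distrib_right[symmetric]) simp
    then show "sos (?Z (u *\<^sub>R b + v *\<^sub>R c))"
      using * by (simp only: sos_add sos_scaleR)
  qed
  then have "convex hull {b. b extreme_point_of contractions} \<subseteq> {b. sos (?Z b)}"
    using ext by (intro hull_minimal) auto
  then show ?thesis
    using b Krein_Milman_Minkowski[OF compact_contractions convex_contractions] by blast
qed


section \<open>Positive quadratic maps are limits of sums of squares\<close>

text \<open>Both sides are homogeneous in (x, z) and in (y, w) separately, so nonzero z and w can be
  scaled to 1, where the hypothesis applies at (x / z, y / w, 1). Continuity covers z = 0 and w =
  0.\<close>

lemma bihomogeneous_bound:
  fixes a b :: "real \<Rightarrow> real \<Rightarrow> real" and q\<^sub>1\<^sub>2 q\<^sub>1\<^sub>3 q\<^sub>2\<^sub>3 q\<^sub>3\<^sub>3 :: quat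
  assumes a: "a = (\<lambda>x z. \<alpha>\<^sub>1 * x\<^sup>2 + 2 * \<alpha>\<^sub>1\<^sub>3 * x * z + \<alpha>\<^sub>3 * z\<^sup>2)"
    and b: "b = (\<lambda>y z. \<beta>\<^sub>2 * y\<^sup>2 + 2 * \<beta>\<^sub>2\<^sub>3 * y * z + \<beta>\<^sub>3 * z\<^sup>2)"
    and bound: "\<And>x y z. (norm ((2 * x * y) *\<^sub>R q\<^sub>1\<^sub>2 + (2 * x * z) *\<^sub>R q\<^sub>1\<^sub>3 + (2 * y * z) *\<^sub>R q\<^sub>2\<^sub>3 + z\<^sup>2 *\<^sub>R q\<^sub>3\<^sub>3))\<^sup>2
      \<le> a x z * b y z"
  shows "(norm ((2 * x * y) *\<^sub>R q\<^sub>1\<^sub>2 + (2 * x * w) *\<^sub>R q\<^sub>1\<^sub>3 + (2 * y * z) *\<^sub>R q\<^sub>2\<^sub>3 + (z * w) *\<^sub>R q\<^sub>3\<^sub>3))\<^sup>2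
    \<le> a x z * b y w"
proof -
  let ?q = "\<lambda>x y z w. (2 * x * y) *\<^sub>R q\<^sub>1\<^sub>2 + (2 * x * w) *\<^sub>R q\<^sub>1\<^sub>3 + (2 * y * z) *\<^sub>R q\<^sub>2\<^sub>3 + (z * w) *\<^sub>R q\<^sub>3\<^sub>3"
  have *: "(norm (?q x y z w))\<^sup>2 \<le> a x z * b y w" if "z \<noteq> 0" "w \<noteq> 0" for z w
  proof -
    have "(z * w) *\<^sub>R ?q (x / z) (y / w) 1 1 = ?q x y z w"
      using that by (simp add: scaleR_right_distrib mult_ac)
    then have "(norm (?q x y z w))\<^sup>2 = (z * w)\<^sup>2 * (norm (?q (x / z) (y / w) 1 1))\<^sup>2"
      by (metis norm_scaleR power_mult_distrib power2_abs)
    also have "\<dots> \<le> (z * w)\<^sup>2 * (a (x / z) 1 * b (y / w) 1)"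
      using bound[of "x / z" "y / w" 1] by (intro mult_left_mono) auto
    also have "\<dots> = (z\<^sup>2 * a (x / z) 1) * (w\<^sup>2 * b (y / w) 1)"
      by (simp add: power_mult_distrib)
    also have "z\<^sup>2 * a (x / z) 1 = a x z"
      using that by (simp add: a field_simps power2_eq_square)
    also have "w\<^sup>2 * b (y / w) 1 = b y w"
      using that by (simp add: b field_simps power2_eq_square)
    finally show ?thesis .
  qed
  define F G where "F = (\<lambda>d. (norm (?q x y (z + d) (w + d)))\<^sup>2)"
    and "G = (\<lambda>d. a x (z + d) * b y (w + d))"
  have "isCont F 0" "isCont G 0"
    unfolding F_def G_def a b by (intro continuous_intros)+
  then have lim: "(F \<longlongrightarrow> F 0) (at 0)" "(G \<longlongrightarrow> G 0) (at 0)" by (auto simp: isCont_def)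
  have "eventually (\<lambda>d. F d \<le> G d) (at 0)"
    using eventually_neq_at_within[of "- z" 0 UNIV] eventually_neq_at_within[of "- w" 0 UNIV]
  proof eventually_elim
    case (elim d)
    then have "z + d \<noteq> 0" "w + d \<noteq> 0" by linarith+
    then show ?case using * by (simp add: F_def G_def)
  qed
  then have "F 0 \<le> G 0" by (rule tendsto_le[OF trivial_limit_at lim(2,1)])
  then show ?thesis by (simp add: F_def G_def)
qed

lemma det2_zero_rank_one:
  assumes "det2 X = 0"
  obtains p\<^sub>1 p\<^sub>2 y\<^sub>1 y\<^sub>2 where "X = (p\<^sub>1 * y\<^sub>1, p\<^sub>1 * y\<^sub>2, p\<^sub>2 * y\<^sub>1, p\<^sub>2 * y\<^sub>2)"
proof -
  obtain a b c d where X: "X = (a, b, c, d)" by (metis prod_cases4)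
  have det: "a * d = b * c" using assms by (simp add: X det2_def)
  show thesis
  proof (cases "a = 0")
    case a: True
    show ?thesis
    proof (cases "b = 0")
      case True then show ?thesis using a by (intro that[of 0 c d 1]) (simp add: X)
    next
      case False then show ?thesis using a det by (intro that[of 1 0 b "d / b"]) (simp add: X)
    qed
  next
    case False then show ?thesis using det by (intro that[of 1 a b "c / a"]) (simp add: X field_simps)
  qed
qed


lemma psd_form_square:
  fixes \<alpha>\<^sub>1 \<alpha>\<^sub>1\<^sub>3 \<alpha>\<^sub>3 :: real
  assumes "0 < \<alpha>\<^sub>1" "\<alpha>\<^sub>1\<^sub>3\<^sup>2 < \<alpha>\<^sub>1 * \<alpha>\<^sub>3"
  obtains f g h where "f \<noteq> 0" "h \<noteq> 0"
    "\<And>x z. (f * x + g * z)\<^sup>2 + (h * z)\<^sup>2 = \<alpha>\<^sub>1 * x\<^sup>2 + 2 * \<alpha>\<^sub>1\<^sub>3 * x * z + \<alpha>\<^sub>3 * z\<^sup>2"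
proof (rule that)
  let ?f = "sqrt \<alpha>\<^sub>1"
  have pos: "0 < \<alpha>\<^sub>3 - \<alpha>\<^sub>1\<^sub>3\<^sup>2 / \<alpha>\<^sub>1" using assms by (simp add: field_simps)
  show "?f \<noteq> 0" "sqrt (\<alpha>\<^sub>3 - \<alpha>\<^sub>1\<^sub>3\<^sup>2 / \<alpha>\<^sub>1) \<noteq> 0" using assms(1) pos by auto
  have f: "?f\<^sup>2 = \<alpha>\<^sub>1" using assms by simp
  fix x z
  have "(?f * x + (\<alpha>\<^sub>1\<^sub>3 / ?f) * z)\<^sup>2 = ?f\<^sup>2 * x\<^sup>2 + 2 * \<alpha>\<^sub>1\<^sub>3 * x * z + (\<alpha>\<^sub>1\<^sub>3\<^sup>2 / ?f\<^sup>2) * z\<^sup>2"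
    using assms(1) by (simp add: power2_sum power_mult_distrib power_divide)
  moreover have "(sqrt (\<alpha>\<^sub>3 - \<alpha>\<^sub>1\<^sub>3\<^sup>2 / \<alpha>\<^sub>1) * z)\<^sup>2 = (\<alpha>\<^sub>3 - \<alpha>\<^sub>1\<^sub>3\<^sup>2 / \<alpha>\<^sub>1) * z\<^sup>2"
    using pos by (simp add: power_mult_distrib)
  ultimately show "(?f * x + (\<alpha>\<^sub>1\<^sub>3 / ?f) * z)\<^sup>2 + (sqrt (\<alpha>\<^sub>3 - \<alpha>\<^sub>1\<^sub>3\<^sup>2 / \<alpha>\<^sub>1) * z)\<^sup>2
      = \<alpha>\<^sub>1 * x\<^sup>2 + 2 * \<alpha>\<^sub>1\<^sub>3 * x * z + \<alpha>\<^sub>3 * z\<^sup>2"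
    unfolding f by (simp add: algebra_simps)
qed

text \<open>Definiteness makes each diagonal form a sum of squares of two independent linear forms.
  In these as coordinates the decoupled bound says that the off-diagonal entry is a contraction on
  matrices of rank at most one.\<close>

lemma sos_two_null_vectors_strict:
  fixes x y z :: "'v::real_vector \<Rightarrow> real" and q\<^sub>1\<^sub>2 q\<^sub>1\<^sub>3 q\<^sub>2\<^sub>3 q\<^sub>3\<^sub>3 :: quat
  assumes lin: "linear x" "linear y" "linear z"
    and \<alpha>: "0 < \<alpha>\<^sub>1" "\<alpha>\<^sub>1\<^sub>3\<^sup>2 < \<alpha>\<^sub>1 * \<alpha>\<^sub>3" and \<beta>: "0 < \<beta>\<^sub>2" "\<beta>\<^sub>2\<^sub>3\<^sup>2 < \<beta>\<^sub>2 * \<beta>\<^sub>3"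
    and a: "a = (\<lambda>x z. \<alpha>\<^sub>1 * x\<^sup>2 + 2 * \<alpha>\<^sub>1\<^sub>3 * x * z + \<alpha>\<^sub>3 * z\<^sup>2)"
    and b: "b = (\<lambda>y z. \<beta>\<^sub>2 * y\<^sup>2 + 2 * \<beta>\<^sub>2\<^sub>3 * y * z + \<beta>\<^sub>3 * z\<^sup>2)"
    and bound: "\<And>x y z. (norm ((2 * x * y) *\<^sub>R q\<^sub>1\<^sub>2 + (2 * x * z) *\<^sub>R q\<^sub>1\<^sub>3 + (2 * y * z) *\<^sub>R q\<^sub>2\<^sub>3 + z\<^sup>2 *\<^sub>R q\<^sub>3\<^sub>3))\<^sup>2
      \<le> a x z * b y z"
  shows "sos (\<lambda>v. (a (x v) (z v), b (y v) (z v),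
    (2 * x v * y v) *\<^sub>R q\<^sub>1\<^sub>2 + (2 * x v * z v) *\<^sub>R q\<^sub>1\<^sub>3 + (2 * y v * z v) *\<^sub>R q\<^sub>2\<^sub>3 + (z v)\<^sup>2 *\<^sub>R q\<^sub>3\<^sub>3))"
proof -
  obtain f g h where f: "f \<noteq> 0" "h \<noteq> 0" "\<And>x z. (f * x + g * z)\<^sup>2 + (h * z)\<^sup>2 = a x z"
    using psd_form_square[OF \<alpha>] a by metis
  obtain k l m where k: "k \<noteq> 0" "m \<noteq> 0" "\<And>y z. (k * y + l * z)\<^sup>2 + (m * z)\<^sup>2 = b y z"
    using psd_form_square[OF \<beta>] b by metis
  \<comment> \<open>Entries of the inverse of the triangular substitution (x, z) -> (f x + g z, h
    z); the next triple does the same for (y, z) -> (k y + l z, m z).\<close>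
  define e\<^sub>1 e\<^sub>2 e\<^sub>3 where "e\<^sub>1 = 1 / f" "e\<^sub>2 = - (g / (f * h))" "e\<^sub>3 = 1 / h"
  note e = this
  define d\<^sub>1 d\<^sub>2 d\<^sub>3 where "d\<^sub>1 = 1 / k" "d\<^sub>2 = - (l / (k * m))" "d\<^sub>3 = 1 / m"
  note d = this
  \<comment> \<open>The off-diagonal entry after both inverse substitutions, with z treated as a
    separate variable in each factor.\<close>
  define B :: quat4 where "B = ((2 * e\<^sub>1 * d\<^sub>1) *\<^sub>R q\<^sub>1\<^sub>2, (2 * e\<^sub>1 * d\<^sub>2) *\<^sub>R q\<^sub>1\<^sub>2 + (2 * e\<^sub>1 * d\<^sub>3) *\<^sub>R q\<^sub>1\<^sub>3,
    (2 * e\<^sub>2 * d\<^sub>1) *\<^sub>R q\<^sub>1\<^sub>2 + (2 * e\<^sub>3 * d\<^sub>1) *\<^sub>R q\<^sub>2\<^sub>3,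
    (2 * e\<^sub>2 * d\<^sub>2) *\<^sub>R q\<^sub>1\<^sub>2 + (2 * e\<^sub>2 * d\<^sub>3) *\<^sub>R q\<^sub>1\<^sub>3 + (2 * e\<^sub>3 * d\<^sub>2) *\<^sub>R q\<^sub>2\<^sub>3 + (e\<^sub>3 * d\<^sub>3) *\<^sub>R q\<^sub>3\<^sub>3)"
  let ?q = "\<lambda>x y z w. (2 * x * y) *\<^sub>R q\<^sub>1\<^sub>2 + (2 * x * w) *\<^sub>R q\<^sub>1\<^sub>3 + (2 * y * z) *\<^sub>R q\<^sub>2\<^sub>3 + (z * w) *\<^sub>R q\<^sub>3\<^sub>3"
  have B: "qmap B (p\<^sub>1 * y\<^sub>1, p\<^sub>1 * y\<^sub>2, p\<^sub>2 * y\<^sub>1, p\<^sub>2 * y\<^sub>2)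
      = ?q (e\<^sub>1 * p\<^sub>1 + e\<^sub>2 * p\<^sub>2) (d\<^sub>1 * y\<^sub>1 + d\<^sub>2 * y\<^sub>2) (e\<^sub>3 * p\<^sub>2) (d\<^sub>3 * y\<^sub>2)" for p\<^sub>1 p\<^sub>2 y\<^sub>1 y\<^sub>2
    by (simp add: quat_eq_iff qmap_def B_def algebra_simps)
  have inv1: "f * (e\<^sub>1 * p\<^sub>1 + e\<^sub>2 * p\<^sub>2) + g * (e\<^sub>3 * p\<^sub>2) = p\<^sub>1" "h * (e\<^sub>3 * p\<^sub>2) = p\<^sub>2" for p\<^sub>1 p\<^sub>2
    using f(1,2) by (simp_all add: e field_simps)
  have inv2: "k * (d\<^sub>1 * y\<^sub>1 + d\<^sub>2 * y\<^sub>2) + l * (d\<^sub>3 * y\<^sub>2) = y\<^sub>1" "m * (d\<^sub>3 * y\<^sub>2) = y\<^sub>2" for y\<^sub>1 y\<^sub>2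
    using k(1,2) by (simp_all add: d field_simps)
  have inv3: "e\<^sub>1 * (f * x + g * z) + e\<^sub>2 * (h * z) = x" "e\<^sub>3 * (h * z) = z"
    "d\<^sub>1 * (k * x + l * z) + d\<^sub>2 * (m * z) = x" "d\<^sub>3 * (m * z) = z" for x z
    using f(1,2) k(1,2) by (simp_all add: e d field_simps)
  have contr: "B \<in> contractions"
  proof (rule contractionsI)
    fix X assume "det2 X = 0"
    then obtain p\<^sub>1 p\<^sub>2 y\<^sub>1 y\<^sub>2 where X: "X = (p\<^sub>1 * y\<^sub>1, p\<^sub>1 * y\<^sub>2, p\<^sub>2 * y\<^sub>1, p\<^sub>2 * y\<^sub>2)"
      by (rule det2_zero_rank_one)
    have "(norm (qmap B X))\<^sup>2
        \<le> a (e\<^sub>1 * p\<^sub>1 + e\<^sub>2 * p\<^sub>2) (e\<^sub>3 * p\<^sub>2) * b (d\<^sub>1 * y\<^sub>1 + d\<^sub>2 * y\<^sub>2) (d\<^sub>3 * y\<^sub>2)"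
      unfolding X B by (rule bihomogeneous_bound[OF a b bound])
    also have "\<dots> = (p\<^sub>1\<^sup>2 + p\<^sub>2\<^sup>2) * (y\<^sub>1\<^sup>2 + y\<^sub>2\<^sup>2)"
      unfolding f(3)[symmetric] k(3)[symmetric] inv1 inv2 ..
    also have "\<dots> = (norm X)\<^sup>2"
      by (simp add: X norm_Pair power_mult_distrib algebra_simps)
    finally show "norm (qmap B X) \<le> norm X" by (rule power2_le_imp_le) simp
  qed
  have lin2: "linear (\<lambda>v. r * F v + s * G v)"
    if "linear F" "linear G" for r s and F G :: "'v \<Rightarrow> real"
    using that by (simp add: linear_iff algebra_simps)
  have lin1: "linear (\<lambda>v. s * z v)" for s
    using lin(3) by (simp add: linear_iff algebra_simps)
  show ?thesis
    using sos_contraction[OF lin2[OF lin(1,3), of f g] lin1[of h]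
        lin2[OF lin(2,3), of k l] lin1[of m] contr]
    unfolding B f(3) k(3) inv3 by (simp add: power2_eq_square)
qed


section \<open>Independent null vectors of the two diagonal entries\<close>

lemma bilinear_compose_linear:
  "bilinear B \<Longrightarrow> linear T \<Longrightarrow> bilinear (\<lambda>x y. T (B x y))"
  unfolding bilinear_def by (auto intro: linear_compose[unfolded o_def])

lemma psd_bilinear_null:
  fixes h :: "'a::real_vector \<Rightarrow> 'a \<Rightarrow> real"
  assumes h: "bilinear h" "\<And>x y. h x y = h y x" and pos: "\<And>x. 0 \<le> h x x" and y: "h y y = 0"
  shows "h y x = 0"
proof (rule ccontr)
  assume ne: "h y x \<noteq> 0"
  define s where "s = - (h x x + 1) / (2 * h y x)"
  have "0 \<le> h (x + s *\<^sub>R y) (x + s *\<^sub>R y)" by (rule pos)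
  also have "\<dots> = h x x + 2 * s * h y x"
    using h(2)[of x y] y
    by (simp add: bilinear_ladd[OF h(1)] bilinear_radd[OF h(1)] bilinear_lmul[OF h(1)]
        bilinear_rmul[OF h(1)])
  also have "\<dots> = -1" using ne by (simp add: s_def field_simps)
  finally show False by simp
qed

lemma psd_bilinear_Cauchy_Schwarz_le:
  fixes h :: "'a::real_vector \<Rightarrow> 'a \<Rightarrow> real"
  assumes h: "bilinear h" "\<And>x y. h x y = h y x" and pos: "\<And>x. 0 \<le> h x x"
  shows "(h y x)\<^sup>2 \<le> h y y * h x x"
proof (cases "h y y = 0")
  case True then show ?thesis using psd_bilinear_null[OF h pos True] by simp
next
  case False
  then have "0 < h y y" using pos[of y] by simp
  then show ?thesis by (rule psd_bilinear_Cauchy_Schwarz[OF h pos])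
qed

lemma coordinates3:
  fixes v\<^sub>1 v\<^sub>2 :: "real^3"
  assumes ind: "independent {v\<^sub>1, v\<^sub>2}" "v\<^sub>1 \<noteq> v\<^sub>2"
  obtains x y z v\<^sub>3 where "linear x" "linear y" "linear z"
    "\<And>v. v = x v *\<^sub>R v\<^sub>1 + y v *\<^sub>R v\<^sub>2 + z v *\<^sub>R v\<^sub>3"
proof -
  have "dim {v\<^sub>1, v\<^sub>2} = 2" using ind by (simp add: dim_eq_card_independent)
  then have "dim (span {v\<^sub>1, v\<^sub>2}) \<noteq> dim (UNIV :: (real^3) set)" by simp
  then have "span {v\<^sub>1, v\<^sub>2} \<noteq> UNIV" by metis
  then obtain v\<^sub>3 where v3: "v\<^sub>3 \<notin> span {v\<^sub>1, v\<^sub>2}" by blast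
  then have ne: "v\<^sub>3 \<noteq> v\<^sub>1" "v\<^sub>3 \<noteq> v\<^sub>2" by (auto simp: span_base)
  let ?B = "{v\<^sub>3, v\<^sub>1, v\<^sub>2}"
  have B: "independent ?B" using v3 ind by (simp add: independent_insertI)
  have "card ?B = 3" using ind ne by simp
  then have sp: "span ?B = UNIV"
    using B card_eq_dim[of ?B UNIV] by auto
  have ex: "\<exists>g :: real^3 \<Rightarrow> real. linear g \<and> (\<forall>u\<in>?B. g u = (if u = w then 1 else 0))" for w
    by (rule linear_independent_extend[OF B])
  obtain x where x: "linear x" "\<forall>u\<in>?B. x u = (if u = v\<^sub>1 then 1 else 0 :: real)" using ex by blast
  obtain y where y: "linear y" "\<forall>u\<in>?B. y u = (if u = v\<^sub>2 then 1 else 0 :: real)" using ex by blast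
  obtain z where z: "linear z" "\<forall>u\<in>?B. z u = (if u = v\<^sub>3 then 1 else 0 :: real)" using ex by blast
  show thesis
  proof (rule that[OF x(1) y(1) z(1)])
    fix v
    have "v \<in> span ?B" using sp by simp
    then obtain a b c where v: "v = c *\<^sub>R v\<^sub>3 + (a *\<^sub>R v\<^sub>1 + b *\<^sub>R v\<^sub>2)"
      by (auto simp: span_insert algebra_simps eq_diff_eq)
    have "x v = a" "y v = b" "z v = c"
      using x y z ne ind unfolding v by (auto simp: linear_add linear_scale)
    then show "v = x v *\<^sub>R v\<^sub>1 + y v *\<^sub>R v\<^sub>2 + z v *\<^sub>R v\<^sub>3" using v by (simp add: add_ac)
  qed
qed

text \<open>A null vector of a semidefinite form lies in its radical, which removes y from the first
  diagonal entry and x from the second. Adding e to the square coefficients of these binary forms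
  makes them definite; the added map is e times a fixed one, so the limit takes it back.\<close>

lemma sos_independent_null_vectors:
  fixes Z :: "real^3 \<Rightarrow> herm2"
  assumes Z: "pos_quadmap Z" and ind: "independent {v\<^sub>1, v\<^sub>2}" "v\<^sub>1 \<noteq> v\<^sub>2"
    and null: "fst (Z v\<^sub>2) = 0" "fst (snd (Z v\<^sub>1)) = 0"
  shows "sos Z"
proof -
  obtain B where B: "bilinear B" "\<And>x y. B x y = B y x" and ZB: "Z = (\<lambda>v. B v v)"
    using Z by (auto simp: pos_quadmap_def quadmap_def)
  obtain x y z v\<^sub>3 where lin: "linear x" "linear y" "linear z"
    and coord: "\<And>v. v = x v *\<^sub>R v\<^sub>1 + y v *\<^sub>R v\<^sub>2 + z v *\<^sub>R v\<^sub>3"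
    by (rule coordinates3[OF ind]) (rule that)
  define A b q where "A = (\<lambda>x y. fst (B x y))" "b = (\<lambda>x y. fst (snd (B x y)))"
    "q = (\<lambda>x y. snd (snd (B x y)))"
  note defs = this
  have lin_proj: "linear (\<lambda>p. fst (p :: herm2))" "linear (\<lambda>p. fst (snd (p :: herm2)))"
    "linear (\<lambda>p. snd (snd (p :: herm2)))"
    by (simp_all add: linear_iff)
  have A: "bilinear A" "\<And>x y. A x y = A y x" and b: "bilinear b" "\<And>x y. b x y = b y x"
    and q: "bilinear q" "\<And>x y. q x y = q y x"
    unfolding defs using B(2)
    by (simp_all only: bilinear_compose_linear[OF B(1) lin_proj(1)]
        bilinear_compose_linear[OF B(1) lin_proj(2)] bilinear_compose_linear[OF B(1) lin_proj(3)])
  have ZA: "Z v = (A v v, b v v, q v v)" for v by (simp add: defs ZB)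
  have psd: "0 \<le> A v v" "0 \<le> b v v" "(norm (q v v))\<^sup>2 \<le> A v v * b v v" for v
    using Z[unfolded pos_quadmap_def psd2_def, THEN conjunct2, rule_format, of v] by (simp_all add: ZA)
  have A0: "A v\<^sub>2 u = 0" "A u v\<^sub>2 = 0" for u
    using psd_bilinear_null[OF A psd(1), of v\<^sub>2 u] null(1) A(2)[of u "v\<^sub>2"] by (simp_all add: ZA)
  have b0: "b v\<^sub>1 u = 0" "b u v\<^sub>1 = 0" for u
    using psd_bilinear_null[OF b psd(2), of v\<^sub>1 u] null(2) b(2)[of u "v\<^sub>1"] by (simp_all add: ZA)
  have q0: "q v\<^sub>1 v\<^sub>1 = 0" "q v\<^sub>2 v\<^sub>2 = 0" using psd(3)[of v\<^sub>1] psd(3)[of v\<^sub>2] by (simp_all add: A0 b0)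
  have expand: "A v v = A v\<^sub>1 v\<^sub>1 * x\<^sup>2 + 2 * A v\<^sub>1 v\<^sub>3 * x * z + A v\<^sub>3 v\<^sub>3 * z\<^sup>2"
    "b v v = b v\<^sub>2 v\<^sub>2 * y\<^sup>2 + 2 * b v\<^sub>2 v\<^sub>3 * y * z + b v\<^sub>3 v\<^sub>3 * z\<^sup>2"
    "q v v = (2 * x * y) *\<^sub>R q v\<^sub>1 v\<^sub>2 + (2 * x * z) *\<^sub>R q v\<^sub>1 v\<^sub>3 + (2 * y * z) *\<^sub>R q v\<^sub>2 v\<^sub>3 + z\<^sup>2 *\<^sub>R q v\<^sub>3 v\<^sub>3"
    if "v = x *\<^sub>R v\<^sub>1 + y *\<^sub>R v\<^sub>2 + z *\<^sub>R v\<^sub>3" for v and x y z :: real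
  proof -
    note bl = bilinear_ladd bilinear_radd bilinear_lmul bilinear_rmul
    show "A v v = A v\<^sub>1 v\<^sub>1 * x\<^sup>2 + 2 * A v\<^sub>1 v\<^sub>3 * x * z + A v\<^sub>3 v\<^sub>3 * z\<^sup>2"
      using A(2)[of "v\<^sub>3" "v\<^sub>1"]
      by (simp add: that bl[OF A(1)] A0 power2_eq_square algebra_simps)
    show "b v v = b v\<^sub>2 v\<^sub>2 * y\<^sup>2 + 2 * b v\<^sub>2 v\<^sub>3 * y * z + b v\<^sub>3 v\<^sub>3 * z\<^sup>2"
      using b(2)[of "v\<^sub>3" "v\<^sub>2"]
      by (simp add: that bl[OF b(1)] b0 power2_eq_square algebra_simps)
    show "q v v = (2 * x * y) *\<^sub>R q v\<^sub>1 v\<^sub>2 + (2 * x * z) *\<^sub>R q v\<^sub>1 v\<^sub>3 + (2 * y * z) *\<^sub>R q v\<^sub>2 v\<^sub>3 + z\<^sup>2 *\<^sub>R q v\<^sub>3 v\<^sub>3"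
      by (simp add: that bl[OF q(1)] q0 power2_eq_square scaleR_right_distrib
          q(2)[of "v\<^sub>2" "v\<^sub>1"] q(2)[of "v\<^sub>3" "v\<^sub>1"] q(2)[of "v\<^sub>3" "v\<^sub>2"])
        (simp add: quat_eq_iff algebra_simps)
  qed
  show ?thesis
  proof (rule sos_limit)
    fix e :: real assume e: "0 < e"
    define a' b' where "a' = (\<lambda>x z. (A v\<^sub>1 v\<^sub>1 + e) * x\<^sup>2 + 2 * A v\<^sub>1 v\<^sub>3 * x * z + (A v\<^sub>3 v\<^sub>3 + e) * z\<^sup>2)"
      "b' = (\<lambda>y z. (b v\<^sub>2 v\<^sub>2 + e) * y\<^sup>2 + 2 * b v\<^sub>2 v\<^sub>3 * y * z + (b v\<^sub>3 v\<^sub>3 + e) * z\<^sup>2)"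
    have strict: "m\<^sup>2 < (k + e) * (l + e)" if "m\<^sup>2 \<le> k * l" "0 \<le> k" "0 \<le> l" for k l m :: real
    proof -
      have "0 < e * e" "0 \<le> k * e" "0 \<le> e * l" using e that by simp_all
      then show ?thesis using that(1) unfolding distrib_left distrib_right by linarith
    qed
    have "sos (\<lambda>v. (a' (x v) (z v), b' (y v) (z v),
      (2 * x v * y v) *\<^sub>R q v\<^sub>1 v\<^sub>2 + (2 * x v * z v) *\<^sub>R q v\<^sub>1 v\<^sub>3 + (2 * y v * z v) *\<^sub>R q v\<^sub>2 v\<^sub>3
        + (z v)\<^sup>2 *\<^sub>R q v\<^sub>3 v\<^sub>3))"
    proof (rule sos_two_null_vectors_strict[OF lin _ _ _ _ a'_b'_def(1) a'_b'_def(2)])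
      show "0 < A v\<^sub>1 v\<^sub>1 + e" "0 < b v\<^sub>2 v\<^sub>2 + e" using psd(1)[of "v\<^sub>1"] psd(2)[of "v\<^sub>2"] e by linarith+
      show "(A v\<^sub>1 v\<^sub>3)\<^sup>2 < (A v\<^sub>1 v\<^sub>1 + e) * (A v\<^sub>3 v\<^sub>3 + e)"
        by (intro strict psd psd_bilinear_Cauchy_Schwarz_le[OF A])
      show "(b v\<^sub>2 v\<^sub>3)\<^sup>2 < (b v\<^sub>2 v\<^sub>2 + e) * (b v\<^sub>3 v\<^sub>3 + e)"
        by (intro strict psd psd_bilinear_Cauchy_Schwarz_le[OF b])
      fix x y z :: real
      define v where "v = x *\<^sub>R v\<^sub>1 + y *\<^sub>R v\<^sub>2 + z *\<^sub>R v\<^sub>3"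
      have nn: "0 \<le> e * x\<^sup>2" "0 \<le> e * y\<^sup>2" "0 \<le> e * z\<^sup>2" using e by simp_all
      have "A v v \<le> a' x z" "b v v \<le> b' y z"
        using nn unfolding expand[OF v_def] a'_b'_def distrib_right by linarith+
      then have "A v v * b v v \<le> a' x z * b' y z"
        using psd[of v] by (intro mult_mono) auto
      with psd(3)[of v] show "(norm ((2 * x * y) *\<^sub>R q v\<^sub>1 v\<^sub>2 + (2 * x * z) *\<^sub>R q v\<^sub>1 v\<^sub>3
          + (2 * y * z) *\<^sub>R q v\<^sub>2 v\<^sub>3 + z\<^sup>2 *\<^sub>R q v\<^sub>3 v\<^sub>3))\<^sup>2 \<le> a' x z * b' y z"
        unfolding expand(3)[OF v_def] by linarith
    qed
    also have "(\<lambda>v. (a' (x v) (z v), b' (y v) (z v),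
      (2 * x v * y v) *\<^sub>R q v\<^sub>1 v\<^sub>2 + (2 * x v * z v) *\<^sub>R q v\<^sub>1 v\<^sub>3 + (2 * y v * z v) *\<^sub>R q v\<^sub>2 v\<^sub>3
        + (z v)\<^sup>2 *\<^sub>R q v\<^sub>3 v\<^sub>3)) = (\<lambda>v. Z v + e *\<^sub>R ((x v)\<^sup>2 + (z v)\<^sup>2, (y v)\<^sup>2 + (z v)\<^sup>2, 0))"
    proof
      fix v
      show "(a' (x v) (z v), b' (y v) (z v),
          (2 * x v * y v) *\<^sub>R q v\<^sub>1 v\<^sub>2 + (2 * x v * z v) *\<^sub>R q v\<^sub>1 v\<^sub>3 + (2 * y v * z v) *\<^sub>R q v\<^sub>2 v\<^sub>3
            + (z v)\<^sup>2 *\<^sub>R q v\<^sub>3 v\<^sub>3) = Z v + e *\<^sub>R ((x v)\<^sup>2 + (z v)\<^sup>2, (y v)\<^sup>2 + (z v)\<^sup>2, 0)"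
        unfolding ZA[of v] expand[OF coord[of v]] a'_b'_def by (simp add: algebra_simps)
    qed
    finally show "sos (\<lambda>v. Z v + e *\<^sub>R ((x v)\<^sup>2 + (z v)\<^sup>2, (y v)\<^sup>2 + (z v)\<^sup>2, 0))" .
  qed
qed


text \<open>In these coordinates \<^const>\<open>psd2\<close> is the Lorentz cone \<open>|X| \<le> T\<close>.\<close>

definition lor_t :: "herm2 \<Rightarrow> real"
  where "lor_t = (\<lambda>(a, b, q). (a + b) / 2)"

definition lor_x :: "herm2 \<Rightarrow> real \<times> quat"
  where "lor_x = (\<lambda>(a, b, q). ((a - b) / 2, q))"

definition of_lor :: "real \<Rightarrow> real \<times> quat \<Rightarrow> herm2"
  where "of_lor t x = (t + fst x, t - fst x, snd x)"

lemma linear_lor: "linear lor_t" "linear lor_x"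
  by (auto simp: linear_iff lor_t_def lor_x_def field_simps)

lemma lor_of_lor [simp]: "lor_t (of_lor t x) = t" "lor_x (of_lor t x) = x"
  by (simp_all add: lor_t_def lor_x_def of_lor_def)

lemma psd2_diag: "z \<in> psd2 \<Longrightarrow> 0 \<le> fst z" "z \<in> psd2 \<Longrightarrow> 0 \<le> fst (snd z)"
  by (auto simp: psd2_def)

lemma psd2_iff_lor: "z \<in> psd2 \<longleftrightarrow> norm (lor_x z) \<le> lor_t z"
proof -
  obtain a b q where z: "z = (a, b, q)" by (metis prod_cases3)
  have n: "(norm (lor_x z))\<^sup>2 = ((a - b) / 2)\<^sup>2 + (norm q)\<^sup>2"
    by (simp add: z lor_x_def norm_Pair power_divide)
  have *: "(norm (lor_x z))\<^sup>2 \<le> ((a + b) / 2)\<^sup>2 \<longleftrightarrow> (norm q)\<^sup>2 \<le> a * b"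
    unfolding n by (simp add: power2_eq_square field_simps)
  show ?thesis
  proof
    assume "z \<in> psd2"
    then have "0 \<le> a" "0 \<le> b" "(norm q)\<^sup>2 \<le> a * b" by (simp_all add: z psd2_def)
    then have "(norm (lor_x z))\<^sup>2 \<le> (lor_t z)\<^sup>2" "0 \<le> lor_t z"
      using * by (simp_all add: z lor_t_def)
    then show "norm (lor_x z) \<le> lor_t z" by (rule power2_le_imp_le)
  next
    assume le: "norm (lor_x z) \<le> lor_t z"
    have "0 \<le> lor_t z" using le norm_ge_zero[of "lor_x z"] by linarith
    moreover have "\<bar>(a - b) / 2\<bar> \<le> norm (lor_x z)"
      using norm_fst_le[of "(a - b) / 2" q] by (simp add: z lor_x_def)
    ultimately have "0 \<le> a" "0 \<le> b" using le by (auto simp: z lor_t_def)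
    moreover have "(norm (lor_x z))\<^sup>2 \<le> (lor_t z)\<^sup>2" using le by (intro power_mono) auto
    ultimately show "z \<in> psd2" using * by (simp add: z psd2_def lor_t_def)
  qed
qed

text \<open>
  The extreme rays of the dual cone are parametrised by the projective line \<open>\<H> \<union> {\<infinity>}\<close>; the
  shear moves the point \<open>l\<close> to \<open>0\<close>.
\<close>

lemma contact_cases:
  assumes u: "norm u = 1" and z: "lor_t z = lor_x z \<bullet> u"
  shows "u = (1, 0) \<and> fst (snd z) = 0 \<or>
    fst u \<noteq> 1 \<and> fst (shear (- (snd u /\<^sub>R (1 - fst u))) z) = 0"
proof -
  obtain a b q where Z: "z = (a, b, q)" by (metis prod_cases3)
  obtain r p where U: "u = (r, p)" by force
  have "(norm u)\<^sup>2 = 1" using u by simp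
  then have rp: "r\<^sup>2 + (norm p)\<^sup>2 = 1" by (simp add: U norm_Pair)
  have eq: "(1 - r) * a + (1 + r) * b = 2 * (q \<bullet> p)"
    using z by (simp add: Z U lor_t_def lor_x_def field_simps)
  show ?thesis
  proof (cases "r = 1")
    case True then show ?thesis using rp eq by (simp add: U Z)
  next
    case False
    define s where "s = 1 - r"
    have s: "s \<noteq> 0" "r = 1 - s" using False by (simp_all add: s_def)
    have "(norm p)\<^sup>2 = s * (1 + r)" using rp by (simp add: s_def power2_eq_square algebra_simps)
    then have "fst (shear (- (p /\<^sub>R s)) z) = a - 2 * (p \<bullet> q) / s + (1 + r) * b / s"
      using s(1) by (simp add: Z shear_def power_mult_distrib power_divide divide_simps power2_eq_square)
    also have "\<dots> = (s * a + (1 + r) * b - 2 * (q \<bullet> p)) / s"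
      using s(1) by (simp add: divide_simps inner_commute)
    also have "\<dots> = 0" using eq by (simp add: s_def)
    finally show ?thesis using False by (simp add: U s_def)
  qed
qed

text \<open>The projected point has squared norm (1 + r) / (1 - r), which determines the first
  coordinate r of u and then the rest. So different contact directions give different points of the
  projective line.\<close>

lemma stereographic_inj:
  assumes "norm u = 1" "norm u' = 1" "fst u \<noteq> 1" "fst u' \<noteq> 1"
    and eq: "snd u /\<^sub>R (1 - fst u) = snd u' /\<^sub>R (1 - fst u')"
  shows "u = (u' :: real \<times> quat)"
proof -
  have *: "(norm (snd u /\<^sub>R (1 - fst u)))\<^sup>2 = (1 + fst u) / (1 - fst u)"
    if "norm u = 1" "fst u \<noteq> 1" for u :: "real \<times> quat"
  proof -
    obtain r p where U: "u = (r, p)" by force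
    have "(norm u)\<^sup>2 = 1" using that by simp
    then have "(norm p)\<^sup>2 = (1 - r) * (1 + r)"
      by (simp add: U norm_Pair power2_eq_square algebra_simps)
    then show ?thesis
      using that by (simp add: U power_mult_distrib power_divide divide_simps power2_eq_square)
  qed
  have "(1 + fst u) / (1 - fst u) = (1 + fst u') / (1 - fst u')"
    using *[of u] *[of u'] assms by metis
  then have f: "fst u = fst u'" using assms by (simp add: divide_simps algebra_simps)
  then have "snd u = snd u'" using eq assms by simp
  with f show ?thesis by (simp add: prod_eq_iff)
qed

text \<open>Each functional that is nonnegative on the cone turns \<open>B\<close> into a
  semidefinite real form with v in its radical. The corner entries of all shears, together with the
  second diagonal entry, separate points.\<close>

lemma pos_quadmap_null_polar:
  assumes Z: "pos_quadmap Z" and B: "bilinear B" "\<And>x y. B x y = B y x" and ZB: "Z = (\<lambda>v. B v v)"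
    and null: "Z v = 0"
  shows "B v w = 0"
proof -
  have sh: "fst (shear l (B v w)) = 0" for l
  proof (rule psd_bilinear_null[of "\<lambda>x y. fst (shear l (B x y))"])
    have "linear (\<lambda>p. fst (shear l p))"
      using linear_compose[OF linear_shear linear_fst] by (simp add: o_def)
    then show "bilinear (\<lambda>x y. fst (shear l (B x y)))" by (rule bilinear_compose_linear[OF B(1)])
    show "0 \<le> fst (shear l (B x x))" for x
      using psd2_diag(1)[OF psd2_shear[of "Z x" l]] Z by (simp add: ZB pos_quadmap_def)
    show "fst (shear l (B v v)) = 0"
      using null linear_0[OF linear_shear, of l] by (simp add: ZB)
  qed (simp add: B(2)[of x y for x y])
  have fl: "fst (snd (B v w)) = 0"
  proof (rule psd_bilinear_null[of "\<lambda>x y. fst (snd (B x y))"])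
    show "bilinear (\<lambda>x y. fst (snd (B x y)))"
      by (rule bilinear_compose_linear[OF B(1)]) (simp add: linear_iff)
    show "0 \<le> fst (snd (B x x))" for x
      using psd2_diag(2)[of "Z x"] Z by (simp add: ZB pos_quadmap_def)
    show "fst (snd (B v v)) = 0" using null by (simp add: ZB)
  qed (simp add: B(2)[of x y for x y])
  obtain a b q where ab: "B v w = (a, b, q)" by (metis prod_cases3)
  have "a + 2 * (l \<bullet> q) + (norm l)\<^sup>2 * b = 0" for l using sh[of l] by (simp add: ab shear_def)
  from this[of 0] this[of q] have "a = 0" "q \<bullet> q = 0" using fl by (simp_all add: ab)
  then show ?thesis using fl by (simp add: ab zero_prod_def)
qed

lemma pos_quadmap_diff_norm2:
  fixes P :: "'v::real_vector \<Rightarrow> 'w::real_inner"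
  assumes "pos_quadmap Z" "linear P" "\<And>v. Z v - (norm (P v))\<^sup>2 *\<^sub>R z \<in> psd2"
  shows "pos_quadmap (\<lambda>v. Z v - (norm (P v))\<^sup>2 *\<^sub>R z)"
  using quadmap_add[OF _ quadmap_scaleR[OF quadmap_norm2[OF assms(2)], of "-1" z], of Z] assms
  by (simp add: pos_quadmap_def)

lemma independent_orthogonal_pair:
  fixes v w :: "'a::euclidean_space"
  assumes "v \<noteq> 0" "w \<noteq> 0" "v \<bullet> w = 0"
  shows "independent {v, w}" "v \<noteq> w"
proof -
  show "v \<noteq> w" using assms by auto
  have "pairwise orthogonal {v, w}"
    using assms by (simp add: pairwise_def orthogonal_def inner_commute)
  then show "independent {v, w}" using assms by (intro pairwise_orthogonal_independent) auto
qed

text \<open>\<open>Z\<close> depends only on the projection orthogonal to \<open>v\<^sub>1\<close>,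
  and every shear of it vanishes at \<open>v\<^sub>1\<close>. One contact on the orthogonal plane is
  therefore enough; it is forced by subtracting as much of the identity there as positivity
  allows.\<close>

lemma sos_null_vector:
  fixes Z :: "real^3 \<Rightarrow> herm2"
  assumes Z: "pos_quadmap Z" and v1: "Z v\<^sub>1 = 0" "v\<^sub>1 \<noteq> 0"
  shows "sos Z"
proof -
  obtain B where B: "bilinear B" "\<And>x y. B x y = B y x" and ZB: "Z = (\<lambda>v. B v v)"
    using Z by (auto simp: pos_quadmap_def quadmap_def)
  have quad: "quadmap Z" and psd: "Z v \<in> psd2" for v using Z by (simp_all add: pos_quadmap_def)
  define P where "P = (\<lambda>v. v - ((v \<bullet> v\<^sub>1) / (v\<^sub>1 \<bullet> v\<^sub>1)) *\<^sub>R v\<^sub>1)"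
  have P: "linear P" by (simp add: P_def linear_iff inner_add_left algebra_simps add_divide_distrib)
  have P1: "P v \<bullet> v\<^sub>1 = 0" for v using v1 by (simp add: P_def inner_diff_left)
  have Pv1: "P v\<^sub>1 = 0" using v1 by (simp add: P_def)
  have ZP: "Z (P v) = Z v" for v
    using pos_quadmap_null_polar[OF Z B ZB v1(1)] B(2)[of _ "v\<^sub>1"]
    by (simp add: ZB P_def bilinear_lsub[OF B(1)] bilinear_rsub[OF B(1)] bilinear_lmul[OF B(1)]
        bilinear_rmul[OF B(1)])
  define S where "S = sphere 0 1 \<inter> {v. v \<bullet> v\<^sub>1 = 0}"
  have "compact S" unfolding S_def
    by (intro compact_Int_closed compact_sphere closed_Collect_eq continuous_intros)
  have "S \<noteq> {}"
  proof -
    obtain w :: "real^3" where w: "w \<noteq> 0" "orthogonal v\<^sub>1 w"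
      using orthogonal_to_vector_exists[of v\<^sub>1] by auto
    then have "w /\<^sub>R norm w \<in> S" by (simp add: S_def orthogonal_def inner_commute)
    then show ?thesis by blast
  qed
  have contZ: "continuous_on S (\<lambda>v. lor_t (Z v))" "continuous_on S (\<lambda>v. lor_x (Z v))"
    using quadmap_linear[OF quad] linear_lor by (intro quadmap_continuous; blast)+
  then have "continuous_on S (\<lambda>v. lor_t (Z v) - norm (lor_x (Z v)))"
    by (intro continuous_intros)
  then obtain v\<^sub>0 where v0: "v\<^sub>0 \<in> S"
    and min: "\<And>v. v \<in> S \<Longrightarrow> lor_t (Z v\<^sub>0) - norm (lor_x (Z v\<^sub>0)) \<le> lor_t (Z v) - norm (lor_x (Z v))"
    using continuous_attains_inf[OF \<open>compact S\<close> \<open>S \<noteq> {}\<close>] by blast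
  \<comment> \<open>\<open>lor_t - norm lor_x\<close> is the smaller eigenvalue, so m is the least
    eigenvalue over the unit circle \<open>S\<close>, and \<open>I\<close> is m times the identity
    matrix.\<close>
  define m where "m = lor_t (Z v\<^sub>0) - norm (lor_x (Z v\<^sub>0))"
  have m: "0 \<le> m" using psd[of v\<^sub>0] by (simp add: m_def psd2_iff_lor)
  define I where "I = of_lor m 0"
  have I: "I \<in> psd2" using m by (simp add: psd2_iff_lor I_def)
  define Y where "Y = (\<lambda>v. Z v - (norm (P v))\<^sup>2 *\<^sub>R I)"
  have lorY: "lor_t (Z v - r *\<^sub>R I) = lor_t (Z v) - r * m" "lor_x (Z v - r *\<^sub>R I) = lor_x (Z v)" for v r
    by (simp_all add: linear_diff[OF linear_lor(1)] linear_diff[OF linear_lor(2)]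
        linear_scale[OF linear_lor(1)] linear_scale[OF linear_lor(2)] I_def)
  have "Z v - (norm (P v))\<^sup>2 *\<^sub>R I \<in> psd2" for v
  proof (cases "P v = 0")
    case True then show ?thesis using psd[of v] by simp
  next
    case False
    define w where "w = P v /\<^sub>R norm (P v)"
    have w: "w \<in> S" using False P1 by (simp add: S_def w_def)
    have Pw: "P v = norm (P v) *\<^sub>R w" using False by (simp add: w_def)
    have "Z v = (norm (P v))\<^sup>2 *\<^sub>R Z w"
      by (metis ZP Pw quadmap_homogeneous[OF quad])
    then have "Z v - (norm (P v))\<^sup>2 *\<^sub>R I = (norm (P v))\<^sup>2 *\<^sub>R (Z w - I)"
      by (simp add: scaleR_diff_right)
    moreover have "Z w - I \<in> psd2"
      using min[OF w] lorY[of w 1] by (simp add: psd2_iff_lor m_def)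
    ultimately show ?thesis by (simp add: psd2_scaleR)
  qed
  then have Y: "pos_quadmap Y" unfolding Y_def by (intro pos_quadmap_diff_norm2 Z P)
  have Yv1: "Y v\<^sub>1 = 0" by (simp add: Y_def v1 Pv1)
  have v0': "v\<^sub>0 \<noteq> 0" "v\<^sub>0 \<bullet> v\<^sub>1 = 0" "norm v\<^sub>0 = 1" using v0 by (auto simp: S_def)
  have "P v\<^sub>0 = v\<^sub>0" using v0' by (simp add: P_def)
  then have Yv0: "lor_t (Y v\<^sub>0) = norm (lor_x (Y v\<^sub>0))"
    using v0' lorY[of _ 1] by (simp add: Y_def m_def)
  obtain u where u: "norm u = 1" "lor_t (Y v\<^sub>0) = lor_x (Y v\<^sub>0) \<bullet> u"
  proof (cases "lor_x (Y v\<^sub>0) = 0")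
    case True
    then show ?thesis using Yv0 by (intro that[of "(1, 0)"]) simp_all
  next
    case False
    then show ?thesis using Yv0
      by (intro that[of "lor_x (Y v\<^sub>0) /\<^sub>R norm (lor_x (Y v\<^sub>0))"])
        (simp_all add: dot_square_norm power2_eq_square)
  qed
  note ind = independent_orthogonal_pair[OF v0'(1) v1(2) v0'(2)]
    independent_orthogonal_pair[OF v1(2) v0'(1)]
  have "sos Y"
    using contact_cases[OF u]
  proof (elim disjE conjE)
    assume "fst (snd (Y v\<^sub>0)) = 0"
    then show ?thesis
      using sos_independent_null_vectors[OF Y ind(1,2)] Yv1 by simp
  next
    let ?l = "- (snd u /\<^sub>R (1 - fst u))"
    assume "fst (shear ?l (Y v\<^sub>0)) = 0"
    then have "sos (\<lambda>v. shear ?l (Y v))"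
      using sos_independent_null_vectors[OF pos_quadmap_shear[OF Y] ind(3,4), of ?l] v0'(2)
        linear_0[OF linear_shear, of ?l]
      by (simp add: Yv1 inner_commute)
    then show ?thesis by (rule sos_shear)
  qed
  then show ?thesis
    using sos_add[OF _ sos_norm2[OF P I], of Y] by (simp add: Y_def)
qed

text \<open>For parallel vectors both diagonal entries vanish at \<open>v\<^sub>1\<close>, so
  \<open>Z v\<^sub>1 = 0\<close> and the case of a common null vector applies.\<close>

lemma sos_contact_zero_infinity:
  fixes Z :: "real^3 \<Rightarrow> herm2"
  assumes Z: "pos_quadmap Z" and v: "v\<^sub>1 \<noteq> 0" "v\<^sub>2 \<noteq> 0"
    and null: "fst (snd (Z v\<^sub>1)) = 0" "fst (Z v\<^sub>2) = 0"
  shows "sos Z"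
proof (cases "independent {v\<^sub>1, v\<^sub>2} \<and> v\<^sub>1 \<noteq> v\<^sub>2")
  case True
  then show ?thesis using sos_independent_null_vectors[OF Z] null by blast
next
  case False
  have "\<exists>c. v\<^sub>2 = c *\<^sub>R v\<^sub>1"
  proof (cases "v\<^sub>1 = v\<^sub>2")
    case True then show ?thesis by (intro exI[of _ 1]) simp
  next
    case ne: False
    then have "v\<^sub>2 \<in> span {v\<^sub>1}"
      using False v independent_insertI[of v\<^sub>2 "{v\<^sub>1}"] by (auto simp: insert_commute)
    then show ?thesis by (auto simp: span_singleton)
  qed
  then obtain c where c: "v\<^sub>2 = c *\<^sub>R v\<^sub>1" by blast
  then have "c \<noteq> 0" using v by auto
  have "Z v\<^sub>2 = c\<^sup>2 *\<^sub>R Z v\<^sub>1"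
    using quadmap_homogeneous[of Z c v\<^sub>1] Z by (simp add: pos_quadmap_def c)
  then have "fst (Z v\<^sub>1) = 0" using null(2) \<open>c \<noteq> 0\<close> by simp
  moreover have "Z v\<^sub>1 \<in> psd2" using Z by (simp add: pos_quadmap_def)
  ultimately have "Z v\<^sub>1 = 0"
    using null(1) by (cases "Z v\<^sub>1") (auto simp: psd2_def zero_prod_def)
  then show ?thesis using sos_null_vector[OF Z] v by blast
qed

text \<open>A shear leaves the second diagonal entry alone: it fixes the point at infinity while
  moving the finite contact to 0.\<close>

lemma sos_contact_infinity:
  fixes Z :: "real^3 \<Rightarrow> herm2"
  assumes Z: "pos_quadmap Z" and v: "v\<^sub>1 \<noteq> 0" "v\<^sub>2 \<noteq> 0"
    and null: "fst (snd (Z v\<^sub>1)) = 0" "fst (shear l (Z v\<^sub>2)) = 0"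
  shows "sos Z"
proof -
  have "fst (snd (shear l (Z v\<^sub>1))) = 0"
    using null(1) by (simp add: shear_def case_prod_beta)
  then show ?thesis
    using sos_contact_zero_infinity[OF pos_quadmap_shear[OF Z] v _ null(2)] sos_shear by blast
qed

text \<open>The shear by \<open>- l\<^sub>1\<close> moves \<open>l\<^sub>1\<close> to 0, and the
  flip acts on the projective line as inversion, taking 0 to infinity and
  \<open>m = l\<^sub>2 - l\<^sub>1\<close> to its inverse.\<close>

lemma sos_contact_finite:
  fixes Z :: "real^3 \<Rightarrow> herm2"
  assumes Z: "pos_quadmap Z" and v: "v\<^sub>1 \<noteq> 0" "v\<^sub>2 \<noteq> 0" and l: "l\<^sub>1 \<noteq> l\<^sub>2"
    and null: "fst (shear (- l\<^sub>1) (Z v\<^sub>1)) = 0" "fst (shear (- l\<^sub>2) (Z v\<^sub>2)) = 0"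
  shows "sos Z"
proof -
  define m where "m = l\<^sub>2 - l\<^sub>1"
  define Y where "Y = (\<lambda>v. flip (shear (- l\<^sub>1) (Z v)))"
  have m: "m \<noteq> 0" using l by (simp add: m_def)
  have n: "(norm (l\<^sub>1 + m))\<^sup>2 = (norm l\<^sub>1)\<^sup>2 + 2 * (l\<^sub>1 \<bullet> m) + (norm m)\<^sup>2"
    unfolding power2_norm_eq_inner by (simp add: inner_add_left inner_add_right inner_commute)
  have "fst (snd (Y v\<^sub>1)) = 0" using null(1) by (simp add: Y_def flip_def case_prod_beta)
  \<comment> \<open>The conjugate of m divided by its squared norm is the quaternion inverse of
    m.\<close>
  moreover have "fst (shear (- (qcnj m /\<^sub>R (norm m)\<^sup>2)) (Y v\<^sub>2)) = 0"
  proof -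
    obtain a b q where z: "Z v\<^sub>2 = (a, b, q)" by (metis prod_cases3)
    have l2: "l\<^sub>2 = l\<^sub>1 + m" by (simp add: m_def)
    have a: "a - 2 * ((l\<^sub>1 + m) \<bullet> q) + (norm (l\<^sub>1 + m))\<^sup>2 * b = 0"
      using null(2) unfolding z l2 shear_def by (simp del: minus_add_distrib)
    have "(norm (qcnj m /\<^sub>R (norm m)\<^sup>2))\<^sup>2 = 1 / (norm m)\<^sup>2"
      using m by (simp add: power_mult_distrib power_divide field_simps power2_eq_square)
    moreover have "qcnj m \<bullet> qcnj (q - b *\<^sub>R l\<^sub>1) = m \<bullet> q - b * (l\<^sub>1 \<bullet> m)"
      by (simp add: inner_diff_right inner_commute)
    ultimately have "fst (shear (- (qcnj m /\<^sub>R (norm m)\<^sup>2)) (Y v\<^sub>2))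
        = b - 2 * (m \<bullet> q - b * (l\<^sub>1 \<bullet> m)) / (norm m)\<^sup>2 + (a - 2 * (l\<^sub>1 \<bullet> q) + (norm l\<^sub>1)\<^sup>2 * b) / (norm m)\<^sup>2"
      by (simp add: Y_def z shear_def flip_def divide_inverse mult.commute)
    also have "\<dots> = (a - 2 * ((l\<^sub>1 + m) \<bullet> q) + (norm (l\<^sub>1 + m))\<^sup>2 * b) / (norm m)\<^sup>2"
      using m unfolding n inner_add_left by (simp add: field_simps)
    finally show ?thesis using a by simp
  qed
  ultimately have "sos Y"
    unfolding Y_def by (intro sos_contact_infinity[OF _ v]) (simp_all add: pos_quadmap_flip pos_quadmap_shear Z)
  then show ?thesis unfolding Y_def by (rule sos_shear[OF sos_flip])
qed

theorem pos_quadmap_sos: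
  fixes Z :: "real^3 \<Rightarrow> herm2"
  assumes Z: "pos_quadmap Z"
  shows "sos Z"
proof (rule sos_limit)
  fix e :: real assume e: "0 < e"
  \<comment> \<open>\<open>of_lor 1 0\<close> is the identity matrix; on the unit sphere it provides
    the gap e to the boundary of the cone.\<close>
  define W where "W = (\<lambda>v :: real^3. Z v + e *\<^sub>R ((norm v)\<^sup>2 *\<^sub>R of_lor 1 0))"
  have quadW: "quadmap W"
    unfolding W_def using Z
    by (intro quadmap_add quadmap_scaleR quadmap_norm2[OF linear_ident]) (simp add: pos_quadmap_def)
  have lorW: "lor_t (W v) = lor_t (Z v) + e * (norm v)\<^sup>2" "lor_x (W v) = lor_x (Z v)" for v
    by (simp_all add: W_def linear_add[OF linear_lor(1)] linear_add[OF linear_lor(2)]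
        linear_scale[OF linear_lor(1)] linear_scale[OF linear_lor(2)])
  have W: "pos_quadmap W"
    unfolding pos_quadmap_def
  proof (intro conjI allI quadW)
    fix v
    have "norm (lor_x (Z v)) \<le> lor_t (Z v)" using Z by (simp add: pos_quadmap_def psd2_iff_lor)
    moreover have "0 \<le> e * (norm v)\<^sup>2" using e by simp
    ultimately show "W v \<in> psd2" unfolding psd2_iff_lor lorW by linarith
  qed
  have contW: "continuous_on (sphere 0 1) (\<lambda>v. lor_t (W v))" "continuous_on (sphere 0 1) (\<lambda>v. lor_x (W v))"
    using quadmap_linear[OF quadW] linear_lor by (intro quadmap_continuous; blast)+
  have below: "norm (lor_x (W v)) + e \<le> lor_t (W v)" if "v \<in> sphere 0 1" for v
    using Z that by (simp add: lorW pos_quadmap_def psd2_iff_lor)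
  have ne: "sphere 0 1 \<noteq> ({} :: (real^3) set)" by simp
  obtain n\<^sub>0 n v\<^sub>1 v\<^sub>2 u\<^sub>1 u\<^sub>2 where n: "norm n \<le> n\<^sub>0"
      "\<And>v. v \<in> sphere 0 1 \<Longrightarrow> norm (lor_x (W v) - n) \<le> lor_t (W v) - n\<^sub>0"
    and v: "v\<^sub>1 \<in> sphere 0 1" "v\<^sub>2 \<in> sphere 0 1" and u: "norm u\<^sub>1 = 1" "norm u\<^sub>2 = 1" "u\<^sub>1 \<noteq> u\<^sub>2"
    and c: "lor_t (W v\<^sub>1) - n\<^sub>0 = (lor_x (W v\<^sub>1) - n) \<bullet> u\<^sub>1" "lor_t (W v\<^sub>2) - n\<^sub>0 = (lor_x (W v\<^sub>2) - n) \<bullet> u\<^sub>2"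
    by (rule lorentz_two_contacts[OF compact_sphere ne contW e below], assumption) (rule that)
  define N where "N = of_lor n\<^sub>0 n"
  have N: "N \<in> psd2" using n(1) by (simp add: psd2_iff_lor N_def)
  define Y where "Y = (\<lambda>v. W v - (norm v)\<^sup>2 *\<^sub>R N)"
  have lorY: "lor_t (W v - r *\<^sub>R N) = lor_t (W v) - r * n\<^sub>0" "lor_x (W v - r *\<^sub>R N) = lor_x (W v) - r *\<^sub>R n" for v r
    by (simp_all add: linear_diff[OF linear_lor(1)] linear_diff[OF linear_lor(2)]
        linear_scale[OF linear_lor(1)] linear_scale[OF linear_lor(2)] N_def)
  have "W v - (norm v)\<^sup>2 *\<^sub>R N \<in> psd2" for v
  proof (cases "v = 0")
    case True then show ?thesis using W by (simp add: pos_quadmap_def)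
  next
    case False
    define w where "w = v /\<^sub>R norm v"
    have w: "w \<in> sphere 0 1" and vw: "v = norm v *\<^sub>R w" using False by (simp_all add: w_def)
    have "W v = (norm v)\<^sup>2 *\<^sub>R W w" by (metis vw quadmap_homogeneous[OF quadW])
    then have "W v - (norm v)\<^sup>2 *\<^sub>R N = (norm v)\<^sup>2 *\<^sub>R (W w - N)" by (simp add: scaleR_diff_right)
    moreover have "W w - N \<in> psd2" using n(2)[OF w] lorY[of w 1] by (simp add: psd2_iff_lor)
    ultimately show ?thesis by (simp add: psd2_scaleR)
  qed
  then have Y: "pos_quadmap Y" unfolding Y_def by (intro pos_quadmap_diff_norm2 W linear_ident)
  have cY: "lor_t (Y v\<^sub>1) = lor_x (Y v\<^sub>1) \<bullet> u\<^sub>1" "lor_t (Y v\<^sub>2) = lor_x (Y v\<^sub>2) \<bullet> u\<^sub>2"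
    using v c lorY[of _ 1] by (simp_all add: Y_def)
  have v0: "v\<^sub>1 \<noteq> 0" "v\<^sub>2 \<noteq> 0" using v by auto
  have "sos Y"
    using contact_cases[OF u(1) cY(1)] contact_cases[OF u(2) cY(2)]
  proof (elim disjE conjE)
    \<comment> \<open>Two distinct directions cannot both be the point at infinity.\<close>
    show "sos Y" if "u\<^sub>1 = (1, 0)" "u\<^sub>2 = (1, 0)" using that u by simp
    show "sos Y" if "fst (snd (Y v\<^sub>1)) = 0" "fst (shear (- (snd u\<^sub>2 /\<^sub>R (1 - fst u\<^sub>2))) (Y v\<^sub>2)) = 0"
      by (rule sos_contact_infinity[OF Y v0 that])
    show "sos Y" if "fst (snd (Y v\<^sub>2)) = 0" "fst (shear (- (snd u\<^sub>1 /\<^sub>R (1 - fst u\<^sub>1))) (Y v\<^sub>1)) = 0"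
      by (rule sos_contact_infinity[OF Y v0(2,1) that])
    show "sos Y" if "fst u\<^sub>1 \<noteq> 1" "fst u\<^sub>2 \<noteq> 1"
      "fst (shear (- (snd u\<^sub>1 /\<^sub>R (1 - fst u\<^sub>1))) (Y v\<^sub>1)) = 0"
      "fst (shear (- (snd u\<^sub>2 /\<^sub>R (1 - fst u\<^sub>2))) (Y v\<^sub>2)) = 0"
      using stereographic_inj[OF u(1,2) that(1,2)] u(3)
      by (intro sos_contact_finite[OF Y v0 _ that(3,4)]) blast
  qed
  then have "sos (\<lambda>v. Y v + (norm v)\<^sup>2 *\<^sub>R N)" by (intro sos_add sos_norm2[OF linear_ident N])
  then show "sos (\<lambda>v. Z v + e *\<^sub>R ((norm v)\<^sup>2 *\<^sub>R of_lor 1 0))"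
    by (simp add: Y_def W_def)
qed


section \<open>Separable matrices and duality\<close>

definition herm_mat :: "herm2 \<Rightarrow> quat^2^2"
  where "herm_mat z = (\<chi> i j. if i = 1 then (if j = 1 then fst z *\<^sub>R 1 else snd (snd z))
    else (if j = 1 then qcnj (snd (snd z)) else fst (snd z) *\<^sub>R 1))"

definition outer :: "real^'n \<Rightarrow> real^'n^'n"
  where "outer v = (\<chi> i j. v $ i * v $ j)"

lemma herm_mat_nth [simp]:
  "herm_mat z $ 1 $ 1 = fst z *\<^sub>R 1" "herm_mat z $ 1 $ 2 = snd (snd z)"
  "herm_mat z $ 2 $ 1 = qcnj (snd (snd z))" "herm_mat z $ 2 $ 2 = fst (snd z) *\<^sub>R 1"
  by (simp_all add: herm_mat_def)

lemma qcnj_sum: "qcnj (sum f S) = (\<Sum>i\<in>S. qcnj (f i))"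
  using linear_sum[OF linear_qcnj] by (simp add: o_def)

lemma qRe_sum: "qRe (sum f S) = (\<Sum>i\<in>S. qRe (f i))"
  using linear_sum[of qRe f S] by (simp add: linear_iff o_def)

lemma quat_form_eq: "quat_form A v = (\<Sum>i\<in>UNIV. \<Sum>j\<in>UNIV. qcnj (v $ i) * A $ i $ j * v $ j)"
  by (simp add: quat_form_def matrix_vector_mult_def sum_distrib_left mult.assoc)

lemma quat_form_hermitian: "A \<in> quat_herm \<Longrightarrow> qcnj (quat_form A v) = quat_form A v"
proof -
  assume "A \<in> quat_herm"
  then have A: "qcnj (A $ i $ j) = A $ j $ i" for i j
    by (simp add: quat_herm_def qadjoint_def vec_eq_iff)
  have "qcnj (quat_form A v) = (\<Sum>i\<in>UNIV. \<Sum>j\<in>UNIV. qcnj (v $ j) * A $ j $ i * v $ i)"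
    by (simp add: quat_form_eq qcnj_sum qcnj_mult qcnj_qcnj A mult.assoc)
  also have "\<dots> = quat_form A v" unfolding quat_form_eq by (rule sum.swap)
  finally show ?thesis .
qed

lemma qRe_quat_form:
  "qRe (quat_form A v) = (\<Sum>i\<in>UNIV. \<Sum>j\<in>UNIV. A $ i $ j \<bullet> (v $ i * qcnj (v $ j)))"
  unfolding quat_form_eq qRe_sum
  by (intro sum.cong refl) (simp add: inner_quat_def quat_mult_sel algebra_simps)

text \<open>The form of a hermitian matrix equals its own conjugate, so it is real and only its real
  part has to be tested; written with inner products, that part is linear in the matrix.\<close>

lemma quat_psd_iff:
  "A \<in> quat_psd \<longleftrightarrow> A \<in> quat_herm \<and>
    (\<forall>v. 0 \<le> (\<Sum>i\<in>UNIV. \<Sum>j\<in>UNIV. A $ i $ j \<bullet> (v $ i * qcnj (v $ j))))"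
proof -
  have "quat_form A v \<in> \<real>\<^sub>\<ge>\<^sub>0 \<longleftrightarrow> 0 \<le> qRe (quat_form A v)" if "A \<in> quat_herm" for v
  proof
    assume "quat_form A v \<in> \<real>\<^sub>\<ge>\<^sub>0"
    then show "0 \<le> qRe (quat_form A v)" by (auto simp: nonneg_Reals_def of_real_def)
  next
    assume "0 \<le> qRe (quat_form A v)"
    moreover have "quat_form A v = of_real (qRe (quat_form A v))"
      using quat_form_hermitian[OF that, of v] by (simp add: quat_eq_iff of_real_def)
    ultimately show "quat_form A v \<in> \<real>\<^sub>\<ge>\<^sub>0" unfolding nonneg_Reals_def by blast
  qed
  then show ?thesis unfolding quat_psd_def qRe_quat_form by blast
qed

lemma quat_psd_zero: "0 \<in> quat_psd"
  by (simp add: quat_psd_iff quat_herm_def qadjoint_def vec_eq_iff qcnj_zero)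

lemma quat_psd_add: "A \<in> quat_psd \<Longrightarrow> B \<in> quat_psd \<Longrightarrow> A + B \<in> quat_psd"
  by (simp add: quat_psd_iff quat_herm_def qadjoint_def vec_eq_iff qcnj_add inner_add_left
      sum.distrib)

lemma quat_psd_scaleR: "A \<in> quat_psd \<Longrightarrow> 0 \<le> r \<Longrightarrow> r *\<^sub>R A \<in> quat_psd"
  by (simp add: quat_psd_iff quat_herm_def qadjoint_def vec_eq_iff qcnj_scaleR
      sum_distrib_left[symmetric])

section \<open>Hermitian 2 x 2 matrices and their Kronecker products\<close>

lemma herm_mat_psd:
  assumes "z \<in> psd2"
  shows "herm_mat z \<in> quat_psd"
proof -
  obtain a b q where z: "z = (a, b, q)" by (metis prod_cases3)
  have ab: "0 \<le> a" "0 \<le> b" "(norm q)\<^sup>2 \<le> a * b" using assms by (simp_all add: z psd2_def)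
  have "0 \<le> a * (norm x)\<^sup>2 + b * (norm y)\<^sup>2 + 2 * (q \<bullet> (x * qcnj y))" for x y
  proof -
    have "(norm q * (norm x * norm y))\<^sup>2 = (norm q)\<^sup>2 * ((norm x)\<^sup>2 * (norm y)\<^sup>2)"
      by (simp add: power_mult_distrib)
    also have "\<dots> \<le> (a * b) * ((norm x)\<^sup>2 * (norm y)\<^sup>2)"
      using ab(3) by (intro mult_right_mono) auto
    also have "\<dots> \<le> ((a * (norm x)\<^sup>2 + b * (norm y)\<^sup>2) / 2)\<^sup>2"
      using zero_le_power2[of "a * (norm x)\<^sup>2 - b * (norm y)\<^sup>2"]
      by (simp add: power2_sum power2_diff power_divide algebra_simps)
    finally have "norm q * (norm x * norm y) \<le> (a * (norm x)\<^sup>2 + b * (norm y)\<^sup>2) / 2"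
      by (rule power2_le_imp_le) (use ab in simp)
    moreover have "\<bar>q \<bullet> (x * qcnj y)\<bar> \<le> norm q * (norm x * norm y)"
      using Cauchy_Schwarz_ineq2[of q "x * qcnj y"] by (simp add: norm_quat_mult)
    ultimately have "- (q \<bullet> (x * qcnj y)) \<le> (a * (norm x)\<^sup>2 + b * (norm y)\<^sup>2) / 2"
      by (meson abs_le_D2 order_trans)
    then show ?thesis by (simp add: field_simps)
  qed
  moreover have "qcnj q \<bullet> (y * qcnj x) = q \<bullet> (x * qcnj y)" for x y
    by (simp add: inner_qcnj_left qcnj_mult qcnj_qcnj)
  moreover have "1 \<bullet> (x * qcnj x) = (norm x)\<^sup>2" for x :: quat
    by (simp add: mult_qcnj_self dot_square_norm)
  ultimately show ?thesis
    by (simp add: quat_psd_iff quat_herm_def qadjoint_def vec_eq_iff forall_2 sum_2 z qcnj_qcnj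
        qcnj_scaleR algebra_simps) (simp add: quat_eq_iff)
qed

text \<open>The test vectors (s q, t) already detect a negative determinant. The criterion serves
  both for matrices and for the dual cone.\<close>

lemma psd2_of_quadratic:
  assumes "0 \<le> a" "0 \<le> b"
    and h: "\<And>s t. 0 \<le> a * s\<^sup>2 * (norm q)\<^sup>2 + b * t\<^sup>2 + 2 * s * t * (norm q)\<^sup>2"
  shows "(a, b, q) \<in> psd2"
proof (cases "q = 0 \<or> b = 0")
  case True
  show ?thesis
  proof (cases "q = 0")
    case False
    then have "0 < (norm q)\<^sup>2" "b = 0" using True by simp_all
    moreover from this have "0 \<le> - (norm q)\<^sup>2"
      using h[of 1 "- (a + 1) / 2"] by (simp add: field_simps)
    ultimately show ?thesis by linarith
  qed (use assms in \<open>simp add: psd2_def\<close>)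
next
  case False
  then have pos: "0 < b * (norm q)\<^sup>2" using assms(2) by simp
  \<comment> \<open>At s = b and t = - norm q^2 the form equals b norm q^2 times the
    determinant.\<close>
  have "0 \<le> b * (norm q)\<^sup>2 * (a * b - (norm q)\<^sup>2)"
    using h[of b "- (norm q)\<^sup>2"] by (simp add: power2_eq_square algebra_simps)
  then have "(norm q)\<^sup>2 \<le> a * b" using pos by (simp add: zero_le_mult_iff)
  then show ?thesis using assms by (simp add: psd2_def)
qed

lemma quat_psd_herm_mat:
  assumes "A \<in> quat_psd"
  obtains z where "z \<in> psd2" "A = herm_mat z"
proof -
  have herm: "qcnj (A $ i $ j) = A $ j $ i" for i j
    using assms by (simp add: quat_psd_iff quat_herm_def qadjoint_def vec_eq_iff)
  define a b q where "a = qRe (A $ 1 $ 1)" "b = qRe (A $ 2 $ 2)" "q = A $ 1 $ 2"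
  note defs = this
  have A: "A $ 1 $ 1 = a *\<^sub>R 1" "A $ 2 $ 2 = b *\<^sub>R 1" "A $ 2 $ 1 = qcnj q"
    using herm[of 1 1] herm[of 2 2] herm[of 1 2] by (simp_all add: defs quat_eq_iff)
  have "A = herm_mat (a, b, q)"
    by (simp add: vec_eq_iff forall_2 A defs(3))
  moreover have "(a, b, q) \<in> psd2"
  proof (rule psd2_of_quadratic)
    have f: "0 \<le> a * (norm x)\<^sup>2 + b * (norm y)\<^sup>2 + 2 * (q \<bullet> (x * qcnj y))" for x y
    proof -
      have "0 \<le> (\<Sum>i\<in>UNIV. \<Sum>j\<in>UNIV. A $ i $ j \<bullet> ((vector [x, y] :: quat^2) $ i * qcnj (vector [x, y] $ j)))"
        using assms unfolding quat_psd_iff by blast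
      also have "\<dots> = a * (1 \<bullet> (x * qcnj x)) + q \<bullet> (x * qcnj y) + (qcnj q \<bullet> (y * qcnj x) + b * (1 \<bullet> (y * qcnj y)))"
        by (simp add: sum_2 A defs(3)[symmetric])
      also have "qcnj q \<bullet> (y * qcnj x) = q \<bullet> (x * qcnj y)"
        by (simp add: inner_qcnj_left qcnj_mult qcnj_qcnj)
      finally show ?thesis by (simp add: mult_qcnj_self dot_square_norm)
    qed
    show "0 \<le> a" "0 \<le> b" using f[of 1 0] f[of 0 1] by (simp_all add: qcnj_zero)
    show "0 \<le> a * s\<^sup>2 * (norm q)\<^sup>2 + b * t\<^sup>2 + 2 * s * t * (norm q)\<^sup>2" for s t
      using f[of "s *\<^sub>R q" "t *\<^sub>R 1"]
      by (simp add: power_mult_distrib qcnj_scaleR dot_square_norm quat_eq_iff[of "qcnj 1" 1, simplified] mult_ac)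
  qed
  ultimately show thesis using that by blast
qed

lemma outer_psd: "outer v \<in> real_psd"
proof -
  have "w \<bullet> (outer v *v w) = (v \<bullet> w)\<^sup>2" for w
    by (simp add: inner_vec_def matrix_vector_mult_def outer_def power2_eq_square sum_product
        sum_distrib_left algebra_simps)
  then show ?thesis
    by (simp add: real_psd_def real_sym_def outer_def transpose_def vec_eq_iff mult.commute)
qed

lemma real_psd_inner_sum:
  fixes y :: "'n::finite \<Rightarrow> quat"
  assumes B: "B \<in> real_psd"
  shows "0 \<le> (\<Sum>a\<in>UNIV. \<Sum>b\<in>UNIV. B $ a $ b * (y a \<bullet> y b))"
proof -
  have *: "0 \<le> (\<Sum>a\<in>UNIV. \<Sum>b\<in>UNIV. B $ a $ b * (f a * f b))" for f :: "'n \<Rightarrow> real"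
  proof -
    have "0 \<le> (\<chi> a. f a) \<bullet> (B *v (\<chi> a. f a))" using B by (simp add: real_psd_def)
    also have "\<dots> = (\<Sum>a\<in>UNIV. \<Sum>b\<in>UNIV. B $ a $ b * (f a * f b))"
      by (simp add: inner_vec_def matrix_vector_mult_def sum_distrib_left algebra_simps)
    finally show ?thesis .
  qed
  have "(\<Sum>a\<in>UNIV. \<Sum>b\<in>UNIV. B $ a $ b * (y a \<bullet> y b))
    = (\<Sum>a\<in>UNIV. \<Sum>b\<in>UNIV. B $ a $ b * (qRe (y a) * qRe (y b)))
    + (\<Sum>a\<in>UNIV. \<Sum>b\<in>UNIV. B $ a $ b * (qI (y a) * qI (y b)))
    + (\<Sum>a\<in>UNIV. \<Sum>b\<in>UNIV. B $ a $ b * (qJ (y a) * qJ (y b)))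
    + (\<Sum>a\<in>UNIV. \<Sum>b\<in>UNIV. B $ a $ b * (qK (y a) * qK (y b)))"
    by (simp add: inner_quat_def distrib_left sum.distrib)
  then show ?thesis using *[of "\<lambda>a. qRe (y a)"] *[of "\<lambda>a. qI (y a)"] *[of "\<lambda>a. qJ (y a)"]
      *[of "\<lambda>a. qK (y a)"] by linarith
qed

lemma sum_UNIV_prod:
  "(\<Sum>p\<in>(UNIV :: ('m::finite \<times> 'n::finite) set). f p) = (\<Sum>i\<in>UNIV. \<Sum>a\<in>UNIV. f (i, a))"
  unfolding UNIV_Times_UNIV[symmetric] by (simp add: sum.cartesian_product)

lemma kron_add_left: "kron (A + A') B = kron A B + kron A' B"
  by (simp add: kron_def vec_eq_iff scaleR_right_distrib)

lemma kron_herm: "A \<in> quat_herm \<Longrightarrow> B \<in> real_sym \<Longrightarrow> kron A B \<in> quat_herm"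
  by (auto simp: quat_herm_def real_sym_def qadjoint_def kron_def vec_eq_iff transpose_def
      qcnj_scaleR)

text \<open>For A of rank one the form collapses to \<open>B\<close> evaluated on the quaternions
  obtained by summing \<open>qcnj (c i) * w $ (i, a)\<close> over i.\<close>

lemma kron_rank_one_psd:
  fixes c :: "2 \<Rightarrow> quat" and B :: "real^'n^'n"
  assumes A: "A = (\<chi> i j. c i * qcnj (c j))" and B: "B \<in> real_psd"
  shows "kron A B \<in> quat_psd"
  unfolding quat_psd_iff
proof (intro conjI allI)
  show "kron A B \<in> quat_herm"
    using B by (intro kron_herm)
      (simp_all add: A quat_herm_def qadjoint_def qcnj_mult qcnj_qcnj real_psd_def)
  fix w :: "quat^(2 \<times> 'n)"
  \<comment> \<open>Cyclicity of the real part stands in for commutativity.\<close>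
  have t: "(c i * qcnj (c j)) \<bullet> (x * qcnj y) = (qcnj (c i) * x) \<bullet> (qcnj (c j) * y)" for i j x y
  proof -
    have "(c i * qcnj (c j)) \<bullet> (x * qcnj y) = qRe (c j * (qcnj (c i) * x * qcnj y))"
      by (simp add: quat_inner_qRe(1) qcnj_mult qcnj_qcnj mult.assoc)
    also have "\<dots> = qRe (qcnj (c i) * x * qcnj y * c j)" by (rule qRe_mult_commute)
    also have "\<dots> = (qcnj (c i) * x) \<bullet> (qcnj (c j) * y)"
      by (simp add: quat_inner_qRe(2) qcnj_mult qcnj_qcnj mult.assoc)
    finally show ?thesis .
  qed
  have "(\<Sum>p\<in>UNIV. \<Sum>q\<in>UNIV. kron A B $ p $ q \<bullet> (w $ p * qcnj (w $ q)))
    = (\<Sum>i\<in>UNIV. \<Sum>a\<in>UNIV. \<Sum>j\<in>UNIV. \<Sum>b\<in>UNIV. B $ a $ b * ((qcnj (c i) * w $ (i, a)) \<bullet> (qcnj (c j) * w $ (j, b))))"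
    unfolding sum_UNIV_prod by (simp add: kron_def A t)
  also have "\<dots> = (\<Sum>a\<in>UNIV. \<Sum>b\<in>UNIV. B $ a $ b *
      ((\<Sum>i\<in>UNIV. qcnj (c i) * w $ (i, a)) \<bullet> (\<Sum>j\<in>UNIV. qcnj (c j) * w $ (j, b))))"
    unfolding sum_2 by (simp add: inner_add_left inner_add_right distrib_left sum.distrib algebra_simps)
  also have "0 \<le> \<dots>" by (rule real_psd_inner_sum[OF B])
  finally show "0 \<le> (\<Sum>p\<in>UNIV. \<Sum>q\<in>UNIV. kron A B $ p $ q \<bullet> (w $ p * qcnj (w $ q)))" by simp
qed

lemma kron_psd:
  fixes B :: "real^'n^'n"
  assumes z: "z \<in> psd2" and B: "B \<in> real_psd"
  shows "kron (herm_mat z) B \<in> quat_psd"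
proof -
  obtain c d x y where zeq: "z = ((norm c)\<^sup>2, (norm d)\<^sup>2, c * qcnj d)
      + ((norm x)\<^sup>2, (norm y)\<^sup>2, x * qcnj y)"
    using psd2_rank_ones[OF z] by metis
  have h: "herm_mat ((norm x)\<^sup>2, (norm y)\<^sup>2, x * qcnj y)
      = (\<chi> i j. (if i = 1 then x else y) * qcnj (if j = 1 then x else y))" for x y
    by (simp add: vec_eq_iff forall_2 mult_qcnj_self qcnj_mult qcnj_qcnj)
  have "herm_mat (z + z') = herm_mat z + herm_mat z'" for z z'
    by (simp add: vec_eq_iff forall_2 scaleR_left_distrib qcnj_add)
  then show ?thesis
    unfolding zeq by (simp only: kron_add_left h quat_psd_add kron_rank_one_psd[OF refl B])
qed

lemma partial_transpose_kron_herm_mat: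
  "partial_transpose (kron (herm_mat (a, b, q)) B) = kron (herm_mat (a, b, qcnj q)) B"
proof -
  have "herm_mat (a, b, q) $ j $ i = herm_mat (a, b, qcnj q) $ i $ j" for i j :: 2
    using exhaust_2[of i] exhaust_2[of j] by (auto simp: qcnj_qcnj)
  then show ?thesis by (simp add: partial_transpose_def kron_def vec_eq_iff)
qed

text \<open>Transposing a hermitian 2 x 2 matrix conjugates its off-diagonal entry, and membership
  in \<open>psd2\<close> depends only on the norm of that entry.\<close>

lemma kron_PPT:
  fixes B :: "real^'n^'n"
  assumes "A \<in> (quat_psd :: (quat^2^2) set)" "B \<in> real_psd"
  shows "PPT (kron A B)"
proof -
  obtain z where z: "z \<in> psd2" "A = herm_mat z" by (rule quat_psd_herm_mat[OF assms(1)])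
  obtain a b q where "z = (a, b, q)" by (metis prod_cases3)
  moreover from this z have "(a, b, qcnj q) \<in> psd2" by (simp add: psd2_def)
  ultimately show ?thesis
    using z assms(2) by (simp add: PPT_def partial_transpose_kron_herm_mat kron_psd)
qed

lemma separable_imp_PPT:
  fixes M :: "quat^(2 \<times> 'n::finite)^(2 \<times> 'n)"
  assumes "separable M"
  shows "PPT M" "M \<in> herm_tensor_sym"
proof -
  obtain N :: nat and A B where AB: "\<And>l. l < N \<Longrightarrow> A l \<in> quat_psd \<and> B l \<in> real_psd"
    and M: "M = (\<Sum>l<N. kron (A l) (B l))" using assms unfolding separable_def by blast
  have add: "PPT X \<Longrightarrow> PPT Y \<Longrightarrow> PPT (X + Y)" for X Y :: "quat^(2 \<times> 'n)^(2 \<times> 'n)"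
  proof -
    have "partial_transpose (X + Y) = partial_transpose X + partial_transpose Y"
      by (simp add: partial_transpose_def vec_eq_iff)
    then show "PPT X \<Longrightarrow> PPT Y \<Longrightarrow> PPT (X + Y)" by (simp add: PPT_def quat_psd_add)
  qed
  have zero: "PPT (0 :: quat^(2 \<times> 'n)^(2 \<times> 'n))"
  proof -
    have "partial_transpose (0 :: quat^(2 \<times> 'n)^(2 \<times> 'n)) = 0"
      by (simp add: partial_transpose_def vec_eq_iff)
    then show ?thesis by (simp add: PPT_def quat_psd_zero)
  qed
  have "PPT (\<Sum>l\<in>S. kron (A l) (B l))" if "finite S" "S \<subseteq> {..<N}" for S
    using that by (induction S rule: finite_induct) (simp_all add: zero add kron_PPT AB)
  then show "PPT M" unfolding M by simp
  show "M \<in> herm_tensor_sym"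
    unfolding M herm_tensor_sym_def
  proof (intro span_sum span_base)
    fix l assume "l \<in> {..<N}"
    then have "A l \<in> quat_herm" "B l \<in> real_sym"
      using AB[of l] by (simp_all add: quat_psd_def real_psd_def)
    then show "kron (A l) (B l) \<in> {kron A B |A B. A \<in> quat_herm \<and> B \<in> real_sym}" by blast
  qed
qed


section \<open>Separable matrices form a convex cone\<close>

lemma separable_kron_add:
  assumes "separable M" "A \<in> quat_psd" "B \<in> real_psd"
  shows "separable (M + kron A B)"
proof -
  obtain N :: nat and A' B' where *: "\<And>l. l < N \<Longrightarrow> A' l \<in> quat_psd \<and> B' l \<in> real_psd"
    and M: "M = (\<Sum>l<N. kron (A' l) (B' l))" using assms unfolding separable_def by blast
  have "M + kron A B = (\<Sum>l<Suc N. kron ((A'(N := A)) l) ((B'(N := B)) l))"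
    by (simp add: M)
  moreover have "(A'(N := A)) l \<in> quat_psd \<and> (B'(N := B)) l \<in> real_psd" if "l < Suc N" for l
    using that * assms by (auto simp: less_Suc_eq)
  ultimately show ?thesis unfolding separable_def by blast
qed

lemma separable_zero: "separable 0"
  unfolding separable_def by (intro exI[of _ 0]) simp

lemma separable_add:
  assumes M: "separable M" and N: "separable N"
  shows "separable (M + N)"
proof -
  obtain n :: nat and A B where *: "\<And>l. l < n \<Longrightarrow> A l \<in> quat_psd \<and> B l \<in> real_psd"
    and N: "N = (\<Sum>l<n. kron (A l) (B l))" using N unfolding separable_def by blast
  have "separable (M + (\<Sum>l<k. kron (A l) (B l)))" if "k \<le> n" for k
    using that
  proof (induction k)
    case 0 then show ?case using M by simp
  next
    case (Suc k)
    then show ?case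
      using separable_kron_add[of "M + (\<Sum>l<k. kron (A l) (B l))" "A k" "B k"] *[of k]
      by (simp add: add.assoc)
  qed
  then show ?thesis unfolding N by simp
qed

lemma separable_scaleR:
  assumes M: "separable M" and r: "0 \<le> r"
  shows "separable (r *\<^sub>R M)"
proof -
  obtain n :: nat and A B where *: "\<And>l. l < n \<Longrightarrow> A l \<in> quat_psd \<and> B l \<in> real_psd"
    and M: "M = (\<Sum>l<n. kron (A l) (B l))" using M unfolding separable_def by blast
  have "r *\<^sub>R M = (\<Sum>l<n. kron (r *\<^sub>R A l) (B l))"
    unfolding M scaleR_sum_right
    by (intro sum.cong refl) (simp add: kron_def vec_eq_iff mult.commute)
  moreover have "\<forall>l<n. r *\<^sub>R A l \<in> quat_psd \<and> B l \<in> real_psd"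
    using * r quat_psd_scaleR by blast
  ultimately show ?thesis
    unfolding separable_def by (intro exI[of _ n] exI[of _ "\<lambda>l. r *\<^sub>R A l"] exI[of _ B] conjI)
qed

lemma separable_kron: "A \<in> quat_psd \<Longrightarrow> B \<in> real_psd \<Longrightarrow> separable (kron A B)"
  using separable_kron_add[OF separable_zero] by simp

section \<open>Matrices as functionals on quadratic maps\<close>

definition qform :: "('n::finite \<Rightarrow> 'n \<Rightarrow> herm2) \<Rightarrow> real^'n \<Rightarrow> herm2"
  where "qform G v = (\<Sum>a\<in>UNIV. \<Sum>b\<in>UNIV. (v $ a * v $ b) *\<^sub>R G a b)"

text \<open>The real trace form of two hermitian matrices, in which off-diagonal entries count
  twice.\<close>

definition hpair :: "herm2 \<Rightarrow> herm2 \<Rightarrow> real"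
  where "hpair = (\<lambda>(a, b, q) (a', b', q'). a * a' + b * b' + 2 * (q \<bullet> q'))"

text \<open>Averaging the two off-diagonal entries lets \<open>X\<close> be an arbitrary matrix; on
  the tensor product the two agree.\<close>

definition block :: "quat^(2 \<times> 'n::finite)^(2 \<times> 'n) \<Rightarrow> 'n \<Rightarrow> 'n \<Rightarrow> herm2"
  where "block X a b = (qRe (X $ (1, a) $ (1, b)), qRe (X $ (2, a) $ (2, b)),
    (1/2) *\<^sub>R (X $ (1, a) $ (2, b) + qcnj (X $ (2, a) $ (1, b))))"

text \<open>Polarisation at the unit vectors recovers the coefficients of a quadratic map, and makes sense
  for every function, so that the functional is defined on the whole function space.\<close>

definition pairing :: "quat^(2 \<times> 'n::finite)^(2 \<times> 'n) \<Rightarrow> (real^'n \<Rightarrow> herm2) \<Rightarrow> real"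
  where "pairing M F = (\<Sum>a\<in>UNIV. \<Sum>b\<in>UNIV.
    hpair (block M a b) ((1/2) *\<^sub>R (F (axis a 1 + axis b 1) - F (axis a 1) - F (axis b 1))))"

lemma linear_hpair: "linear (hpair z)"
  by (auto simp: linear_iff hpair_def inner_add_right algebra_simps split: prod.splits)

lemma hpair_commute: "hpair z w = hpair w z"
  by (simp add: hpair_def inner_commute split: prod.splits)

lemma pairing_linear: "pairing M (\<lambda>v. A v + r *\<^sub>R B v) = pairing M A + r * pairing M B"
proof -
  have "(1/2) *\<^sub>R ((A u + r *\<^sub>R B u) - (A v + r *\<^sub>R B v) - (A w + r *\<^sub>R B w))
      = (1/2) *\<^sub>R (A u - A v - A w) + r *\<^sub>R ((1/2) *\<^sub>R (B u - B v - B w))" for u v w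
    by (simp add: scaleR_right_diff_distrib scaleR_right_distrib mult.commute)
  then show ?thesis
    unfolding pairing_def
    by (simp only: linear_add[OF linear_hpair] linear_scale[OF linear_hpair] sum.distrib
        sum_distrib_left real_scaleR_def)
qed

text \<open>Hermitian symmetry exchanges a and b together with the block indices, and symmetry of
  the blocks exchanges a and b back; so for fixed a, b the 2 x 2 matrix of entries is
  hermitian.\<close>

lemma herm_tensor_sym_block:
  assumes M: "M \<in> (herm_tensor_sym :: (quat^(2 \<times> 'n::finite)^(2 \<times> 'n)) set)"
  shows "M $ (1, a) $ (1, b) = qRe (M $ (1, a) $ (1, b)) *\<^sub>R 1"
    "M $ (2, a) $ (2, b) = qRe (M $ (2, a) $ (2, b)) *\<^sub>R 1"
    "M $ (2, a) $ (1, b) = qcnj (M $ (1, a) $ (2, b))"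
    "block M a b = (qRe (M $ (1, a) $ (1, b)), qRe (M $ (2, a) $ (2, b)), M $ (1, a) $ (2, b))"
    "block M a b = block M b a"
proof -
  have sym: "M $ (i, a) $ (j, b) = M $ (i, b) $ (j, a)" and herm: "qcnj (M $ p $ q) = M $ q $ p"
    for i j a b p q
    using M unfolding herm_tensor_sym_iff
    by (simp, cases p, cases q, simp add: quat_herm_def qadjoint_def vec_eq_iff)
  have c: "qcnj (M $ (i, a) $ (j, b)) = M $ (j, a) $ (i, b)" for i j a b
    using herm[of "(i, a)" "(j, b)"] sym[of j b i a] by simp
  show "M $ (1, a) $ (1, b) = qRe (M $ (1, a) $ (1, b)) *\<^sub>R 1"
    "M $ (2, a) $ (2, b) = qRe (M $ (2, a) $ (2, b)) *\<^sub>R 1"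
    using c[of 1 a 1 b] c[of 2 a 2 b] by (simp_all add: quat_eq_iff)
  show "M $ (2, a) $ (1, b) = qcnj (M $ (1, a) $ (2, b))" by (simp add: c)
  then show *: "block M a b = (qRe (M $ (1, a) $ (1, b)), qRe (M $ (2, a) $ (2, b)), M $ (1, a) $ (2, b))"
    by (simp add: block_def qcnj_qcnj scaleR_2[symmetric])
  show "block M a b = block M b a"
    unfolding block_def using sym by metis
qed

text \<open>Pairing with an element of the tensor product sees only the averaged part of the other
  factor, so \<open>X\<close> may be the normal of any separating hyperplane.\<close>

lemma inner_block:
  assumes M: "M \<in> (herm_tensor_sym :: (quat^(2 \<times> 'n::finite)^(2 \<times> 'n)) set)"
  shows "M \<bullet> X = (\<Sum>a\<in>UNIV. \<Sum>b\<in>UNIV. hpair (block M a b) (block X a b))"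
proof -
  note B = herm_tensor_sym_block[OF M]
  have one: "1 \<bullet> x = qRe x" for x :: quat by (simp add: inner_quat_def)
  have "M \<bullet> X = (\<Sum>i\<in>UNIV. \<Sum>a\<in>UNIV. \<Sum>j\<in>UNIV. \<Sum>b\<in>UNIV. M $ (i, a) $ (j, b) \<bullet> X $ (i, a) $ (j, b))"
    unfolding inner_vec_def sum_UNIV_prod ..
  also have "\<dots> = (\<Sum>a\<in>UNIV. \<Sum>b\<in>UNIV. \<Sum>i\<in>UNIV. \<Sum>j\<in>UNIV. M $ (i, a) $ (j, b) \<bullet> X $ (i, a) $ (j, b))"
    unfolding sum_2 by (simp add: sum.distrib algebra_simps)
  also have "\<dots> = (\<Sum>a\<in>UNIV. \<Sum>b\<in>UNIV. hpair (block M a b) (block X a b))"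
  proof (intro sum.cong refl)
    fix a b
    have "M $ (1, a) $ (1, b) \<bullet> X $ (1, a) $ (1, b) = qRe (M $ (1, a) $ (1, b)) * qRe (X $ (1, a) $ (1, b))"
      by (subst B(1)) (simp add: one)
    moreover have "M $ (2, a) $ (2, b) \<bullet> X $ (2, a) $ (2, b) = qRe (M $ (2, a) $ (2, b)) * qRe (X $ (2, a) $ (2, b))"
      by (subst B(2)) (simp add: one)
    ultimately show "(\<Sum>i\<in>UNIV. \<Sum>j\<in>UNIV. M $ (i, a) $ (j, b) \<bullet> X $ (i, a) $ (j, b))
        = hpair (block M a b) (block X a b)"
      unfolding sum_2 B(4) by (simp add: B(3) block_def hpair_def inner_add_right inner_qcnj_left)
  qed
  finally show ?thesis .
qed

lemma quadmap_polar:
  assumes "bilinear B" "\<And>x y. B x y = B y x"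
  shows "(1/2) *\<^sub>R (B (x + y) (x + y) - B x x - B y y) = B x y"
  using assms(2)[of y x]
  by (simp add: bilinear_ladd[OF assms(1)] bilinear_radd[OF assms(1)] scaleR_2[symmetric])

lemma bilinear_matrix:
  fixes H :: "'n::finite \<Rightarrow> 'n \<Rightarrow> 'w::real_vector"
  shows "bilinear (\<lambda>u v :: real^'n. \<Sum>a\<in>UNIV. \<Sum>b\<in>UNIV. (u $ a * v $ b) *\<^sub>R H a b)"
  unfolding bilinear_def
  by (auto simp: linear_iff distrib_left distrib_right scaleR_left_distrib sum.distrib
      scaleR_sum_right mult_ac)

lemma qform_bilinear:
  fixes G :: "'n::finite \<Rightarrow> 'n \<Rightarrow> herm2"
  obtains B where "bilinear B" "\<And>u v. B u v = B v u" "qform G = (\<lambda>v. B v v)"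
    "\<And>a b. B (axis a 1) (axis b 1) = (1/2) *\<^sub>R (G a b + G b a)"
proof -
  define B where "B = (\<lambda>u v :: real^'n. \<Sum>a\<in>UNIV. \<Sum>b\<in>UNIV. (u $ a * v $ b) *\<^sub>R ((1/2) *\<^sub>R (G a b + G b a)))"
  have 1: "bilinear B"
    unfolding B_def by (rule bilinear_matrix)
  have 2: "B u v = B v u" for u v
    unfolding B_def by (subst sum.swap) (simp add: mult.commute add.commute)
  have "B v v = qform G v" for v
  proof -
    have "B v v = (1/2) *\<^sub>R qform G v + (1/2) *\<^sub>R (\<Sum>a\<in>UNIV. \<Sum>b\<in>UNIV. (v $ a * v $ b) *\<^sub>R G b a)"
      by (simp add: B_def qform_def scaleR_right_distrib sum.distrib scaleR_sum_right mult.commute)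
    also have "(\<Sum>a\<in>UNIV. \<Sum>b\<in>UNIV. (v $ a * v $ b) *\<^sub>R G b a) = qform G v"
      unfolding qform_def by (subst sum.swap) (simp add: mult.commute)
    finally show ?thesis by (simp add: scaleR_left_distrib[symmetric])
  qed
  then have 3: "qform G = (\<lambda>v. B v v)" by auto
  have ax: "(axis a 1 $ c * axis b 1 $ d) *\<^sub>R x = (if c = a then if d = b then x else 0 else 0)"
    for a b c d :: 'n and x :: herm2 by (simp add: axis_def)
  have pick: "(\<Sum>d\<in>UNIV. if c = a then if d = b then h d else 0 else 0) = (if c = a then h b else 0)"
    for a b c and h :: "'n \<Rightarrow> herm2" by (cases "c = a") simp_all
  have 4: "B (axis a 1) (axis b 1) = (1/2) *\<^sub>R (G a b + G b a)" for a b
    unfolding B_def ax pick by simp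
  from 1 2 3 4 show thesis by (rule that)
qed

text \<open>Polarisation returns the coefficients symmetrised in a and b; the sum does not change
  because \<open>block M\<close> is symmetric in them.\<close>

lemma pairing_qform:
  assumes M: "M \<in> herm_tensor_sym"
  shows "pairing M (qform (block X)) = M \<bullet> X"
proof -
  obtain B where q: "bilinear B" "\<And>u v. B u v = B v u" "qform (block X) = (\<lambda>v. B v v)"
    "\<And>a b. B (axis a 1) (axis b 1) = (1/2) *\<^sub>R (block X a b + block X b a)"
    by (rule qform_bilinear[where G = "block X"]) (rule that)
  have "pairing M (qform (block X)) = (\<Sum>a\<in>UNIV. \<Sum>b\<in>UNIV. hpair (block M a b) ((1/2) *\<^sub>R (block X a b + block X b a)))"
    unfolding pairing_def q(3) by (simp only: quadmap_polar[OF q(1,2)]) (simp only: q(4))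
  also have "\<dots> = (1/2) * (\<Sum>a\<in>UNIV. \<Sum>b\<in>UNIV. hpair (block M a b) (block X a b))
      + (1/2) * (\<Sum>a\<in>UNIV. \<Sum>b\<in>UNIV. hpair (block M b a) (block X b a))"
    using herm_tensor_sym_block(5)[OF M]
    by (simp add: linear_add[OF linear_hpair] linear_scale[OF linear_hpair] sum.distrib
        sum_distrib_left scaleR_right_distrib)
  also have "(\<Sum>a\<in>UNIV. \<Sum>b\<in>UNIV. hpair (block M b a) (block X b a))
      = (\<Sum>a\<in>UNIV. \<Sum>b\<in>UNIV. hpair (block M a b) (block X a b))"
    by (rule sum.swap)
  finally show ?thesis by (simp add: inner_block[OF M])
qed


lemma linear_axis_expansion:
  fixes c :: "real^'n \<Rightarrow> 'w::real_vector"
  assumes "linear c"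
  shows "c v = (\<Sum>a\<in>UNIV. v $ a *\<^sub>R c (axis a 1))"
proof -
  have "v = (\<Sum>a\<in>UNIV. v $ a *\<^sub>R axis a 1)"
    using basis_expansion[of v] by (simp add: scalar_mult_eq_scaleR)
  then have "c v = c (\<Sum>a\<in>UNIV. v $ a *\<^sub>R axis a 1)" by simp
  also have "\<dots> = (\<Sum>a\<in>UNIV. v $ a *\<^sub>R c (axis a 1))"
    by (simp add: linear_sum[OF assms] linear_scale[OF assms])
  finally show ?thesis .
qed

lemma bilinear_sum_qcnj:
  fixes x y :: "'n::finite \<Rightarrow> quat" and v :: "real^'n"
  shows "(\<Sum>a\<in>UNIV. \<Sum>b\<in>UNIV. (v $ a * v $ b) *\<^sub>R (x a * qcnj (y b)))
      = (\<Sum>a\<in>UNIV. v $ a *\<^sub>R x a) * qcnj (\<Sum>b\<in>UNIV. v $ b *\<^sub>R y b)"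
    "(\<Sum>a\<in>UNIV. \<Sum>b\<in>UNIV. (v $ a * v $ b) *\<^sub>R (qcnj (y a) * x b))
      = qcnj (\<Sum>b\<in>UNIV. v $ b *\<^sub>R y b) * (\<Sum>a\<in>UNIV. v $ a *\<^sub>R x a)"
  by (simp_all add: sum_product qcnj_sum qcnj_scaleR mult.commute)

lemma qform_sel:
  "fst (qform G v) = (\<Sum>a\<in>UNIV. \<Sum>b\<in>UNIV. (v $ a * v $ b) * fst (G a b))"
  "fst (snd (qform G v)) = (\<Sum>a\<in>UNIV. \<Sum>b\<in>UNIV. (v $ a * v $ b) * fst (snd (G a b)))"
  "snd (snd (qform G v)) = (\<Sum>a\<in>UNIV. \<Sum>b\<in>UNIV. (v $ a * v $ b) *\<^sub>R snd (snd (G a b)))"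
  by (simp_all add: qform_def fst_sum snd_sum)

lemma qRe_bilinear_sum:
  fixes x :: "'n::finite \<Rightarrow> quat" and v :: "real^'n"
  shows "(\<Sum>a\<in>UNIV. \<Sum>b\<in>UNIV. (v $ a * v $ b) * qRe (x a * qcnj (x b))) = (norm (\<Sum>a\<in>UNIV. v $ a *\<^sub>R x a))\<^sup>2"
    "(\<Sum>a\<in>UNIV. \<Sum>b\<in>UNIV. (v $ a * v $ b) * qRe (qcnj (x a) * x b)) = (norm (\<Sum>a\<in>UNIV. v $ a *\<^sub>R x a))\<^sup>2"
  using arg_cong[OF bilinear_sum_qcnj(1)[of v x x], of qRe] arg_cong[OF bilinear_sum_qcnj(2)[of v x x], of qRe]
  by (simp_all add: qRe_sum mult_qcnj_self)

definition coeffs :: "(real^'n \<Rightarrow> quat) \<Rightarrow> (real^'n \<Rightarrow> quat) \<Rightarrow> quat^(2 \<times> 'n::finite)"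
  where "coeffs c d = (\<chi> p. if fst p = 1 then c (axis (snd p) 1) else d (axis (snd p) 1))"

definition qouter :: "quat^'m \<Rightarrow> quat^'m^'m"
  where "qouter w = (\<chi> p q. w $ p * qcnj (w $ q))"

text \<open>Squares of the first kind come from rank-one matrices \<open>qouter w\<close>, with w
  the coefficient vector of c and d; pairing \<open>M\<close> with one of these evaluates its
  quaternionic form at w.\<close>

lemma sq1_eq_qform:
  assumes "linear c" "linear d"
  shows "sq1 c d = qform (block (qouter (coeffs c d)))"
proof
  fix v
  define x y where "x = (\<lambda>a. c (axis a 1))" "y = (\<lambda>a. d (axis a 1))"
  note xy = this
  have v: "c v = (\<Sum>a\<in>UNIV. v $ a *\<^sub>R x a)" "d v = (\<Sum>a\<in>UNIV. v $ a *\<^sub>R y a)"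
    unfolding xy by (rule linear_axis_expansion[OF assms(1)] linear_axis_expansion[OF assms(2)])+
  have b: "block (qouter (coeffs c d)) a b = (qRe (x a * qcnj (x b)), qRe (y a * qcnj (y b)),
      (1/2) *\<^sub>R (x a * qcnj (y b) + x b * qcnj (y a)))" for a b
    by (simp add: block_def qouter_def coeffs_def xy qcnj_mult qcnj_qcnj)
  have "(\<Sum>a\<in>UNIV. \<Sum>b\<in>UNIV. (v $ a * v $ b) *\<^sub>R ((1/2) *\<^sub>R (x a * qcnj (y b) + x b * qcnj (y a))))
      = (1/2) *\<^sub>R (\<Sum>a\<in>UNIV. \<Sum>b\<in>UNIV. (v $ a * v $ b) *\<^sub>R (x a * qcnj (y b)))
      + (1/2) *\<^sub>R (\<Sum>b\<in>UNIV. \<Sum>a\<in>UNIV. (v $ b * v $ a) *\<^sub>R (x b * qcnj (y a)))"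
    by (subst (2) sum.swap) (simp add: scaleR_sum_right scaleR_right_distrib sum.distrib mult.commute)
  also have "\<dots> = c v * qcnj (d v)"
    unfolding bilinear_sum_qcnj v[symmetric] by (simp add: scaleR_left_distrib[symmetric])
  finally show "sq1 c d v = qform (block (qouter (coeffs c d))) v"
    by (simp add: prod_eq_iff qform_sel b qRe_bilinear_sum v[symmetric] sq1_def)
qed

text \<open>With conjugated coefficients the lower left block of the outer product carries the
  reversed product, and partial transposition moves it to the upper right.\<close>

lemma sq2_eq_qform:
  assumes "linear c" "linear d"
  shows "sq2 c d = qform (block (partial_transpose (qouter (coeffs (\<lambda>v. qcnj (c v)) (\<lambda>v. qcnj (d v))))))"
    (is "_ = qform (block ?X)")
proof
  fix v
  define x y where "x = (\<lambda>a. c (axis a 1))" "y = (\<lambda>a. d (axis a 1))"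
  note xy = this
  have v: "c v = (\<Sum>a\<in>UNIV. v $ a *\<^sub>R x a)" "d v = (\<Sum>a\<in>UNIV. v $ a *\<^sub>R y a)"
    unfolding xy by (rule linear_axis_expansion[OF assms(1)] linear_axis_expansion[OF assms(2)])+
  have b: "block ?X a b = (qRe (qcnj (x a) * x b), qRe (qcnj (y a) * y b),
      (1/2) *\<^sub>R (qcnj (y a) * x b + qcnj (y b) * x a))" for a b
    by (simp add: block_def partial_transpose_def qouter_def coeffs_def xy qcnj_mult qcnj_qcnj)
  have "(\<Sum>a\<in>UNIV. \<Sum>b\<in>UNIV. (v $ a * v $ b) *\<^sub>R ((1/2) *\<^sub>R (qcnj (y a) * x b + qcnj (y b) * x a)))
      = (1/2) *\<^sub>R (\<Sum>a\<in>UNIV. \<Sum>b\<in>UNIV. (v $ a * v $ b) *\<^sub>R (qcnj (y a) * x b))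
      + (1/2) *\<^sub>R (\<Sum>b\<in>UNIV. \<Sum>a\<in>UNIV. (v $ b * v $ a) *\<^sub>R (qcnj (y b) * x a))"
    by (subst (2) sum.swap) (simp add: scaleR_sum_right scaleR_right_distrib sum.distrib mult.commute)
  also have "\<dots> = qcnj (d v) * c v"
    unfolding bilinear_sum_qcnj v[symmetric] by (simp add: scaleR_left_distrib[symmetric])
  finally show "sq2 c d v = qform (block ?X) v"
    by (simp add: prod_eq_iff qform_sel b qRe_bilinear_sum v[symmetric] sq2_def)
qed

lemma inner_partial_transpose:
  fixes M X :: "quat^(2 \<times> 'n::finite)^(2 \<times> 'n)"
  shows "M \<bullet> partial_transpose X = partial_transpose M \<bullet> X"
  unfolding inner_vec_def sum_UNIV_prod sum_2 partial_transpose_def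
  by (simp add: sum.distrib algebra_simps)

lemma inner_qouter_psd: "M \<in> quat_psd \<Longrightarrow> 0 \<le> M \<bullet> qouter w"
  by (simp add: quat_psd_iff inner_vec_def qouter_def)

text \<open>Here PPT enters: positivity of \<open>M\<close> handles squares of the first kind,
  positivity of its partial transpose those of the second, as partial transposition is
  self-adjoint.\<close>

lemma sq_positive_pairing:
  fixes M :: "quat^(2 \<times> 'n::finite)^(2 \<times> 'n)"
  assumes M: "M \<in> herm_tensor_sym" and ppt: "PPT M"
  shows "sq_positive (pairing M)"
  using ppt unfolding sq_positive_def
  by (simp add: pairing_linear sq1_eq_qform sq2_eq_qform pairing_qform[OF M]
      inner_partial_transpose inner_qouter_psd PPT_def)

text \<open>Self-duality of the cone, tested on the diagonal units and on rank-one matrices built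
  from q itself.\<close>

lemma psd2_dual:
  assumes "\<And>z. z \<in> psd2 \<Longrightarrow> 0 \<le> hpair z w"
  shows "w \<in> psd2"
proof -
  obtain a b q where w: "w = (a, b, q)" by (metis prod_cases3)
  have ab: "0 \<le> a" "0 \<le> b"
    using assms[of "(1, 0, 0)"] assms[of "(0, 1, 0)"] by (simp_all add: w hpair_def psd2_def)
  show ?thesis
    unfolding w
  proof (rule psd2_of_quadratic[OF ab])
    fix s t :: real
    have "(s\<^sup>2 * (norm q)\<^sup>2, t\<^sup>2, (s * t) *\<^sub>R q) \<in> psd2"
      by (simp add: psd2_def power_mult_distrib mult_ac)
    from assms[OF this] show "0 \<le> a * s\<^sup>2 * (norm q)\<^sup>2 + b * t\<^sup>2 + 2 * s * t * (norm q)\<^sup>2"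
      by (simp add: w hpair_def dot_square_norm mult_ac)
  qed
qed

section \<open>A compact base of the separable cone\<close>

lemma block_kron_outer: "block (kron (herm_mat z) (outer v)) a b = (v $ a * v $ b) *\<^sub>R z"
  by (cases z) (simp add: block_def kron_def outer_def qcnj_scaleR qcnj_qcnj scaleR_2[symmetric])

lemma kron_herm_mat_in_herm_tensor_sym:
  fixes v :: "real^'n"
  assumes "z \<in> psd2"
  shows "kron (herm_mat z) (outer v) \<in> herm_tensor_sym"
  using separable_imp_PPT(2)[OF separable_kron[OF herm_mat_psd[OF assms] outer_psd]] .

lemma inner_kron_outer:
  fixes X :: "quat^(2 \<times> 'n::finite)^(2 \<times> 'n)"
  assumes "z \<in> psd2"
  shows "kron (herm_mat z) (outer v) \<bullet> X = hpair z (qform (block X) v)"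
proof -
  have "hpair (r *\<^sub>R z) w = r * hpair z w" for r w
    using linear_scale[OF linear_hpair, of w r z] by (simp add: hpair_commute)
  then show ?thesis
    unfolding inner_block[OF kron_herm_mat_in_herm_tensor_sym[OF assms]] block_kron_outer qform_def
    by (simp add: linear_sum[OF linear_hpair] linear_scale[OF linear_hpair])
qed

lemma kron_outer_scaleR:
  "kron (herm_mat (r *\<^sub>R z)) (outer (s *\<^sub>R v)) = (r * s\<^sup>2) *\<^sub>R kron (herm_mat z) (outer v)"
proof -
  have "herm_mat (r *\<^sub>R z) = r *\<^sub>R herm_mat z"
    by (simp add: vec_eq_iff forall_2 qcnj_scaleR)
  then show ?thesis by (simp add: kron_def outer_def vec_eq_iff power2_eq_square mult_ac)
qed

text \<open>Normalised to trace 1, so that the set is compact and its convex hull misses 0; this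
  makes the generated cone closed.\<close>

definition unit_products :: "(quat^(2 \<times> 'n::finite)^(2 \<times> 'n)) set"
  where "unit_products = (\<lambda>p. kron (herm_mat (fst p)) (outer (snd p))) `
    ({z \<in> psd2. fst z + fst (snd z) = 1} \<times> sphere 0 1)"

lemma compact_unit_products: "compact unit_products"
  unfolding unit_products_def
proof (intro compact_continuous_image compact_Times compact_sphere)
  have cont: "continuous_on S (\<lambda>p. herm_mat (fst p) $ i $ j)" for S i j
    using exhaust_2[of i] exhaust_2[of j]
    by (elim disjE; simp only: herm_mat_nth; intro continuous_intros)
  show "continuous_on ({z \<in> psd2. fst z + fst (snd z) = 1} \<times> sphere 0 1)
      (\<lambda>p. kron (herm_mat (fst p)) (outer (snd p :: real^'n)))"
    unfolding kron_def outer_def vec_lambda_beta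
    by (intro continuous_on_vec_lambda continuous_on_scaleR cont) (intro continuous_intros)
  show "compact {z \<in> psd2. fst z + fst (snd z) = 1}"
    unfolding compact_eq_bounded_closed
  proof
    have "norm z \<le> 3" if "z \<in> psd2" "fst z + fst (snd z) = 1" for z
    proof -
      obtain a b q where z: "z = (a, b, q)" by (metis prod_cases3)
      have ab: "0 \<le> a" "0 \<le> b" "(norm q)\<^sup>2 \<le> a * b" "a + b = 1"
        using that by (simp_all add: z psd2_def)
      have "a * b \<le> 1 * 1" using ab by (intro mult_mono) auto
      then have "(norm q)\<^sup>2 \<le> 1\<^sup>2" using ab by simp
      then have "norm q \<le> 1" by (rule power2_le_imp_le) simp
      moreover have "norm z \<le> norm a + (norm b + norm q)"
        unfolding z by (intro order_trans[OF norm_Pair_le] add_left_mono order_refl)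
      ultimately show ?thesis using ab by simp
    qed
    then show "bounded {z \<in> psd2. fst z + fst (snd z) = 1}" unfolding bounded_iff by blast
    have "{z \<in> psd2. fst z + fst (snd z) = 1} = {z. 0 \<le> fst z} \<inter> {z. 0 \<le> fst (snd z)}
        \<inter> {z. (norm (snd (snd z)))\<^sup>2 \<le> fst z * fst (snd z)} \<inter> {z. fst z + fst (snd z) = 1}"
      by (auto simp: psd2_def)
    also have "closed \<dots>"
      by (intro closed_Int closed_Collect_le closed_Collect_eq continuous_intros)
    finally show "closed {z \<in> psd2. fst z + fst (snd z) = 1}" .
  qed
qed

lemma zero_notin_hull_unit_products: "0 \<notin> convex hull (unit_products :: (quat^(2 \<times> 'n::finite)^(2 \<times> 'n)) set)"
proof
  define tr :: "quat^(2 \<times> 'n)^(2 \<times> 'n) \<Rightarrow> real" where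
    "tr = (\<lambda>M. \<Sum>a\<in>UNIV. qRe (M $ (1, a) $ (1, a)) + qRe (M $ (2, a) $ (2, a)))"
  have "convex {M. tr M = 1}"
    unfolding convex_def
  proof (intro ballI allI impI, unfold mem_Collect_eq)
    fix M N and u v :: real
    assume *: "tr M = 1" "tr N = 1" "u + v = 1"
    have "tr (u *\<^sub>R M + v *\<^sub>R N) = u * tr M + v * tr N"
      unfolding tr_def by (simp add: sum.distrib sum_distrib_left algebra_simps)
    then show "tr (u *\<^sub>R M + v *\<^sub>R N) = 1" using * by simp
  qed
  moreover have "unit_products \<subseteq> {M. tr M = 1}"
  proof
    fix M :: "quat^(2 \<times> 'n)^(2 \<times> 'n)" assume "M \<in> unit_products"
    then obtain z and v :: "real^'n" where z: "fst z + fst (snd z) = 1" and v: "norm v = 1"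
      and M: "M = kron (herm_mat z) (outer v)" by (auto simp: unit_products_def)
    have "tr M = (\<Sum>a\<in>UNIV. v $ a * v $ a * (fst z + fst (snd z)))"
      unfolding tr_def M by (simp add: kron_def outer_def algebra_simps)
    also have "\<dots> = v \<bullet> v" by (simp add: z inner_vec_def)
    finally show "M \<in> {M. tr M = 1}" using v by (simp add: dot_square_norm)
  qed
  ultimately have "convex hull unit_products \<subseteq> {M. tr M = 1}" by (intro hull_minimal)
  moreover assume "0 \<in> convex hull (unit_products :: (quat^(2 \<times> 'n)^(2 \<times> 'n)) set)"
  ultimately show False by (auto simp: tr_def)
qed

lemma conic_hull_unit_products_separable:
  assumes "M \<in> conic hull (convex hull unit_products)"
  shows "separable M"
proof -
  have "convex {M. separable M}" by (simp add: convex_def separable_add separable_scaleR)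
  moreover have "unit_products \<subseteq> {M. separable M}"
    by (auto simp: unit_products_def intro!: separable_kron herm_mat_psd outer_psd)
  ultimately have "convex hull unit_products \<subseteq> {M. separable M}" by (intro hull_minimal)
  then show ?thesis using assms by (auto simp: conic_hull_explicit separable_scaleR)
qed

lemma kron_in_conic_hull:
  assumes z: "z \<in> psd2"
  shows "kron (herm_mat z) (outer (v :: real^'n)) \<in> conic hull (convex hull unit_products)"
proof -
  obtain a b q where zeq: "z = (a, b, q)" by (metis prod_cases3)
  define t where "t = a + b"
  have ab: "0 \<le> a" "0 \<le> b" "(norm q)\<^sup>2 \<le> a * b" using z by (simp_all add: zeq psd2_def)
  obtain i :: 'n where True by simp
  define e :: "real^'n" where "e = axis i 1"
  have e: "norm e = 1" by (simp add: e_def)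
  \<comment> \<open>For v = 0 or z = 0 an arbitrary normalised choice is made; the scaling factor is
    then 0.\<close>
  define v' where "v' = (if v = 0 then e else v /\<^sub>R norm v)"
  define z' :: herm2 where "z' = (if t = 0 then (1, 0, 0) else (1 / t) *\<^sub>R z)"
  have v': "norm v' = 1" "v = norm v *\<^sub>R v'" using e by (auto simp: v'_def)
  have z': "z' \<in> psd2" "fst z' + fst (snd z') = 1" "z = t *\<^sub>R z'"
  proof -
    show "z' \<in> psd2"
      using psd2_scaleR[OF z, of "1 / t"] ab by (auto simp: z'_def t_def psd2_def)
    show "fst z' + fst (snd z') = 1"
      using ab by (auto simp: z'_def zeq t_def add_divide_distrib[symmetric])
    show "z = t *\<^sub>R z'"
    proof (cases "t = 0")
      case True
      then have "a = 0" "b = 0" using ab by (simp_all add: t_def)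
      then show ?thesis using ab True by (simp add: zeq zero_prod_def)
    qed (simp add: z'_def)
  qed
  have "kron (herm_mat z') (outer v') \<in> convex hull unit_products"
    using v' z' by (intro hull_inc) (force simp: unit_products_def)
  moreover have "kron (herm_mat z) (outer v) = (t * (norm v)\<^sup>2) *\<^sub>R kron (herm_mat z') (outer v')"
    using kron_outer_scaleR[of t z' "norm v" v'] v'(2) z'(3) by simp
  moreover have "0 \<le> t * (norm v)\<^sup>2" using ab by (simp add: t_def)
  ultimately show ?thesis unfolding conic_hull_explicit by blast
qed

text \<open>A matrix outside the closed cone is cut off by some \<open>X\<close>. Nonnegativity of
  \<open>X\<close> on products makes its quadratic map positive by self-duality, hence a limit of
  sums of squares, on which the functional of a PPT matrix is nonnegative.\<close>

lemma PPT_imp_separable: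
  fixes M :: "quat^(2 \<times> 3)^(2 \<times> 3)"
  assumes M: "M \<in> herm_tensor_sym" and ppt: "PPT M"
  shows "separable M"
proof (rule conic_hull_unit_products_separable, rule ccontr)
  let ?C = "conic hull (convex hull unit_products) :: (quat^(2 \<times> 3)^(2 \<times> 3)) set"
  assume "M \<notin> ?C"
  moreover have "closed ?C"
    using zero_notin_hull_unit_products compact_convex_hull[OF compact_unit_products]
    by (intro closed_conic_hull) blast
  moreover have "convex ?C" by (intro convex_conic_hull convex_convex_hull)
  ultimately obtain X b where X: "X \<bullet> M < b" "\<And>Y. Y \<in> ?C \<Longrightarrow> b < X \<bullet> Y"
    using separating_hyperplane_closed_point[of ?C M] by blast
  have scale: "c *\<^sub>R Y \<in> ?C" if "Y \<in> ?C" "0 \<le> c" for c Y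
    using that conic_conic_hull[of "convex hull unit_products"] by (auto simp: conic_def)
  have nonneg: "0 \<le> X \<bullet> Y" if Y: "Y \<in> ?C" for Y
  proof (rule ccontr)
    assume neg: "\<not> 0 \<le> X \<bullet> Y"
    \<comment> \<open>Scaling Y by c brings the value to - |b|, which is not above b.\<close>
    define c where "c = \<bar>b\<bar> / - (X \<bullet> Y)"
    have "0 \<le> c" unfolding c_def by (intro divide_nonneg_nonneg) (use neg in auto)
    then have "b < X \<bullet> (c *\<^sub>R Y)" using X(2) scale[OF Y] by blast
    also have "\<dots> = - \<bar>b\<bar>" using neg by (simp add: c_def)
    finally show False by simp
  qed
  have "kron (herm_mat (0, 0, 0)) (outer (0 :: real^3)) \<in> ?C"
    by (rule kron_in_conic_hull) (simp add: psd2_def)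
  from X(2)[OF scale[OF this, of 0]] have "b < 0" by simp
  have "qform (block X) v \<in> psd2" for v
  proof (rule psd2_dual)
    fix z assume z: "z \<in> psd2"
    show "0 \<le> hpair z (qform (block X) v)"
      using nonneg[OF kron_in_conic_hull[OF z, of v]] inner_kron_outer[OF z, of v X]
      by (simp add: inner_commute)
  qed
  moreover have "quadmap (qform (block X))"
  proof -
    obtain B where "bilinear B" "\<And>u v. B u v = B v u" "qform (block X) = (\<lambda>v. B v v)"
      by (rule qform_bilinear[where G = "block X"]) (rule that)
    then show ?thesis unfolding quadmap_def by blast
  qed
  ultimately have "sos (qform (block X))"
    by (intro pos_quadmap_sos) (simp add: pos_quadmap_def)
  then have "0 \<le> pairing M (qform (block X))"
    using sq_positive_pairing[OF M ppt] by (simp add: sos_def)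
  then have "0 \<le> X \<bullet> M" by (simp add: pairing_qform[OF M] inner_commute)
  with X(1) \<open>b < 0\<close> show False by simp
qed

theorem theorem5p5:
  shows "Gamma_6_3 = Sigma_6_3 \<and>
    (\<forall>M \<in> (herm_tensor_sym :: (quat^(2 \<times> 3)^(2 \<times> 3)) set). separable M \<longleftrightarrow> PPT M)"
  unfolding Gamma_6_3_def Sigma_6_3_def
  using PPT_imp_separable separable_imp_PPT by blast

end
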